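(* The sharp isoperimetric inequality holds for free boundary minimal surfaces in the ball: if $\Sigma$ is a free boundary minimal surface in the unit ball $B^n\subset\mathbb{R}^n$, with area $A$ and boundary length $L$, then $$A\le\frac{L^2}{4\pi}.$$
   Context: A free boundary minimal surface in $B^n$ is a compact (immersed) two-dimensional minimal surface $\Sigma$ in $B^n$ with nonempty boundary $\partial\Sigma\subset\partial B^n$ which meets $\partial B^n$ orthogonally, i.e. whose outward unit conormal along $\partial\Sigma$ equals the position vector. $A$ and $L$ are the area of $\Sigma$ and the length of $\partial\Sigma$ in the induced metric. *)

theory Defs
  imports "HOL-Analysis.Analysis"
begin

section \<open>Calculus on relatively open subsets of the closed half-plane\<close>

definition half_plane :: "(real^2) set" where
  "half_plane = {p. 0 \<le> p $ 2}"

text \<open>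
  Derivatives are taken within the domain, hence one-sided at points of the boundary line. On
  relatively open subsets of the half-plane they are uniquely determined.
\<close>

definition partial_deriv ::
  "(real^2) set \<Rightarrow> (real^2 \<Rightarrow> 'b::real_normed_vector) \<Rightarrow> 2 \<Rightarrow> real^2 \<Rightarrow> 'b" where
  "partial_deriv D f i p = frechet_derivative f (at p within D) (axis i 1)"

fun Ck_on :: "nat \<Rightarrow> (real^2) set \<Rightarrow> (real^2 \<Rightarrow> 'b::real_normed_vector) \<Rightarrow> bool" where
  "Ck_on 0 D f \<longleftrightarrow> continuous_on D f"
| "Ck_on (Suc k) D f \<longleftrightarrow> f differentiable_on D \<and> (\<forall>i. Ck_on k D (partial_deriv D f i))"

definition smooth_on :: "(real^2) set \<Rightarrow> (real^2 \<Rightarrow> 'b::real_normed_vector) \<Rightarrow> bool" where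
  "smooth_on D f \<longleftrightarrow> (\<forall>k. Ck_on k D f)"


section \<open>Smooth surfaces with boundary\<close>

text \<open>
  A patch \<open>(D, X)\<close> is a local parametrization \<open>X : D \<rightarrow> M\<close>, that is, the inverse of a coordinate
  chart. The surface \<open>M\<close> is abstract and carries the subspace topology of its ambient type.
\<close>

type_synonym 'm patch = "(real^2) set \<times> (real^2 \<Rightarrow> 'm)"

definition smooth_surface :: "'m::t2_space set \<Rightarrow> 'm patch set \<Rightarrow> bool" where
  "smooth_surface M P \<longleftrightarrow>
     (\<forall>(D, X) \<in> P. openin (top_of_set half_plane) D \<and> openin (top_of_set M) (X ` D) \<and>
        homeomorphism D (X ` D) X (inv_into D X)) \<and>
     (\<Union>(D, X) \<in> P. X ` D) = M \<and>
     (\<forall>(D, X) \<in> P. \<forall>(E, Y) \<in> P. smooth_on {p \<in> D. X p \<in> Y ` E} (inv_into E Y \<circ> X))"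

definition surface_boundary :: "'m patch set \<Rightarrow> 'm set" where
  "surface_boundary P = {X p | D X p. (D, X) \<in> P \<and> p \<in> D \<and> p $ 2 = 0}"

definition smooth_immersion :: "'m patch set \<Rightarrow> ('m \<Rightarrow> real^'n) \<Rightarrow> bool" where
  "smooth_immersion P F \<longleftrightarrow>
     (\<forall>(D, X) \<in> P. smooth_on D (F \<circ> X) \<and>
        (\<forall>p\<in>D. \<forall>a b. a *\<^sub>R partial_deriv D (F \<circ> X) 1 p + b *\<^sub>R partial_deriv D (F \<circ> X) 2 p = 0
                  \<longrightarrow> a = 0 \<and> b = 0))"


section \<open>Induced metric, mean curvature and conormal of a parametrized piece\<close>

definition induced_metric :: "(real^2) set \<Rightarrow> (real^2 \<Rightarrow> real^'n) \<Rightarrow> real^2 \<Rightarrow> real^2^2" where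
  "induced_metric D f p = (\<chi> i j. partial_deriv D f i p \<bullet> partial_deriv D f j p)"

definition inverse_metric :: "(real^2) set \<Rightarrow> (real^2 \<Rightarrow> real^'n) \<Rightarrow> real^2 \<Rightarrow> real^2^2" where
  "inverse_metric D f p = matrix_inv (induced_metric D f p)"

definition normal_part :: "(real^2) set \<Rightarrow> (real^2 \<Rightarrow> real^'n) \<Rightarrow> real^2 \<Rightarrow> real^'n \<Rightarrow> real^'n" where
  "normal_part D f p v =
     v - (\<Sum>i\<in>UNIV. \<Sum>j\<in>UNIV.
            (inverse_metric D f p $ i $ j * (v \<bullet> partial_deriv D f i p)) *\<^sub>R partial_deriv D f j p)"

definition second_fundamental_form ::
  "(real^2) set \<Rightarrow> (real^2 \<Rightarrow> real^'n) \<Rightarrow> real^2 \<Rightarrow> 2 \<Rightarrow> 2 \<Rightarrow> real^'n" where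
  "second_fundamental_form D f p i j =
     normal_part D f p (partial_deriv D (partial_deriv D f i) j p)"

definition mean_curvature_vector ::
  "(real^2) set \<Rightarrow> (real^2 \<Rightarrow> real^'n) \<Rightarrow> real^2 \<Rightarrow> real^'n" where
  "mean_curvature_vector D f p =
     (\<Sum>i\<in>UNIV. \<Sum>j\<in>UNIV. inverse_metric D f p $ i $ j *\<^sub>R second_fundamental_form D f p i j)"

text \<open>
  At a point \<open>p\<close> of the boundary line, the boundary of the surface is tangent to the first
  coordinate direction, and \<open>a\<close> points out of the half-plane exactly if its second coordinate is
  negative.
\<close>

definition is_outward_unit_conormal ::
  "(real^2) set \<Rightarrow> (real^2 \<Rightarrow> real^'n) \<Rightarrow> real^2 \<Rightarrow> real^'n \<Rightarrow> bool" where
  "is_outward_unit_conormal D f p \<nu> \<longleftrightarrow>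
     norm \<nu> = 1 \<and> \<nu> \<bullet> partial_deriv D f 1 p = 0 \<and>
     (\<exists>a::real^2. a $ 2 < 0 \<and> \<nu> = (\<Sum>i\<in>UNIV. a $ i *\<^sub>R partial_deriv D f i p))"


section \<open>Free boundary minimal surfaces in the unit ball\<close>

definition minimal_immersion :: "'m patch set \<Rightarrow> ('m \<Rightarrow> real^'n) \<Rightarrow> bool" where
  "minimal_immersion P F \<longleftrightarrow>
     smooth_immersion P F \<and> (\<forall>(D, X) \<in> P. \<forall>p\<in>D. mean_curvature_vector D (F \<circ> X) p = 0)"

definition free_boundary_minimal_surface ::
  "'m::t2_space set \<Rightarrow> 'm patch set \<Rightarrow> ('m \<Rightarrow> real^'n) \<Rightarrow> bool" where
  "free_boundary_minimal_surface M P F \<longleftrightarrow>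
     smooth_surface M P \<and> compact M \<and> surface_boundary P \<noteq> {} \<and>
     minimal_immersion P F \<and>
     F ` M \<subseteq> cball 0 1 \<and> F ` surface_boundary P \<subseteq> sphere 0 1 \<and>
     (\<forall>(D, X) \<in> P. \<forall>p\<in>D. p $ 2 = 0 \<longrightarrow> is_outward_unit_conormal D (F \<circ> X) p (F (X p)))"


section \<open>Area and boundary length in the induced metric\<close>

definition patch_area :: "('m \<Rightarrow> real^'n) \<Rightarrow> 'm patch \<Rightarrow> 'm set \<Rightarrow> ennreal" where
  "patch_area F = (\<lambda>(D, X) S.
     \<integral>\<^sup>+p\<in>{p \<in> D. X p \<in> S}. ennreal (sqrt (det (induced_metric D (F \<circ> X) p))) \<partial>lborel)"

definition patch_boundary_length :: "('m \<Rightarrow> real^'n) \<Rightarrow> 'm patch \<Rightarrow> 'm set \<Rightarrow> ennreal" where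
  "patch_boundary_length F = (\<lambda>(D, X) S.
     \<integral>\<^sup>+t\<in>{t. vector [t, 0] \<in> D \<and> X (vector [t, 0]) \<in> S}.
        ennreal (sqrt (induced_metric D (F \<circ> X) (vector [t, 0]) $ 1 $ 1)) \<partial>lborel)"

text \<open>
  A dissection is a finite family of disjoint Borel sets, each lying in the image of one patch. The
  area and the boundary length are the total masses of the Riemannian measures, which are given in
  every patch by \<open>patch_area\<close> and \<open>patch_boundary_length\<close>. The suprema below are attained by any
  dissection covering the surface.
\<close>

definition dissection :: "'m::t2_space patch set \<Rightarrow> ('m patch \<times> 'm set) set \<Rightarrow> bool" where
  "dissection P Q \<longleftrightarrow>
     finite Q \<and> (\<forall>((D, X), S) \<in> Q. (D, X) \<in> P \<and> S \<in> sets borel \<and> S \<subseteq> X ` D) \<and>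
     pairwise (\<lambda>q r. disjnt (snd q) (snd r)) Q"

definition area :: "'m::t2_space patch set \<Rightarrow> ('m \<Rightarrow> real^'n) \<Rightarrow> ennreal" where
  "area P F = (SUP Q\<in>{Q. dissection P Q}. \<Sum>(c, S)\<in>Q. patch_area F c S)"

definition boundary_length :: "'m::t2_space patch set \<Rightarrow> ('m \<Rightarrow> real^'n) \<Rightarrow> ennreal" where
  "boundary_length P F = (SUP Q\<in>{Q. dissection P Q}. \<Sum>(c, S)\<in>Q. patch_boundary_length F c S)"

end

theory Submission
  imports Defs "HOL-Real_Asymp.Real_Asymp"
begin

text \<open>
  On a minimal surface the coordinate functions are harmonic, so by the divergence theorem
  \<open>\<integral> div u dA = \<integral> u \<bullet> F ds\<close> for every ambient-valued \<open>C\<^sup>1\<close> field \<open>u\<close>, where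
  \<open>div u = \<Sum>\<^sub>k \<langle>\<nabla>u\<^sub>k, \<nabla>F\<^sub>k\<rangle>\<close> and the conormal is \<open>F\<close> itself. The field \<open>u = F\<close> gives
  \<open>2 A = L\<close>. For a boundary point \<open>y\<close> the field \<open>u = (F - y) / (|F - y|\<^sup>2 + \<epsilon>\<^sup>2)\<close> satisfies
  \<open>div u \<ge> 2 \<epsilon>\<^sup>2 / (|F - y|\<^sup>2 + \<epsilon>\<^sup>2)\<^sup>2\<close> and \<open>u \<bullet> F \<le> 1/2\<close> on the boundary; blowing up at \<open>y\<close> and
  using Fatou's lemma, the area integral of the lower bound is at least \<open>\<pi>\<close> in the limit
  \<open>\<epsilon> \<rightarrow> 0\<close>. Hence \<open>L \<ge> 2 \<pi>\<close>, and \<open>A = L/2 \<le> L\<^sup>2/(4 \<pi>)\<close>.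
\<close>

section \<open>Calculus on the half-plane\<close>

text \<open>The constants come from the model at the pole. In the tangent plane at \<open>y\<close>
  the lower bound for the divergence reads 2 \<epsilon>^2 / (|v|^2 + \<epsilon>^2)^2, which
  integrates to 2 \<pi> over a plane for every \<epsilon>; a boundary point sees half of that plane.
  The flux bound 1/2 holds because |F - y|^2 = 2 (F - y) \<bullet> F when both points lie on the
  unit sphere. Hence a single boundary pole already gives \<pi> \<le> L/2. Several sheets of the
  immersed surface may pass through \<open>y\<close>; one chart is enough, since the other sheets
  contribute nonnegatively. The obstacle is the passage from charts to the surface. Charts live on
  pieces of the closed half-plane with one-sided derivatives, and area and length are suprema over
  dissections. So density, divergence and the notion of boundary point must be shown to be
  independent of the chart, and the divergence theorem is localized by a C^1 partition of unity. For
  the suprema one-sided comparisons suffice: area is at most the area integral and boundary length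
  at least the length integral, which are the directions in which the final inequality is
  monotone.\<close>

abbreviation rel_open :: "(real^2) set \<Rightarrow> bool" where
  "rel_open D \<equiv> openin (top_of_set half_plane) D"

lemma Basis_vec2: "(Basis :: (real^2) set) = {axis 1 1, axis 2 1}"
  by (auto simp: Basis_vec_def UNIV_2)

text \<open>A derivative within a set is unique as soon as arbitrarily short steps along each basis
  direction stay in the set. From any point of the closed half-plane, positive steps along both axes
  do.\<close>

lemma half_plane_directions:
  assumes "rel_open D" "p \<in> D" "i \<in> Basis" "0 < e"
  shows "\<exists>d. 0 < \<bar>d\<bar> \<and> \<bar>d\<bar> < e \<and> p + d *\<^sub>R i \<in> D"
proof -
  obtain \<delta> where \<delta>: "\<delta> > 0" "ball p \<delta> \<inter> half_plane \<subseteq> D"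
    using assms(1,2) unfolding openin_contains_ball by blast
  define d where "d = min e \<delta> / 2"
  have d: "0 < d" "d < e" "d < \<delta>"
    using assms(4) \<delta>(1) by (auto simp: d_def)
  have "p \<in> half_plane" using assms(1,2) openin_imp_subset by blast
  moreover have "norm i = 1" "0 \<le> i $ 2"
    using assms(3) by (auto simp: Basis_vec2 axis_def)
  ultimately have "p + d *\<^sub>R i \<in> ball p \<delta> \<inter> half_plane"
    using d by (auto simp: half_plane_def dist_norm)
  with \<delta>(2) d show ?thesis by (intro exI[of _ d]) auto
qed

lemma partial_deriv_eq:
  assumes "rel_open D" "p \<in> D" "(f has_derivative f') (at p within D)"
  shows "partial_deriv D f i p = f' (axis i 1)"
proof -
  have "(f has_derivative frechet_derivative f (at p within D)) (at p within D)"
    using assms(3) frechet_derivative_works differentiableI by blast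
  from frechet_derivative_unique_within[OF assms(3) this] half_plane_directions[OF assms(1,2)]
  have "frechet_derivative f (at p within D) = f'" by blast
  then show ?thesis by (simp add: partial_deriv_def)
qed

lemma linear_vec2:
  fixes f' :: "real^2 \<Rightarrow> 'b::real_vector"
  assumes "linear f'"
  shows "f' v = (v $ 1) *\<^sub>R f' (axis 1 1) + (v $ 2) *\<^sub>R f' (axis 2 1)"
proof -
  have "v = (v $ 1) *\<^sub>R axis 1 1 + (v $ 2) *\<^sub>R axis 2 (1::real)"
    by (auto simp: vec_eq_iff axis_def forall_2)
  then have "f' v = f' ((v $ 1) *\<^sub>R axis 1 1 + (v $ 2) *\<^sub>R axis 2 1)" by simp
  also have "\<dots> = (v $ 1) *\<^sub>R f' (axis 1 1) + (v $ 2) *\<^sub>R f' (axis 2 1)"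
    by (simp add: linear_add[OF assms] linear_cmul[OF assms])
  finally show ?thesis .
qed

lemma has_derivative_partials:
  assumes "f differentiable at p within D"
  shows "(f has_derivative (\<lambda>v. (v $ 1) *\<^sub>R partial_deriv D f 1 p + (v $ 2) *\<^sub>R partial_deriv D f 2 p))
           (at p within D)"
proof -
  have *: "(f has_derivative frechet_derivative f (at p within D)) (at p within D)"
    using assms frechet_derivative_works by blast
  have "frechet_derivative f (at p within D)
      = (\<lambda>v. (v $ 1) *\<^sub>R partial_deriv D f 1 p + (v $ 2) *\<^sub>R partial_deriv D f 2 p)"
    unfolding partial_deriv_def
    using linear_vec2[OF has_derivative_linear[OF *]] by blast
  with * show ?thesis by simp
qed

text \<open>The filter depends only on the set near \<open>p\<close>, so a derivative may be
  computed in any smaller relatively open set.\<close>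

lemma at_within_rel_open:
  assumes "rel_open D" "rel_open D'" "D' \<subseteq> D" "p \<in> D'"
  shows "at p within D = at p within D'"
proof -
  have "openin (top_of_set D) D'"
    using assms by (meson openin_imp_subset openin_subset_trans)
  then obtain T where "open T" "D' = D \<inter> T" by (auto simp: openin_open)
  then show ?thesis using at_within_nhd[of p T D D'] assms(4) by auto
qed

lemma partial_deriv_cong:
  assumes "rel_open D" "p \<in> D" "f differentiable at p within D" "\<And>q. q \<in> D \<Longrightarrow> f q = g q"
  shows "g differentiable at p within D" "partial_deriv D g i p = partial_deriv D f i p"
proof -
  have "(g has_derivative (\<lambda>v. (v $ 1) *\<^sub>R partial_deriv D f 1 p + (v $ 2) *\<^sub>R partial_deriv D f 2 p)) (at p within D)"
    by (rule has_derivative_transform[OF assms(2) _ has_derivative_partials[OF assms(3)]])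
       (simp add: assms(4))
  then show "g differentiable at p within D" "partial_deriv D g i p = partial_deriv D f i p"
    using differentiableI apply blast
    unfolding partial_deriv_eq[OF assms(1,2) \<open>(g has_derivative _) _\<close>]
    using exhaust_2[of i] by (auto simp: axis_def)
qed

text \<open>First derivatives are all that the divergence theorem asks of a field, and the cutoffs
  used below are C^1 but not C^2, so \<open>smooth_on\<close> would exclude them.\<close>

definition c1_on :: "(real^2) set \<Rightarrow> (real^2 \<Rightarrow> 'b::real_normed_vector) \<Rightarrow> bool" where
  "c1_on D f \<longleftrightarrow> f differentiable_on D \<and> (\<forall>i. continuous_on D (partial_deriv D f i))"

lemma c1_on_differentiable: "c1_on D f \<Longrightarrow> p \<in> D \<Longrightarrow> f differentiable at p within D"
  by (auto simp: c1_on_def differentiable_on_def)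

lemma c1_on_continuous: "c1_on D f \<Longrightarrow> continuous_on D f"
  by (auto simp: c1_on_def differentiable_imp_continuous_on)

lemma c1_on_continuous_partial: "c1_on D f \<Longrightarrow> continuous_on D (partial_deriv D f i)"
  by (auto simp: c1_on_def)

lemma smooth_on_c1: "smooth_on D f \<Longrightarrow> c1_on D f"
  unfolding smooth_on_def c1_on_def by (auto dest: spec[of _ "Suc 0"])

lemma smooth_on_c1_partial: "smooth_on D f \<Longrightarrow> c1_on D (partial_deriv D f i)"
  unfolding smooth_on_def c1_on_def by (auto dest: spec[of _ "Suc (Suc 0)"])

section \<open>Differentiation rules for partial derivatives within a relatively open set\<close>

context
  fixes D :: "(real^2) set" and p :: "real^2"
  assumes D: "rel_open D" "p \<in> D"
begin

lemma partial_deriv_const: "partial_deriv D (\<lambda>_. c) i p = 0"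
  by (rule partial_deriv_eq[OF D, where f' = "\<lambda>_. 0"]) simp

lemma partial_deriv_add:
  assumes "f differentiable at p within D" "g differentiable at p within D"
  shows "partial_deriv D (\<lambda>q. f q + g q) i p = partial_deriv D f i p + partial_deriv D g i p"
  by (subst partial_deriv_eq[OF D, OF has_derivative_add[OF has_derivative_partials[OF assms(1)] has_derivative_partials[OF assms(2)]]])
     (use exhaust_2[of i] in \<open>auto simp: axis_def\<close>)

lemma partial_deriv_diff:
  assumes "f differentiable at p within D" "g differentiable at p within D"
  shows "partial_deriv D (\<lambda>q. f q - g q) i p = partial_deriv D f i p - partial_deriv D g i p"
  by (subst partial_deriv_eq[OF D, OF has_derivative_diff[OF has_derivative_partials[OF assms(1)] has_derivative_partials[OF assms(2)]]])
     (use exhaust_2[of i] in \<open>auto simp: axis_def\<close>)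

lemma partial_deriv_scaleR:
  assumes "f differentiable at p within D" "g differentiable at p within D"
  shows "partial_deriv D (\<lambda>q. f q *\<^sub>R g q) i p = f p *\<^sub>R partial_deriv D g i p + partial_deriv D f i p *\<^sub>R g p"
  by (subst partial_deriv_eq[OF D, OF has_derivative_scaleR[OF has_derivative_partials[OF assms(1)] has_derivative_partials[OF assms(2)]]])
     (use exhaust_2[of i] in \<open>auto simp: axis_def\<close>)

lemma partial_deriv_mult:
  fixes f g :: "_ \<Rightarrow> real"
  assumes "f differentiable at p within D" "g differentiable at p within D"
  shows "partial_deriv D (\<lambda>q. f q * g q) i p = f p * partial_deriv D g i p + partial_deriv D f i p * g p"
  using partial_deriv_scaleR[OF assms, of i] by simp

lemma partial_deriv_inner:
  assumes "f differentiable at p within D" "g differentiable at p within D"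
  shows "partial_deriv D (\<lambda>q. f q \<bullet> g q) i p = f p \<bullet> partial_deriv D g i p + partial_deriv D f i p \<bullet> g p"
  by (subst partial_deriv_eq[OF D, OF has_derivative_inner[OF has_derivative_partials[OF assms(1)] has_derivative_partials[OF assms(2)]]])
     (use exhaust_2[of i] in \<open>auto simp: axis_def\<close>)

lemma partial_deriv_chain_real:
  fixes f :: "_ \<Rightarrow> real"
  assumes "f differentiable at p within D" "(h has_real_derivative h') (at (f p))"
  shows "(\<lambda>q. h (f q)) differentiable at p within D"
    "partial_deriv D (\<lambda>q. h (f q)) i p = h' * partial_deriv D f i p"
proof -
  have "((\<lambda>q. h (f q)) has_derivative
     (\<lambda>v. h' * ((v $ 1) *\<^sub>R partial_deriv D f 1 p + (v $ 2) *\<^sub>R partial_deriv D f 2 p))) (at p within D)"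
    using has_derivative_compose[OF has_derivative_partials[OF assms(1)], of h "(*) h'"] assms(2)
    by (auto simp: has_field_derivative_def)
  then show "(\<lambda>q. h (f q)) differentiable at p within D"
    "partial_deriv D (\<lambda>q. h (f q)) i p = h' * partial_deriv D f i p"
     apply (blast intro: differentiableI)
    by (subst partial_deriv_eq[OF D \<open>((\<lambda>q. h (f q)) has_derivative _) _\<close>])
     (use exhaust_2[of i] in \<open>auto simp: axis_def\<close>)
qed

end

section \<open>Closure properties of C^1 functions\<close>

lemma c1_onI:
  assumes "\<And>p. p \<in> D \<Longrightarrow> f differentiable at p within D"
    and "\<And>i p. p \<in> D \<Longrightarrow> partial_deriv D f i p = g i p" "\<And>i. continuous_on D (g i)"
  shows "c1_on D f"
  unfolding c1_on_def differentiable_on_def using assms(1,2) continuous_on_eq[OF assms(3)] by metis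

lemma c1_on_const: "rel_open D \<Longrightarrow> c1_on D (\<lambda>_. c)"
  by (auto simp: c1_on_def partial_deriv_const cong: continuous_on_cong)

lemma c1_on_cong:
  assumes "rel_open D" "c1_on D f" "\<And>q. q \<in> D \<Longrightarrow> f q = g q"
  shows "c1_on D g"
  unfolding c1_on_def differentiable_on_def
proof (intro conjI ballI allI)
  fix p assume p: "p \<in> D"
  show "g differentiable at p within D"
    by (rule partial_deriv_cong(1)[OF assms(1) p c1_on_differentiable[OF assms(2) p] assms(3)])
next
  fix i show "continuous_on D (partial_deriv D g i)"
    by (rule continuous_on_eq[OF c1_on_continuous_partial[OF assms(2)]])
       (rule partial_deriv_cong(2)[OF assms(1) _ c1_on_differentiable[OF assms(2)] assms(3), symmetric])
qed

lemma c1_on_add: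
  assumes "rel_open D" "c1_on D f" "c1_on D g" shows "c1_on D (\<lambda>q. f q + g q)"
  by (rule c1_onI[OF _ partial_deriv_add[OF assms(1)]])
     (auto intro!: continuous_intros differentiable_add differentiable_diff c1_on_continuous_partial[OF assms(2)] c1_on_continuous_partial[OF assms(3)] c1_on_continuous[OF assms(2)] c1_on_continuous[OF assms(3)] c1_on_differentiable[OF assms(2)] c1_on_differentiable[OF assms(3)])

lemma c1_on_diff:
  assumes "rel_open D" "c1_on D f" "c1_on D g" shows "c1_on D (\<lambda>q. f q - g q)"
  by (rule c1_onI[OF _ partial_deriv_diff[OF assms(1)]])
     (auto intro!: continuous_intros differentiable_add differentiable_diff c1_on_continuous_partial[OF assms(2)] c1_on_continuous_partial[OF assms(3)] c1_on_continuous[OF assms(2)] c1_on_continuous[OF assms(3)] c1_on_differentiable[OF assms(2)] c1_on_differentiable[OF assms(3)])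

lemma c1_on_scaleR:
  assumes "rel_open D" "c1_on D f" "c1_on D g" shows "c1_on D (\<lambda>q. f q *\<^sub>R g q)"
  by (rule c1_onI[OF _ partial_deriv_scaleR[OF assms(1)]])
     (auto intro!: continuous_intros differentiable_scaleR c1_on_continuous_partial[OF assms(2)] c1_on_continuous_partial[OF assms(3)] c1_on_continuous[OF assms(2)] c1_on_continuous[OF assms(3)] c1_on_differentiable[OF assms(2)] c1_on_differentiable[OF assms(3)])

lemma c1_on_mult:
  fixes f g :: "_ \<Rightarrow> real"
  assumes "rel_open D" "c1_on D f" "c1_on D g" shows "c1_on D (\<lambda>q. f q * g q)"
  using c1_on_scaleR[OF assms] by simp

lemma c1_on_inner:
  assumes "rel_open D" "c1_on D f" "c1_on D g" shows "c1_on D (\<lambda>q. f q \<bullet> g q)"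
  by (rule c1_onI[OF _ partial_deriv_inner[OF assms(1)]])
     (auto intro!: continuous_intros differentiable_inner c1_on_continuous_partial[OF assms(2)] c1_on_continuous_partial[OF assms(3)] c1_on_continuous[OF assms(2)] c1_on_continuous[OF assms(3)] c1_on_differentiable[OF assms(2)] c1_on_differentiable[OF assms(3)])

lemma c1_on_sum:
  assumes "rel_open D" "\<And>j. j \<in> I \<Longrightarrow> c1_on D (f j)" shows "c1_on D (\<lambda>q. \<Sum>j\<in>I. f j q)"
  using assms(2) by (induction I rule: infinite_finite_induct) (auto intro: c1_on_const c1_on_add assms(1))

lemma c1_on_chain_real:
  fixes f :: "_ \<Rightarrow> real"
  assumes D: "rel_open D" and f: "c1_on D f"
    and h: "\<And>q. q \<in> D \<Longrightarrow> (h has_real_derivative h' (f q)) (at (f q))" "continuous_on (f ` D) h'"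
  shows "c1_on D (\<lambda>q. h (f q))"
  unfolding c1_on_def differentiable_on_def
proof (intro conjI ballI allI)
  fix q assume q: "q \<in> D"
  show "(\<lambda>q. h (f q)) differentiable at q within D"
    by (rule partial_deriv_chain_real[OF D q c1_on_differentiable[OF f q] h(1)[OF q]])
next
  fix i
  have "continuous_on D (\<lambda>q. h' (f q) * partial_deriv D f i q)"
    by (intro continuous_intros continuous_on_compose2[OF h(2) c1_on_continuous[OF f]] c1_on_continuous_partial[OF f]) auto
  then show "continuous_on D (partial_deriv D (\<lambda>q. h (f q)) i)"
    by (rule continuous_on_eq) (simp add: partial_deriv_chain_real(2)[OF D _ c1_on_differentiable[OF f] h(1)])
qed

lemma c1_on_inverse:
  fixes f :: "_ \<Rightarrow> real"
  assumes "rel_open D" "c1_on D f" "\<And>q. q \<in> D \<Longrightarrow> f q \<noteq> 0"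
  shows "c1_on D (\<lambda>q. inverse (f q))"
  by (rule c1_on_chain_real[OF assms(1,2), where h' = "\<lambda>x. - inverse (x\<^sup>2)"])
     (use assms(3) in \<open>auto intro!: continuous_intros derivative_eq_intros simp: power2_eq_square\<close>)

lemma c1_on_sqrt:
  assumes "rel_open D" "c1_on D f" "\<And>q. q \<in> D \<Longrightarrow> 0 < f q"
  shows "c1_on D (\<lambda>q. sqrt (f q))"
  by (rule c1_on_chain_real[OF assms(1,2), where h' = "\<lambda>x. inverse (sqrt x) / 2"])
     (use assms(3) in \<open>auto intro!: continuous_intros DERIV_real_sqrt simp: image_iff\<close>, fastforce)

text \<open>Squaring the positive part removes its corner: at 0 the difference quotient is bounded
  by |h|, and elsewhere the function agrees locally with x^2 or 0. This is the profile of the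
  cutoffs in the partition of unity.\<close>

lemma max_0_square_has_derivative:
  "((\<lambda>x::real. (max 0 x)\<^sup>2) has_real_derivative 2 * max 0 x) (at x)"
proof -
  consider "x > 0" | "x < 0" | "x = 0" by linarith
  then show ?thesis
  proof cases
    case 1
    have "((\<lambda>x::real. x\<^sup>2) has_real_derivative 2 * max 0 x) (at x)"
      using 1 by (auto intro!: derivative_eq_intros)
    then show ?thesis
      by (rule has_field_derivative_transform_within_open[where S = "{0<..}"]) (use 1 in auto)
  next
    case 2
    have "((\<lambda>x::real. 0) has_real_derivative 2 * max 0 x) (at x)"
      using 2 by (auto intro!: derivative_eq_intros)
    then show ?thesis
      by (rule has_field_derivative_transform_within_open[where S = "{..<0}"]) (use 2 in auto)
  next
    case 3
    have "((\<lambda>h. (max 0 h)\<^sup>2 / h) \<longlongrightarrow> 0) (at (0::real))"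
    proof (rule Lim_null_comparison)
      show "\<forall>\<^sub>F h in at 0. norm ((max 0 h)\<^sup>2 / h) \<le> \<bar>h::real\<bar>"
        by (rule always_eventually) (auto simp: max_def power2_eq_square)
      show "((\<lambda>h. \<bar>h\<bar>) \<longlongrightarrow> 0) (at (0::real))" by (auto intro!: tendsto_eq_intros)
    qed
    with 3 show ?thesis by (simp add: DERIV_def)
  qed
qed

lemma c1_on_max_0_square:
  fixes f :: "_ \<Rightarrow> real"
  assumes "rel_open D" "c1_on D f"
  shows "c1_on D (\<lambda>q. (max 0 (f q))\<^sup>2)"
  by (rule c1_on_chain_real[OF assms, where h' = "\<lambda>x. 2 * max 0 x"]) (intro max_0_square_has_derivative continuous_intros)+

text \<open>Being C^1 is local: at each point the filter within the union is the filter within one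
  of the two pieces. It glues a cutoff to its zero extension.\<close>

lemma c1_on_Un:
  assumes A: "rel_open A" "c1_on A f" and B: "rel_open B" "c1_on B f"
  shows "c1_on (A \<union> B) f"
proof -
  have AB: "rel_open (A \<union> B)" using assms by blast
  have *: "at p within (A \<union> B) = at p within A" if "p \<in> A" for p
    using at_within_rel_open[OF AB A(1)] that by auto
  have **: "at p within (A \<union> B) = at p within B" if "p \<in> B" for p
    using at_within_rel_open[OF AB B(1)] that by auto
  have pd: "partial_deriv (A \<union> B) f i p = partial_deriv A f i p" if "p \<in> A" for i p
    unfolding partial_deriv_def *[OF that] ..
  have pd': "partial_deriv (A \<union> B) f i p = partial_deriv B f i p" if "p \<in> B" for i p
    unfolding partial_deriv_def **[OF that] ..
  have "openin (top_of_set (A \<union> B)) A" "openin (top_of_set (A \<union> B)) B"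
    using A(1) B(1) AB by (meson Un_upper1 Un_upper2 openin_imp_subset openin_subset_trans)+
  then have "continuous_on (A \<union> B) (partial_deriv (A \<union> B) f i)" for i
    using continuous_on_eq[OF c1_on_continuous_partial[OF A(2)] pd[symmetric]]
      continuous_on_eq[OF c1_on_continuous_partial[OF B(2)] pd'[symmetric]]
    by (intro continuous_on_Un_local_open) auto
  moreover have "f differentiable at p within (A \<union> B)" if "p \<in> A \<union> B" for p
    using that * ** c1_on_differentiable[OF A(2)] c1_on_differentiable[OF B(2)] by auto
  ultimately show ?thesis by (auto simp: c1_on_def differentiable_on_def)
qed

section \<open>Traces in a moving frame\<close>

definition gram :: "'a::real_inner \<Rightarrow> 'a \<Rightarrow> real" where
  "gram a b = (a \<bullet> a) * (b \<bullet> b) - (a \<bullet> b)\<^sup>2"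

text \<open>With e_1 = a, e_2 = b, u_1 = u, u_2 = v and g the Gram matrix of the frame, this is g^ij
  (u_i \<bullet> e_j): the trace of the tangential part of the linear map that sends
  \<open>a\<close> to \<open>u\<close> and \<open>b\<close> to \<open>v\<close>. For u_i the partial
  derivatives of an ambient-valued field it is the divergence of that field along the
  surface.\<close>

definition frame_trace :: "'a::real_inner \<Rightarrow> 'a \<Rightarrow> 'a \<Rightarrow> 'a \<Rightarrow> real" where
  "frame_trace a b u v =
     ((b \<bullet> b) * (u \<bullet> a) - (a \<bullet> b) * (u \<bullet> b + v \<bullet> a) + (a \<bullet> a) * (v \<bullet> b)) / gram a b"

lemma gram_pos:
  assumes indep: "\<And>s t. s *\<^sub>R a + t *\<^sub>R b = 0 \<Longrightarrow> s = 0 \<and> t = 0"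
  shows "0 < gram a b"
proof -
  \<comment> \<open>\<open>w\<close> is |a|^2 times the component of \<open>b\<close> orthogonal to
    \<open>a\<close>.\<close>
  define w where "w = (a \<bullet> a) *\<^sub>R b - (a \<bullet> b) *\<^sub>R a"
  have a: "a \<noteq> 0" using indep[of 1 0] by auto
  have "w = (- (a \<bullet> b)) *\<^sub>R a + (a \<bullet> a) *\<^sub>R b" by (simp add: w_def)
  with indep a have "w \<noteq> 0" by (metis inner_eq_zero_iff)
  then have "0 < w \<bullet> w" by simp
  also have "w \<bullet> w = (a \<bullet> a) * gram a b"
    by (simp add: w_def gram_def inner_simps inner_commute[of b a] algebra_simps power2_eq_square)
  finally show ?thesis using a inner_gt_zero_iff zero_less_mult_pos by blast
qed

lemma gram_transform:
  "gram (\<alpha> *\<^sub>R a + \<beta> *\<^sub>R b) (\<gamma> *\<^sub>R a + \<delta> *\<^sub>R b) = (\<alpha> * \<delta> - \<beta> * \<gamma>)\<^sup>2 * gram a b"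
  unfolding gram_def by (simp add: inner_simps inner_commute[of b a]) algebra

text \<open>A trace does not depend on the basis: numerator and Gram determinant both pick up the
  squared determinant of the change of frame.\<close>

lemma frame_trace_transform:
  assumes "\<alpha> * \<delta> - \<beta> * \<gamma> \<noteq> 0"
  shows "frame_trace (\<alpha> *\<^sub>R a + \<beta> *\<^sub>R b) (\<gamma> *\<^sub>R a + \<delta> *\<^sub>R b) (\<alpha> *\<^sub>R u + \<beta> *\<^sub>R v) (\<gamma> *\<^sub>R u + \<delta> *\<^sub>R v)
    = frame_trace a b u v"
proof -
  define A B C ua ub va vb where defs: "A = a \<bullet> a" "B = a \<bullet> b" "C = b \<bullet> b"
    "ua = u \<bullet> a" "ub = u \<bullet> b" "va = v \<bullet> a" "vb = v \<bullet> b"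
  have "frame_trace (\<alpha> *\<^sub>R a + \<beta> *\<^sub>R b) (\<gamma> *\<^sub>R a + \<delta> *\<^sub>R b) (\<alpha> *\<^sub>R u + \<beta> *\<^sub>R v) (\<gamma> *\<^sub>R u + \<delta> *\<^sub>R v)
     = (\<alpha> * \<delta> - \<beta> * \<gamma>)\<^sup>2 * (C * ua - B * (ub + va) + A * vb) / ((\<alpha> * \<delta> - \<beta> * \<gamma>)\<^sup>2 * gram a b)"
    unfolding frame_trace_def gram_transform
    apply (rule arg_cong[where f = "\<lambda>x. x / _"])
    apply (simp add: inner_simps inner_commute[of b a] defs[symmetric])
    by algebra
  also have "\<dots> = frame_trace a b u v"
    using assms by (simp add: frame_trace_def defs)
  finally show ?thesis .
qed

lemma frame_trace_self: "gram a b \<noteq> 0 \<Longrightarrow> frame_trace a b a b = 2"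
  by (simp add: frame_trace_def gram_def inner_commute[of b a] field_simps power2_eq_square)

lemma frame_trace_0 [simp]: "frame_trace a b 0 0 = 0"
  by (simp add: frame_trace_def)

lemma frame_trace_add:
  "frame_trace a b (u + u') (v + v') = frame_trace a b u v + frame_trace a b u' v'"
  by (simp add: frame_trace_def inner_simps add_divide_distrib[symmetric] algebra_simps)

lemma frame_trace_scaleR: "frame_trace a b (c *\<^sub>R u) (c *\<^sub>R v) = c * frame_trace a b u v"
  by (simp add: frame_trace_def algebra_simps)

lemma frame_trace_sum:
  "frame_trace a b (\<Sum>j\<in>J. u j) (\<Sum>j\<in>J. v j) = (\<Sum>j\<in>J. frame_trace a b (u j) (v j))"
  by (induction J rule: infinite_finite_induct) (auto simp: frame_trace_add)

text \<open>The map that sends e to (z \<bullet> e) z has trace equal to the squared length of the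
  tangential part of \<open>z\<close>, and projection does not increase length. In the proof
  \<open>t\<close> is the Gram determinant times that tangential part, so the inequality is the
  nonnegativity of the squared normal part.\<close>

lemma frame_trace_rank_one_le:
  assumes "gram a b > 0"
  shows "frame_trace a b ((z \<bullet> a) *\<^sub>R z) ((z \<bullet> b) *\<^sub>R z) \<le> z \<bullet> z"
proof -
  define A B C za zb g where defs: "A = a \<bullet> a" "B = a \<bullet> b" "C = b \<bullet> b" "za = z \<bullet> a" "zb = z \<bullet> b" "g = gram a b"
  define t where "t = (C * za - B * zb) *\<^sub>R a + (A * zb - B * za) *\<^sub>R b"
  define q where "q = C * za * za - 2 * B * za * zb + A * zb * zb"
  have g: "g = A * C - B * B" "g > 0" using assms by (simp_all add: defs gram_def power2_eq_square)
  have 1: "z \<bullet> t = q" by (simp add: t_def q_def inner_simps defs algebra_simps)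
  have "t \<bullet> t = (C * za - B * zb)\<^sup>2 * A + 2 * (C * za - B * zb) * (A * zb - B * za) * B + (A * zb - B * za)\<^sup>2 * C"
    by (simp add: t_def inner_simps defs inner_commute[of b a] power2_eq_square algebra_simps)
  also have "\<dots> = g * q" unfolding g(1) q_def by (simp add: power2_eq_square algebra_simps)
  finally have 2: "t \<bullet> t = g * q" .
  have "0 \<le> (g *\<^sub>R z - t) \<bullet> (g *\<^sub>R z - t)" by simp
  also have "\<dots> = g * g * (z \<bullet> z) - 2 * g * (z \<bullet> t) + t \<bullet> t"
    by (simp add: inner_simps inner_commute[of t z] algebra_simps)
  also have "\<dots> = g * (g * (z \<bullet> z) - q)" by (simp add: 1 2 algebra_simps)
  finally have "q \<le> g * (z \<bullet> z)" using g(2) by (simp add: zero_le_mult_iff)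
  moreover have "frame_trace a b ((z \<bullet> a) *\<^sub>R z) ((z \<bullet> b) *\<^sub>R z) = q / g"
    by (simp add: frame_trace_def q_def defs algebra_simps)
  ultimately show ?thesis using g(2) by (simp add: pos_divide_le_eq mult.commute)
qed

text \<open>Schwarz's argument: the second difference of \<open>g\<close> over a square of side
  \<open>h\<close> is evaluated twice by the mean value theorem, once in each order of the
  variables, which yields equal values of the two mixed derivatives at points within the square.
  Continuity at the corner finishes as \<open>h\<close> tends to 0.\<close>

lemma equality_of_mixed_partials:
  fixes g gx gy gxy gyx :: "real \<Rightarrow> real \<Rightarrow> real"
  assumes r: "r > 0"
    and gx: "\<And>x y. \<bar>x - x0\<bar> < r \<Longrightarrow> \<bar>y - y0\<bar> < r \<Longrightarrow> ((\<lambda>x. g x y) has_real_derivative gx x y) (at x)"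
    and gy: "\<And>x y. \<bar>x - x0\<bar> < r \<Longrightarrow> \<bar>y - y0\<bar> < r \<Longrightarrow> ((\<lambda>y. g x y) has_real_derivative gy x y) (at y)"
    and gxy: "\<And>x y. \<bar>x - x0\<bar> < r \<Longrightarrow> \<bar>y - y0\<bar> < r \<Longrightarrow> ((\<lambda>y. gx x y) has_real_derivative gxy x y) (at y)"
    and gyx: "\<And>x y. \<bar>x - x0\<bar> < r \<Longrightarrow> \<bar>y - y0\<bar> < r \<Longrightarrow> ((\<lambda>x. gy x y) has_real_derivative gyx x y) (at x)"
    and cont: "isCont (\<lambda>(x, y). gxy x y) (x0, y0)" "isCont (\<lambda>(x, y). gyx x y) (x0, y0)"
  shows "gxy x0 y0 = gyx x0 y0"
proof -
  have ex: "\<exists>x y x' y'. x \<in> {x0..x0+h} \<and> y \<in> {y0..y0+h} \<and> x' \<in> {x0..x0+h} \<and> y' \<in> {y0..y0+h} \<and> gxy x y = gyx x' y'"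
    if h: "0 < h" "h < r" for h
  proof -
    have "\<exists>x. x0 < x \<and> x < x0 + h \<and> (g (x0+h) (y0+h) - g (x0+h) y0) - (g x0 (y0+h) - g x0 y0)
        = (x0 + h - x0) * (gx x (y0+h) - gx x y0)"
      by (rule MVT2[of x0 "x0+h" "\<lambda>x. g x (y0+h) - g x y0"]) (use h in \<open>auto intro!: DERIV_diff gx\<close>)
    then obtain x where x: "x0 < x" "x < x0 + h"
      "(g (x0+h) (y0+h) - g (x0+h) y0) - (g x0 (y0+h) - g x0 y0) = h * (gx x (y0+h) - gx x y0)" by auto
    have "\<exists>y. y0 < y \<and> y < y0 + h \<and> gx x (y0+h) - gx x y0 = (y0 + h - y0) * gxy x y"
      by (rule MVT2) (use h x in \<open>auto intro!: gxy\<close>)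
    then obtain y where y: "y0 < y" "y < y0 + h" "gx x (y0+h) - gx x y0 = h * gxy x y" by auto
    have "\<exists>y. y0 < y \<and> y < y0 + h \<and> (g (x0+h) (y0+h) - g x0 (y0+h)) - (g (x0+h) y0 - g x0 y0)
        = (y0 + h - y0) * (gy (x0+h) y - gy x0 y)"
      by (rule MVT2[of y0 "y0+h" "\<lambda>y. g (x0+h) y - g x0 y"]) (use h in \<open>auto intro!: DERIV_diff gy\<close>)
    then obtain y' where y': "y0 < y'" "y' < y0 + h"
      "(g (x0+h) (y0+h) - g x0 (y0+h)) - (g (x0+h) y0 - g x0 y0) = h * (gy (x0+h) y' - gy x0 y')" by auto
    have "\<exists>x. x0 < x \<and> x < x0 + h \<and> gy (x0+h) y' - gy x0 y' = (x0 + h - x0) * gyx x y'"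
      by (rule MVT2) (use h y' in \<open>auto intro!: gyx\<close>)
    then obtain x' where x': "x0 < x'" "x' < x0 + h" "gy (x0+h) y' - gy x0 y' = h * gyx x' y'" by auto
    have "h * (h * gxy x y) = h * (h * gyx x' y')"
      using x(3) y(3) y'(3) x'(3) by (metis (no_types, lifting) diff_diff_eq2 diff_add_eq add.commute diff_diff_add)
    then have "gxy x y = gyx x' y'" using h by simp
    then show ?thesis using x y x' y' by (intro exI[of _ x] exI[of _ y] exI[of _ x'] exI[of _ y']) auto
  qed
  have "\<exists>e>0. False" if "gxy x0 y0 \<noteq> gyx x0 y0"
  proof -
    define e where "e = \<bar>gxy x0 y0 - gyx x0 y0\<bar> / 2"
    have e: "e > 0" using that by (simp add: e_def)
    obtain d1 where d1: "d1 > 0" "\<And>x y. dist (x, y) (x0, y0) < d1 \<Longrightarrow> dist (gxy x y) (gxy x0 y0) < e"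
      using cont(1) e unfolding continuous_at_eps_delta by fastforce
    obtain d2 where d2: "d2 > 0" "\<And>x y. dist (x, y) (x0, y0) < d2 \<Longrightarrow> dist (gyx x y) (gyx x0 y0) < e"
      using cont(2) e unfolding continuous_at_eps_delta by fastforce
    define h where "h = min r (min d1 d2) / 3"
    have h: "0 < h" "h < r" "2 * h < d1" "2 * h < d2" using r d1(1) d2(1) by (auto simp: h_def)
    from ex[OF h(1,2)] obtain x y x' y' where xy: "x \<in> {x0..x0+h}" "y \<in> {y0..y0+h}" "x' \<in> {x0..x0+h}" "y' \<in> {y0..y0+h}"
      "gxy x y = gyx x' y'" by blast
    have near: "dist (a, b) (x0, y0) \<le> 2 * h" if "a \<in> {x0..x0+h}" "b \<in> {y0..y0+h}" for a b
    proof -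
      have "dist (a, b) (x0, y0) \<le> \<bar>a - x0\<bar> + \<bar>b - y0\<bar>"
        by (simp add: dist_Pair_Pair dist_real_def sqrt_sum_squares_le_sum_abs)
      then show ?thesis using that by auto
    qed
    have "dist (gxy x y) (gxy x0 y0) < e" using d1(2) near[OF xy(1,2)] h by force
    moreover have "dist (gyx x' y') (gyx x0 y0) < e" using d2(2) near[OF xy(3,4)] h by force
    ultimately show ?thesis using xy(5) by (auto simp: e_def dist_real_def abs_if split: if_splits)
  qed
  then show ?thesis by blast
qed

section \<open>The divergence theorem on the half-plane\<close>

abbreviation vec2 :: "real \<times> real \<Rightarrow> real^2" where
  "vec2 z \<equiv> vector [fst z, snd z]"

lemma vec2_eq: "vec2 z = fst z *\<^sub>R axis 1 1 + snd z *\<^sub>R axis 2 1"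
  by (auto simp: vec_eq_iff forall_2 vector_2 axis_def)

lemma continuous_on_vec2 [continuous_intros]:
  assumes "continuous_on S f" "continuous_on S g"
  shows "continuous_on S (\<lambda>x. vector [f x, g x] :: real^2)"
proof -
  have "(vector [f x, g x] :: real^2) = f x *\<^sub>R axis 1 1 + g x *\<^sub>R axis 2 1" for x
    using vec2_eq[of "(f x, g x)"] by simp
  then show ?thesis using assms by (auto intro!: continuous_intros)
qed

lemma borel_measurable_vec2 [measurable]: "vec2 \<in> borel_measurable (borel \<Otimes>\<^sub>M borel)"
  unfolding vec2_eq by measurable

lemma borel_measurable_boundary_line [measurable]: "(\<lambda>t. vector [t, 0] :: real^2) \<in> borel_measurable borel"
  by (intro borel_measurable_continuous_onI continuous_intros)

text \<open>Both measures agree on boxes, which determines Lebesgue measure. Iterated integrals on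
  \<open>real^2\<close> are obtained from the product measure through this identification.\<close>

lemma lborel_vec2: "lborel = distr (lborel \<Otimes>\<^sub>M lborel) borel vec2"
proof (rule lborel_eqI)
  fix l u :: "real^2" assume le: "\<And>b. b \<in> Basis \<Longrightarrow> l \<bullet> b \<le> u \<bullet> b"
  from this[of "axis 1 1"] this[of "axis 2 1"]
  have le: "l $ 1 \<le> u $ 1" "l $ 2 \<le> u $ 2" by (auto simp: Basis_vec2 inner_axis)
  have "emeasure (distr (lborel \<Otimes>\<^sub>M lborel) borel vec2) (box l u)
      = emeasure (lborel \<Otimes>\<^sub>M lborel) ({l$1<..<u$1} \<times> {l$2<..<u$2})"
    by (subst emeasure_distr)
       (auto simp: mem_box_cart forall_2 vector_2 space_pair_measure intro!: arg_cong[where f = "emeasure _"])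
  also have "\<dots> = emeasure lborel {l$1<..<u$1} * emeasure lborel {l$2<..<u$2}"
    by (rule lborel.emeasure_pair_measure_Times) auto
  also have "\<dots> = ennreal ((u$1 - l$1) * (u$2 - l$2))"
    using le by (simp add: ennreal_mult)
  also have "(u$1 - l$1) * (u$2 - l$2) = (\<Prod>b\<in>Basis. (u - l) \<bullet> b)"
    by (simp add: Basis_vec2 inner_axis axis_eq_axis)
  finally show "emeasure (distr (lborel \<Otimes>\<^sub>M lborel) borel vec2) (box l u) = (\<Prod>b\<in>Basis. (u - l) \<bullet> b)" .
qed simp

lemma nn_integral_vec2:
  fixes f :: "real^2 \<Rightarrow> ennreal"
  assumes [measurable]: "f \<in> borel_measurable borel"
  shows "(\<integral>\<^sup>+p. f p \<partial>lborel) = (\<integral>\<^sup>+y. \<integral>\<^sup>+x. f (vector [x, y]) \<partial>lborel \<partial>lborel)"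
proof -
  have "(\<integral>\<^sup>+p. f p \<partial>lborel) = (\<integral>\<^sup>+p. f p \<partial>distr (lborel \<Otimes>\<^sub>M lborel) borel vec2)"
    by (simp only: lborel_vec2[symmetric])
  also have "\<dots> = (\<integral>\<^sup>+z. f (vec2 z) \<partial>(lborel \<Otimes>\<^sub>M lborel))"
    by (rule nn_integral_distr) measurable
  also have "\<dots> = (\<integral>\<^sup>+y. \<integral>\<^sup>+x. f (vector [x, y]) \<partial>lborel \<partial>lborel)"
    by (subst lborel_pair.nn_integral_snd[symmetric]) simp_all
  finally show ?thesis .
qed

text \<open>Fubini on the rectangle [-R, R] x [0, R]: \<open>d1\<close> integrates to 0 along
  horizontal lines and \<open>d2\<close> integrates to \<open>- v2\<close> at the foot of each
  vertical line. Derivatives are assumed for y > 0 alone; the line y = 0 is null, and the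
  fundamental theorem of calculus on [0, R] asks for continuity at the endpoints and derivatives
  inside.\<close>

lemma half_plane_divergence:
  fixes v1 v2 d1 d2 :: "real^2 \<Rightarrow> real"
  assumes R: "R > 0" and
    cont: "continuous_on half_plane v1" "continuous_on half_plane v2"
      "continuous_on half_plane d1" "continuous_on half_plane d2"
    and der1: "\<And>x y. 0 < y \<Longrightarrow> ((\<lambda>s. v1 (vector [s, y])) has_real_derivative d1 (vector [x, y])) (at x)"
    and der2: "\<And>x y. 0 < y \<Longrightarrow> ((\<lambda>s. v2 (vector [x, s])) has_real_derivative d2 (vector [x, y])) (at y)"
    and supp: "\<And>p. p \<in> half_plane \<Longrightarrow> R \<le> norm p \<Longrightarrow> v1 p = 0 \<and> v2 p = 0 \<and> d1 p = 0 \<and> d2 p = 0"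
  shows "(\<integral>p. indicator half_plane p * (d1 p + d2 p) \<partial>lborel) = - (\<integral>t. v2 (vector [t, 0]) \<partial>lborel)"
proof -
  let ?K = "cbox (-R, 0) (R, R) :: (real \<times> real) set"
  have norm1: "\<bar>x\<bar> \<le> norm (vector [x, y] :: real^2)" and norm2: "\<bar>y\<bar> \<le> norm (vector [x, y] :: real^2)" for x y
    using component_le_norm_cart[of "vector [x, y] :: real^2" 1] component_le_norm_cart[of "vector [x, y] :: real^2" 2]
    by (auto simp: vector_2)
  have H: "vector [x, y] \<in> half_plane \<longleftrightarrow> 0 \<le> y" for x y by (simp add: half_plane_def vector_2)
  have out: "w (vector [x, y]) = 0" if "w \<in> {v1, v2, d1, d2}" "0 \<le> y" "R \<le> \<bar>x\<bar> \<or> R \<le> \<bar>y\<bar>" for w x y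
    using supp[of "vector [x, y]"] that norm1[of x y] norm2[of y x] H by auto
  have int: "integrable (lborel \<Otimes>\<^sub>M lborel) (\<lambda>z. indicator ?K z *\<^sub>R w (vec2 z))" if "continuous_on half_plane w" for w :: "_ \<Rightarrow> real"
    unfolding lborel_prod
    by (rule borel_integrable_compact)
       (auto intro!: continuous_on_compose2[OF that] continuous_intros simp: H)
  have eq: "indicator half_plane (vec2 z) * w (vec2 z) = indicator ?K z *\<^sub>R w (vec2 z)" if "w \<in> {v1, v2, d1, d2}" for w z
  proof (cases z)
    case (Pair x y)
    show ?thesis
    proof (cases "0 \<le> y \<and> (R \<le> \<bar>x\<bar> \<or> R \<le> \<bar>y\<bar>)")
      case True then show ?thesis using out[OF that, of y x] Pair by auto
    next
      case False then show ?thesis using Pair H by (auto simp: indicator_def)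
    qed
  qed
  have hp[measurable]: "half_plane \<in> sets borel"
    unfolding half_plane_def by (intro borel_closed closed_Collect_le continuous_intros)
  have meas[measurable]: "(\<lambda>p. indicator half_plane p * w p) \<in> borel_measurable borel" if "continuous_on half_plane w" for w :: "_ \<Rightarrow> real"
    using borel_measurable_continuous_on_indicator[OF hp that] by simp
  have pair: "(\<integral>p. indicator half_plane p * (d1 p + d2 p) \<partial>lborel)
     = (\<integral>z. indicator ?K z *\<^sub>R d1 (vec2 z) + indicator ?K z *\<^sub>R d2 (vec2 z) \<partial>(lborel \<Otimes>\<^sub>M lborel))"
  proof -
    have [measurable]: "(\<lambda>p. indicator half_plane p * (d1 p + d2 p)) \<in> borel_measurable borel"
      by (rule meas) (intro continuous_intros cont)
    have "(\<integral>p. indicator half_plane p * (d1 p + d2 p) \<partial>lborel)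
        = (\<integral>p. indicator half_plane p * (d1 p + d2 p) \<partial>distr (lborel \<Otimes>\<^sub>M lborel) borel vec2)"
      by (simp only: lborel_vec2[symmetric])
    also have "\<dots> = (\<integral>z. indicator half_plane (vec2 z) * (d1 (vec2 z) + d2 (vec2 z)) \<partial>(lborel \<Otimes>\<^sub>M lborel))"
      by (rule integral_distr) measurable
    finally show ?thesis by (simp add: distrib_left eq)
  qed
  also have "\<dots> = (\<integral>z. indicator ?K z *\<^sub>R d1 (vec2 z) \<partial>(lborel \<Otimes>\<^sub>M lborel)) + (\<integral>z. indicator ?K z *\<^sub>R d2 (vec2 z) \<partial>(lborel \<Otimes>\<^sub>M lborel))"
    by (rule Bochner_Integration.integral_add[OF int int]) (fact cont)+
  also have "(\<integral>z. indicator ?K z *\<^sub>R d1 (vec2 z) \<partial>(lborel \<Otimes>\<^sub>M lborel)) = 0"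
  proof -
    have "(\<integral>z. indicator ?K z *\<^sub>R d1 (vec2 z) \<partial>(lborel \<Otimes>\<^sub>M lborel))
        = (\<integral>y. \<integral>x. indicator ?K (x, y) *\<^sub>R d1 (vector [x, y]) \<partial>lborel \<partial>lborel)"
      using lborel_pair.integral_snd[of "\<lambda>x y. indicator ?K (x, y) *\<^sub>R d1 (vector [x, y])"] int[OF cont(3)]
      by (simp add: case_prod_beta' cond_case_prod_eta)
    also have "\<dots> = (\<integral>(y::real). 0 \<partial>lborel)"
    proof (rule Bochner_Integration.integral_cong_AE)
      show "(\<lambda>y. \<integral>x. indicator ?K (x, y) *\<^sub>R d1 (vector [x, y]) \<partial>lborel) \<in> borel_measurable lborel"
        using lborel_pair.integrable_snd[of "\<lambda>x y. indicator ?K (x, y) *\<^sub>R d1 (vector [x, y])"] int[OF cont(3)]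
        by (simp add: case_prod_beta' borel_measurable_integrable)
      show "AE y in lborel. (\<integral>x. indicator ?K (x, y) *\<^sub>R d1 (vector [x, y]) \<partial>lborel) = 0"
        using AE_lborel_singleton[of 0]
      proof eventually_elim
        case (elim y)
        show ?case
        proof (cases "0 < y \<and> y \<le> R")
          case True
          have "(\<integral>x. indicator {-R..R} x *\<^sub>R d1 (vector [x, y]) \<partial>lborel) = v1 (vector [R, y]) - v1 (vector [-R, y])"
          proof (rule integral_FTC_atLeastAtMost)
            show "- R \<le> R" using R by simp
            show "continuous_on {- R..R} (\<lambda>x. d1 (vector [x, y]))"
              by (intro continuous_on_compose2[OF cont(3)] continuous_intros) (use True in \<open>auto simp: H\<close>)
            show "((\<lambda>x. v1 (vector [x, y])) has_vector_derivative d1 (vector [x, y])) (at x within {- R..R})" for x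
              using der1[of y x] True by (auto simp: has_real_derivative_iff_has_vector_derivative intro: has_vector_derivative_at_within)
          qed
          also have "\<dots> = 0" using out[of v1 y R] out[of v1 y "-R"] True R by auto
          finally show ?thesis using True by (simp add: indicator_def)
        next
          case False then show ?thesis using elim by (auto simp: indicator_def)
        qed
      qed
    qed auto
    finally show ?thesis by simp
  qed
  also have "(\<integral>z. indicator ?K z *\<^sub>R d2 (vec2 z) \<partial>(lborel \<Otimes>\<^sub>M lborel)) = - (\<integral>t. v2 (vector [t, 0]) \<partial>lborel)"
  proof -
    have "(\<integral>z. indicator ?K z *\<^sub>R d2 (vec2 z) \<partial>(lborel \<Otimes>\<^sub>M lborel))
        = (\<integral>x. \<integral>y. indicator ?K (x, y) *\<^sub>R d2 (vector [x, y]) \<partial>lborel \<partial>lborel)"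
      using lborel_pair.integral_fst[of "\<lambda>x y. indicator ?K (x, y) *\<^sub>R d2 (vector [x, y])"] int[OF cont(4)]
      by (simp add: case_prod_beta' cond_case_prod_eta)
    also have "\<dots> = (\<integral>x. - v2 (vector [x, 0]) \<partial>lborel)"
    proof (rule Bochner_Integration.integral_cong[OF refl])
      fix x
      show "(\<integral>y. indicator ?K (x, y) *\<^sub>R d2 (vector [x, y]) \<partial>lborel) = - v2 (vector [x, 0])"
      proof (cases "\<bar>x\<bar> \<le> R")
        case True
        have "((\<lambda>y. d2 (vector [x, y])) has_integral (v2 (vector [x, R]) - v2 (vector [x, 0]))) {0..R}"
        proof (rule fundamental_theorem_of_calculus_interior)
          show "0 \<le> R" using R by simp
          show "continuous_on {0..R} (\<lambda>y. v2 (vector [x, y]))"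
            by (intro continuous_on_compose2[OF cont(2)] continuous_intros) (auto simp: H)
          show "((\<lambda>y. v2 (vector [x, y])) has_vector_derivative d2 (vector [x, y])) (at y)" if "y \<in> {0<..<R}" for y
            using der2[of y x] that by (auto simp: has_real_derivative_iff_has_vector_derivative)
        qed
        moreover have "v2 (vector [x, R]) = 0" using out R by auto
        moreover have "set_integrable lborel {0..R} (\<lambda>y. d2 (vector [x, y]))"
          unfolding set_integrable_def
          by (intro borel_integrable_compact continuous_on_compose2[OF cont(4)] continuous_intros) (auto simp: H)
        ultimately have "(\<integral>y. indicator {0..R} y *\<^sub>R d2 (vector [x, y]) \<partial>lborel) = - v2 (vector [x, 0])"
          using set_borel_integral_eq_integral(2)[of "{0..R}" "\<lambda>y. d2 (vector [x, y])"]
          by (simp add: set_lebesgue_integral_def integral_unique)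
        then show ?thesis using True by (simp add: indicator_def abs_le_iff)
      next
        case False
        then have "indicator ?K (x, y) = (0::real)" for y by (auto simp: indicator_def)
        then show ?thesis using False out[of v2 0 x] by simp
      qed
    qed
    finally show ?thesis by simp
  qed
  finally show ?thesis by simp
qed

section \<open>Interior points and symmetry of second derivatives\<close>

lemma at_within_rel_open_interior:
  assumes "rel_open D" "p \<in> D" "0 < p $ 2"
  shows "at p within D = at p"
proof -
  obtain T where T: "open T" "D = half_plane \<inter> T" using assms(1) by (auto simp: openin_open)
  have "open (T \<inter> {q. 0 < q $ 2})"
    by (intro open_Int T open_Collect_less continuous_intros)
  moreover have "T \<inter> {q. 0 < q $ 2} \<subseteq> D" using T(2) by (auto simp: half_plane_def)
  moreover have "p \<in> T \<inter> {q. 0 < q $ 2}" using assms T by auto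
  ultimately show ?thesis by (metis at_within_interior interior_maximal subsetD)
qed

lemma has_derivative_along_axes:
  fixes v :: "real^2 \<Rightarrow> real"
  assumes "(v has_derivative (\<lambda>h. (h $ 1) *\<^sub>R a + (h $ 2) *\<^sub>R b)) (at (vector [x, y]))"
  shows "((\<lambda>s. v (vector [s, y])) has_real_derivative a) (at x)"
    "((\<lambda>s. v (vector [x, s])) has_real_derivative b) (at y)"
proof -
  have 1: "(\<lambda>s. vector [s, y] :: real^2) = (\<lambda>s. s *\<^sub>R axis 1 1 + y *\<^sub>R axis 2 1)"
    and 2: "(\<lambda>s. vector [x, s] :: real^2) = (\<lambda>s. x *\<^sub>R axis 1 1 + s *\<^sub>R axis 2 1)"
    using vec2_eq[of "(_, _)"] by auto
  have d1: "((\<lambda>s. vector [s, y] :: real^2) has_derivative (\<lambda>s. s *\<^sub>R axis 1 1)) (at x)"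
    and d2: "((\<lambda>s. vector [x, s] :: real^2) has_derivative (\<lambda>s. s *\<^sub>R axis 2 1)) (at y)"
    unfolding 1 2 by (auto intro!: derivative_eq_intros)
  show "((\<lambda>s. v (vector [s, y])) has_real_derivative a) (at x)"
    using has_derivative_compose[OF d1 assms]
    by (simp add: has_field_derivative_def axis_def mult_commute_abs)
  show "((\<lambda>s. v (vector [x, s])) has_real_derivative b) (at y)"
    using has_derivative_compose[OF d2 assms]
    by (simp add: has_field_derivative_def axis_def mult_commute_abs)
qed

lemma partial_derivs_along_axes:
  fixes v :: "real^2 \<Rightarrow> real"
  assumes "rel_open D" "vector [x, y] \<in> D" "0 < y" "c1_on D v"
  shows "((\<lambda>s. v (vector [s, y])) has_real_derivative partial_deriv D v 1 (vector [x, y])) (at x)"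
    "((\<lambda>s. v (vector [x, s])) has_real_derivative partial_deriv D v 2 (vector [x, y])) (at y)"
  using has_derivative_along_axes[of v "partial_deriv D v 1 (vector [x, y])" "partial_deriv D v 2 (vector [x, y])" x y]
    has_derivative_partials[OF c1_on_differentiable[OF assms(4,2)]]
    at_within_rel_open_interior[OF assms(1,2)] assms(3) by (auto simp: vector_2)

lemma box_in_rel_open:
  assumes "rel_open D" "p \<in> D" "0 < p $ 2"
  obtains r where "r > 0"
    "\<And>x y. \<bar>x - p $ 1\<bar> < r \<Longrightarrow> \<bar>y - p $ 2\<bar> < r \<Longrightarrow> vector [x, y] \<in> D \<and> 0 < y"
proof -
  obtain e where e: "e > 0" "ball p e \<inter> half_plane \<subseteq> D"
    using assms(1,2) unfolding openin_contains_ball by blast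
  \<comment> \<open>Half of \<open>e\<close> because the norm is bounded by the sum of two
    coordinate differences; the bound by \<open>p $ 2\<close> keeps the box above the boundary
    line.\<close>
  define r where "r = min (e / 2) (p $ 2)"
  have "vector [x, y] \<in> D \<and> 0 < y" if "\<bar>x - p $ 1\<bar> < r" "\<bar>y - p $ 2\<bar> < r" for x y
  proof -
    have "norm (vector [x, y] - p) \<le> \<bar>x - p $ 1\<bar> + \<bar>y - p $ 2\<bar>"
      using norm_le_l1_cart[of "vector [x, y] - p"] by (simp add: sum_2 vector_2)
    also have "\<dots> < e" using that by (auto simp: r_def)
    finally have "vector [x, y] \<in> ball p e" by (simp add: dist_norm norm_minus_commute)
    moreover have "0 < y" using that by (auto simp: r_def)
    ultimately show ?thesis using e(2) by (auto simp: half_plane_def vector_2)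
  qed
  moreover have "r > 0" using e assms(3) by (auto simp: r_def)
  ultimately show thesis using that by blast
qed

text \<open>Taking inner products with basis vectors reduces this to the scalar case. The point is
  interior, so a full box around it lies in the domain; for integration nothing is lost, as the
  boundary line is null.\<close>

lemma mixed_partials_eq:
  fixes f :: "real^2 \<Rightarrow> 'b::euclidean_space"
  assumes D: "rel_open D" "p \<in> D" "0 < p $ 2"
    and f: "c1_on D f" "c1_on D (partial_deriv D f 1)" "c1_on D (partial_deriv D f 2)"
  shows "partial_deriv D (partial_deriv D f 1) 2 p = partial_deriv D (partial_deriv D f 2) 1 p"
proof (rule euclidean_eqI)
  fix z :: 'b assume "z \<in> Basis"
  obtain r where r: "r > 0" "\<And>x y. \<bar>x - p $ 1\<bar> < r \<Longrightarrow> \<bar>y - p $ 2\<bar> < r \<Longrightarrow> vector [x, y] \<in> D \<and> 0 < y"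
    using box_in_rel_open[OF D] by blast
  have pd: "partial_deriv D (\<lambda>q. u q \<bullet> z) i q = partial_deriv D u i q \<bullet> z"
    if "c1_on D u" "q \<in> D" for u :: "real^2 \<Rightarrow> 'b" and i q
    using partial_deriv_inner[OF D(1) that(2) c1_on_differentiable[OF that] differentiable_const]
    by (simp add: partial_deriv_const[OF D(1) that(2)])
  have c1: "c1_on D (\<lambda>q. u q \<bullet> z)" if "c1_on D u" for u :: "real^2 \<Rightarrow> 'b"
    by (intro c1_on_inner c1_on_const D that)
  have cont: "isCont (\<lambda>(x, y). u (vector [x, y]) \<bullet> z) (p $ 1, p $ 2)" if "continuous_on D u" for u :: "real^2 \<Rightarrow> 'b"
  proof -
    let ?S = "{p$1 - r<..<p$1 + r} \<times> {p$2 - r<..<p$2 + r}"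
    have "continuous_on ?S (\<lambda>z'. u (vector [fst z', snd z']) \<bullet> z)"
      by (intro continuous_intros continuous_on_compose2[OF that]) (use r(2) in \<open>auto simp: abs_less_iff algebra_simps\<close>)
    moreover have "open ?S" by (intro open_Times) auto
    moreover have "(p $ 1, p $ 2) \<in> ?S" using r(1) by auto
    ultimately show ?thesis by (simp add: case_prod_beta' continuous_on_eq_continuous_at)
  qed
  have p: "p = vector [p $ 1, p $ 2]" by (simp add: vec_eq_iff forall_2 vector_2)
  let ?f = "\<lambda>i j x y. partial_deriv D (partial_deriv D f i) j (vector [x, y]) \<bullet> z"
  have "?f 1 2 (p $ 1) (p $ 2) = ?f 2 1 (p $ 1) (p $ 2)"
  proof (rule equality_of_mixed_partials[OF r(1),
        where g = "\<lambda>x y. f (vector [x, y]) \<bullet> z" and gx = "\<lambda>x y. partial_deriv D f 1 (vector [x, y]) \<bullet> z"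
          and gy = "\<lambda>x y. partial_deriv D f 2 (vector [x, y]) \<bullet> z" and gxy = "?f 1 2" and gyx = "?f 2 1"])
    fix x y assume "\<bar>x - p $ 1\<bar> < r" "\<bar>y - p $ 2\<bar> < r"
    then have xy: "vector [x, y] \<in> D" "0 < y" using r(2) by auto
    note * = partial_derivs_along_axes[OF D(1) xy c1]
    show "((\<lambda>x. f (vector [x, y]) \<bullet> z) has_real_derivative partial_deriv D f 1 (vector [x, y]) \<bullet> z) (at x)"
      "((\<lambda>y. f (vector [x, y]) \<bullet> z) has_real_derivative partial_deriv D f 2 (vector [x, y]) \<bullet> z) (at y)"
      using *[OF f(1)] by (simp_all add: pd f xy)
    show "((\<lambda>y. partial_deriv D f 1 (vector [x, y]) \<bullet> z) has_real_derivative ?f 1 2 x y) (at y)"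
      using *(2)[OF f(2)] by (simp add: pd f xy)
    show "((\<lambda>x. partial_deriv D f 2 (vector [x, y]) \<bullet> z) has_real_derivative ?f 2 1 x y) (at x)"
      using *(1)[OF f(3)] by (simp add: pd f xy)
  qed (intro cont c1_on_continuous_partial f)+
  then show "partial_deriv D (partial_deriv D f 1) 2 p \<bullet> z = partial_deriv D (partial_deriv D f 2) 1 p \<bullet> z"
    using p by simp
qed

section \<open>Minimality and the first variation in a chart\<close>

lemma det_induced_metric:
  "det (induced_metric D f p) = gram (partial_deriv D f 1 p) (partial_deriv D f 2 p)"
  by (simp add: det_2 induced_metric_def gram_def power2_eq_square inner_commute)

lemma normal_part_span:
  "\<exists>c d. normal_part D f p v = v + c *\<^sub>R partial_deriv D f 1 p + d *\<^sub>R partial_deriv D f 2 p"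
  unfolding normal_part_def sum_2
  by (rule exI[of _ "- (inverse_metric D f p $ 1 $ 1 * (v \<bullet> partial_deriv D f 1 p) + inverse_metric D f p $ 2 $ 1 * (v \<bullet> partial_deriv D f 2 p))"],
      rule exI[of _ "- (inverse_metric D f p $ 1 $ 2 * (v \<bullet> partial_deriv D f 1 p) + inverse_metric D f p $ 2 $ 2 * (v \<bullet> partial_deriv D f 2 p))"])
     (simp add: algebra_simps)

text \<open>\<open>matrix_inv\<close> is a choice operator; exhibiting a two-sided inverse
  \<open>N\<close> forces its value to be the familiar cofactor formula.\<close>

lemma inverse_metric_eq:
  assumes g: "gram (partial_deriv D f 1 p) (partial_deriv D f 2 p) \<noteq> 0"
  defines "a \<equiv> partial_deriv D f 1 p" and "b \<equiv> partial_deriv D f 2 p"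
  shows "inverse_metric D f p $ 1 $ 1 = (b \<bullet> b) / gram a b" "inverse_metric D f p $ 1 $ 2 = - (a \<bullet> b) / gram a b"
    "inverse_metric D f p $ 2 $ 1 = - (a \<bullet> b) / gram a b" "inverse_metric D f p $ 2 $ 2 = (a \<bullet> a) / gram a b"
proof -
  define N :: "real^2^2" where "N = vector [vector [b \<bullet> b / gram a b, - (a \<bullet> b) / gram a b], vector [- (a \<bullet> b) / gram a b, a \<bullet> a / gram a b]]"
  have "induced_metric D f p ** N = mat 1" "N ** induced_metric D f p = mat 1"
    using g unfolding a_def[symmetric] b_def[symmetric]
    by (auto simp: vec_eq_iff forall_2 matrix_matrix_mult_def sum_2 N_def vector_2 induced_metric_def mat_def
        a_def[symmetric] b_def[symmetric] inner_commute[of b a] field_simps)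
       (auto simp: gram_def power2_eq_square)
  moreover from this have "matrix_inv (induced_metric D f p) ** induced_metric D f p = mat 1"
    unfolding matrix_inv_def by (metis (mono_tags, lifting) someI)
  ultimately have "matrix_inv (induced_metric D f p) = N"
    by (metis matrix_mul_assoc matrix_mul_lid matrix_mul_rid)
  then show "inverse_metric D f p $ 1 $ 1 = (b \<bullet> b) / gram a b" "inverse_metric D f p $ 1 $ 2 = - (a \<bullet> b) / gram a b"
    "inverse_metric D f p $ 2 $ 1 = - (a \<bullet> b) / gram a b" "inverse_metric D f p $ 2 $ 2 = (a \<bullet> a) / gram a b"
    by (simp_all add: inverse_metric_def N_def vector_2)
qed

text \<open>Multiplying the mean curvature vector by the Gram determinant turns the entries of the
  inverse metric into cofactors. Each second fundamental form differs from the second derivative by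
  a tangent vector, so the vanishing mean curvature leaves a tangential combination of second
  derivatives.\<close>

lemma minimal_second_derivs_span:
  fixes f :: "real^2 \<Rightarrow> real^'n"
  assumes g: "gram (partial_deriv D f 1 p) (partial_deriv D f 2 p) > 0"
    and H: "mean_curvature_vector D f p = 0"
  defines "a \<equiv> partial_deriv D f 1 p" and "b \<equiv> partial_deriv D f 2 p"
  defines "f2 \<equiv> \<lambda>i j. partial_deriv D (partial_deriv D f i) j p"
  shows "\<exists>c d. (b \<bullet> b) *\<^sub>R f2 1 1 - (a \<bullet> b) *\<^sub>R (f2 1 2 + f2 2 1) + (a \<bullet> a) *\<^sub>R f2 2 2 = c *\<^sub>R a + d *\<^sub>R b"
proof -
  have g': "gram a b \<noteq> 0" using g by (simp add: a_def b_def)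
  have "\<exists>c d. second_fundamental_form D f p i j = f2 i j + c *\<^sub>R a + d *\<^sub>R b" for i j
    using normal_part_span[of D f p "f2 i j"] by (simp add: second_fundamental_form_def f2_def a_def b_def)
  then obtain c d where cd: "\<And>i j. second_fundamental_form D f p i j = f2 i j + c i j *\<^sub>R a + d i j *\<^sub>R b"
    by metis
  have "0 = gram a b *\<^sub>R mean_curvature_vector D f p" using H by simp
  also have "\<dots> = (b \<bullet> b) *\<^sub>R second_fundamental_form D f p 1 1 - (a \<bullet> b) *\<^sub>R second_fundamental_form D f p 1 2
      - (a \<bullet> b) *\<^sub>R second_fundamental_form D f p 2 1 + (a \<bullet> a) *\<^sub>R second_fundamental_form D f p 2 2"
    unfolding mean_curvature_vector_def sum_2
    using inverse_metric_eq[of D f p] g g' by (simp add: a_def[symmetric] b_def[symmetric] algebra_simps)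
  also have "\<dots> = (b \<bullet> b) *\<^sub>R f2 1 1 - (a \<bullet> b) *\<^sub>R (f2 1 2 + f2 2 1) + (a \<bullet> a) *\<^sub>R f2 2 2
     + ((b \<bullet> b) * c 1 1 - (a \<bullet> b) * (c 1 2 + c 2 1) + (a \<bullet> a) * c 2 2) *\<^sub>R a
     + ((b \<bullet> b) * d 1 1 - (a \<bullet> b) * (d 1 2 + d 2 1) + (a \<bullet> a) * d 2 2) *\<^sub>R b"
    unfolding cd by (simp add: algebra_simps)
  finally have "(b \<bullet> b) *\<^sub>R f2 1 1 - (a \<bullet> b) *\<^sub>R (f2 1 2 + f2 2 1) + (a \<bullet> a) *\<^sub>R f2 2 2 =
     (- ((b \<bullet> b) * c 1 1 - (a \<bullet> b) * (c 1 2 + c 2 1) + (a \<bullet> a) * c 2 2)) *\<^sub>R a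
     + (- ((b \<bullet> b) * d 1 1 - (a \<bullet> b) * (d 1 2 + d 2 1) + (a \<bullet> a) * d 2 2)) *\<^sub>R b"
    by (simp add: eq_neg_iff_add_eq_0 algebra_simps)
  then show ?thesis by blast
qed

text \<open>Both \<nu> and the left-hand side \<open>w\<close> are tangent vectors orthogonal to
  \<open>a\<close>, hence parallel. The length of \<open>w\<close> is |a| times the root of the Gram
  determinant, and the sign comes from \<open>c $ 2 < 0\<close>. This identifies the flux of a
  coordinate field through the boundary line with the conormal times the length element.\<close>

lemma outward_conormal_eq:
  assumes "is_outward_unit_conormal D f p \<nu>"
  defines "a \<equiv> partial_deriv D f 1 p" and "b \<equiv> partial_deriv D f 2 p"
  assumes g: "gram a b > 0"
  shows "(a \<bullet> a) *\<^sub>R b - (a \<bullet> b) *\<^sub>R a = (- (sqrt (gram a b) * norm a)) *\<^sub>R \<nu>"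
proof -
  obtain c :: "real^2" where c: "c $ 2 < 0" "\<nu> = c $ 1 *\<^sub>R a + c $ 2 *\<^sub>R b"
    and \<nu>: "norm \<nu> = 1" "\<nu> \<bullet> a = 0"
    using assms(1) by (auto simp: is_outward_unit_conormal_def sum_2 a_def b_def)
  have a0: "a \<noteq> 0" using g by (auto simp: gram_def)
  then have A: "a \<bullet> a > 0" by simp
  define w where "w = (a \<bullet> a) *\<^sub>R b - (a \<bullet> b) *\<^sub>R a"
  have "c $ 1 * (a \<bullet> a) + c $ 2 * (a \<bullet> b) = 0"
    using \<nu>(2) c(2) by (simp add: inner_simps inner_commute[of b a])
  then have c1: "c $ 1 * (a \<bullet> a) = - (c $ 2 * (a \<bullet> b))" by simp
  have "(a \<bullet> a) *\<^sub>R \<nu> = (c $ 1 * (a \<bullet> a)) *\<^sub>R a + ((a \<bullet> a) * c $ 2) *\<^sub>R b"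
    by (simp add: c(2) scaleR_add_right mult.commute)
  also have "\<dots> = (c $ 2) *\<^sub>R w" unfolding c1 by (simp add: w_def algebra_simps)
  finally have eq: "(a \<bullet> a) *\<^sub>R \<nu> = (c $ 2) *\<^sub>R w" .
  have "w \<bullet> w = (a \<bullet> a) * gram a b"
    by (simp add: w_def gram_def inner_simps inner_commute[of b a] algebra_simps power2_eq_square)
  then have nw: "norm w = norm a * sqrt (gram a b)"
    by (simp add: norm_eq_sqrt_inner real_sqrt_mult)
  have "a \<bullet> a = \<bar>c $ 2\<bar> * norm w" using arg_cong[OF eq, of norm] \<nu>(1) A by simp
  then have "norm w *\<^sub>R ((a \<bullet> a) *\<^sub>R \<nu>) = (- (a \<bullet> a)) *\<^sub>R w"
    using c(1) eq by (simp add: algebra_simps)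
  then have "(a \<bullet> a) *\<^sub>R (norm w *\<^sub>R \<nu> + w) = 0" by (simp add: algebra_simps)
  then have "norm w *\<^sub>R \<nu> + w = 0" using A by simp
  then show ?thesis unfolding w_def[symmetric] nw by (simp add: add_eq_0_iff mult.commute)
qed

section \<open>Extension by zero of compactly supported functions in a chart\<close>

lemma rel_open_diff: "rel_open D \<Longrightarrow> closed K \<Longrightarrow> rel_open (D - K)"
  unfolding openin_open using open_Compl open_Int by (metis Diff_eq inf_assoc)

lemma zero_extension_continuous:
  fixes v :: "real^2 \<Rightarrow> real"
  assumes D: "rel_open D" and K: "closed K" "K \<inter> half_plane \<subseteq> D"
    and v: "continuous_on D v" "\<And>p. p \<in> D - K \<Longrightarrow> v p = 0"
  shows "continuous_on half_plane (\<lambda>p. if p \<in> D then v p else 0)"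
proof -
  have H: "half_plane = D \<union> (half_plane - K)" using D K openin_imp_subset by blast
  have "openin (top_of_set half_plane) (half_plane - K)" using K(1) by (intro rel_open_diff) auto
  moreover have "continuous_on D (\<lambda>p. if p \<in> D then v p else 0)"
    using v(1) by (simp cong: continuous_on_cong)
  moreover have "continuous_on (half_plane - K) (\<lambda>p. if p \<in> D then v p else 0)"
    by (rule continuous_on_eq[of _ "\<lambda>_. 0"]) (use v(2) in auto)
  ultimately show ?thesis
    using continuous_on_Un_local_open[of D "half_plane - K"] D unfolding H[symmetric] by blast
qed

lemma partial_deriv_vanish:
  assumes "rel_open D" "rel_open D'" "D' \<subseteq> D" "p \<in> D'" "\<And>q. q \<in> D' \<Longrightarrow> v q = 0"
  shows "partial_deriv D v i p = 0"
proof -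
  have "(v has_derivative (\<lambda>_. 0)) (at p within D')"
    by (rule has_derivative_transform[OF assms(4) _ has_derivative_const]) (use assms(5) in auto)
  then have "(v has_derivative (\<lambda>_. 0)) (at p within D)"
    using at_within_rel_open[OF assms(1-4)] by simp
  from partial_deriv_eq[OF assms(1) _ this] assms show ?thesis by auto
qed

lemma AE_off_boundary_line: "AE p in lborel. (p::real^2) $ 2 \<noteq> 0"
proof -
  have "{p::real^2. p $ 2 = 0} \<in> sets borel"
    by (intro borel_closed closed_Collect_eq continuous_intros)
  moreover have "{p::real^2. p $ 2 = 0} \<in> null_sets lebesgue"
    using negligible_standard_hyperplane_cart negligible_iff_null_sets by blast
  ultimately have "{p::real^2. p $ 2 = 0} \<in> null_sets lborel"
    by (simp add: null_sets_def emeasure_completion sets_completionI_sets)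
  then show ?thesis by (rule AE_I') auto
qed

text \<open>Extension by zero reduces this to the whole half-plane. The set \<open>K\<close> may
  leave the half-plane: in the application it is a full closed ball, of which only the upper part
  lies in \<open>D\<close>.\<close>

lemma chart_divergence:
  fixes v1 v2 :: "real^2 \<Rightarrow> real"
  assumes D: "rel_open D" and K: "compact K" "K \<inter> half_plane \<subseteq> D"
    and v: "c1_on D v1" "c1_on D v2" "\<And>p. p \<in> D - K \<Longrightarrow> v1 p = 0" "\<And>p. p \<in> D - K \<Longrightarrow> v2 p = 0"
  shows "(\<integral>p. indicator D p * (partial_deriv D v1 1 p + partial_deriv D v2 2 p) \<partial>lborel)
       = - (\<integral>t. indicator D (vector [t, 0]) * v2 (vector [t, 0]) \<partial>lborel)"
proof -
  let ?ext = "\<lambda>v p. if p \<in> D then v p else (0::real)"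
  let ?d1 = "partial_deriv D v1 1" and ?d2 = "partial_deriv D v2 2"
  have clK: "closed K" using K(1) compact_imp_closed by blast
  obtain R where R: "R > 0" "\<And>p. p \<in> K \<Longrightarrow> norm p < R"
    using compact_imp_bounded[OF K(1)] bounded_pos_less by metis
  have DK: "rel_open (D - K)"
    by (rule rel_open_diff[OF D clK])
  have z: "partial_deriv D w i p = 0" if "p \<in> D - K" "\<And>q. q \<in> D - K \<Longrightarrow> w q = 0" for w :: "real^2 \<Rightarrow> real" and i p
    by (rule partial_deriv_vanish[OF D DK _ that(1)]) (use that in auto)
  have dsub: "D \<subseteq> half_plane" using D openin_imp_subset by blast
  \<comment> \<open>A point outside \<open>D\<close> with positive height lies outside
    \<open>K\<close>, hence has an open neighbourhood on which the extension is identically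
    0.\<close>
  have der: "((?ext w) has_derivative (\<lambda>h. (h $ 1) *\<^sub>R ?ext (partial_deriv D w 1) p + (h $ 2) *\<^sub>R ?ext (partial_deriv D w 2) p)) (at p)"
    if w: "c1_on D w" "\<And>q. q \<in> D - K \<Longrightarrow> w q = 0" and p: "0 < p $ 2" for w p
  proof (cases "p \<in> D")
    case True
    have "(?ext w has_derivative (\<lambda>h. (h $ 1) *\<^sub>R partial_deriv D w 1 p + (h $ 2) *\<^sub>R partial_deriv D w 2 p)) (at p within D)"
      by (rule has_derivative_transform[OF True _ has_derivative_partials[OF c1_on_differentiable[OF w(1) True]]]) auto
    then show ?thesis using at_within_rel_open_interior[OF D True p] True by simp
  next
    case False
    let ?U = "- K \<inter> {q::real^2. 0 < q $ 2}"
    have U: "open ?U" by (intro open_Int open_Compl clK open_Collect_less continuous_intros)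
    have pU: "p \<in> ?U" using False p K(2) by (auto simp: half_plane_def)
    have "(?ext w has_derivative (\<lambda>_. 0)) (at p)"
      by (rule has_derivative_transform_within_open[OF has_derivative_const U pU]) (use w(2) in auto)
    then show ?thesis using False by simp
  qed
  have half: "(vector [x, y] :: real^2) $ 2 = y" for x y by (simp add: vector_2)
  have "(\<integral>p. indicator half_plane p * (?ext ?d1 p + ?ext ?d2 p) \<partial>lborel) = - (\<integral>t. ?ext v2 (vector [t, 0]) \<partial>lborel)"
  proof (rule half_plane_divergence[OF R(1)])
    show "continuous_on half_plane (?ext v1)" "continuous_on half_plane (?ext v2)"
      "continuous_on half_plane (?ext ?d1)" "continuous_on half_plane (?ext ?d2)"
      by (intro zero_extension_continuous[OF D clK K(2)] c1_on_continuous c1_on_continuous_partial v z; simp add: v)+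
    show "((\<lambda>s. ?ext v1 (vector [s, y])) has_real_derivative ?ext ?d1 (vector [x, y])) (at x)" if "0 < y" for x y
      using der[OF v(1,3), of "vector [x, y]"] that by (intro has_derivative_along_axes(1)) (simp add: half)
    show "((\<lambda>s. ?ext v2 (vector [x, s])) has_real_derivative ?ext ?d2 (vector [x, y])) (at y)" if "0 < y" for x y
      using der[OF v(2,4), of "vector [x, y]"] that by (intro has_derivative_along_axes(2)) (simp add: half)
    show "?ext v1 p = 0 \<and> ?ext v2 p = 0 \<and> ?ext ?d1 p = 0 \<and> ?ext ?d2 p = 0" if "p \<in> half_plane" "R \<le> norm p" for p
      using R(2)[of p] that v(3,4) z by fastforce
  qed
  also have "(\<lambda>p. indicator half_plane p * (?ext ?d1 p + ?ext ?d2 p)) = (\<lambda>p. indicator D p * (?d1 p + ?d2 p))"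
    using dsub by (auto simp: fun_eq_iff indicator_def)
  also have "(\<lambda>t. ?ext v2 (vector [t, 0])) = (\<lambda>t. indicator D (vector [t, 0]) * v2 (vector [t, 0]))"
    by (auto simp: fun_eq_iff indicator_def)
  finally show ?thesis .
qed

text \<open>
  Minimality says that the coordinate functions are harmonic: the field
  \<open>n\<^sub>1, n\<^sub>2\<close> below is \<open>\<surd>g g\<^sup>i\<^sup>j \<partial>\<^sub>j f\<close>, and its divergence is tangential because the mean
  curvature vanishes and normal by the product rule.
\<close>

lemma minimal_immersion_harmonic:
  fixes f :: "real^2 \<Rightarrow> real^'n"
  assumes D: "rel_open D" and f: "smooth_on D f"
    and g: "\<And>p. p \<in> D \<Longrightarrow> gram (partial_deriv D f 1 p) (partial_deriv D f 2 p) > 0"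
    and H: "\<And>p. p \<in> D \<Longrightarrow> mean_curvature_vector D f p = 0"
  defines "a \<equiv> partial_deriv D f 1" and "b \<equiv> partial_deriv D f 2"
  defines "W \<equiv> \<lambda>p. sqrt (gram (a p) (b p))"
  defines "n1 \<equiv> \<lambda>p. inverse (W p) *\<^sub>R ((b p \<bullet> b p) *\<^sub>R a p - (a p \<bullet> b p) *\<^sub>R b p)"
    and "n2 \<equiv> \<lambda>p. inverse (W p) *\<^sub>R ((a p \<bullet> a p) *\<^sub>R b p - (a p \<bullet> b p) *\<^sub>R a p)"
  shows "c1_on D n1" "c1_on D n2"
    "\<And>p. p \<in> D \<Longrightarrow> 0 < p $ 2 \<Longrightarrow> partial_deriv D n1 1 p + partial_deriv D n2 2 p = 0"
proof -
  note g = g[folded a_def b_def]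
  have ab: "c1_on D a" "c1_on D b"
    unfolding a_def b_def using f smooth_on_c1_partial by blast+
  have c1W: "c1_on D W"
    unfolding W_def gram_def power2_eq_square
    by (intro c1_on_sqrt c1_on_diff c1_on_mult c1_on_inner D ab) (use g in \<open>simp add: gram_def power2_eq_square\<close>)
  have W: "W p > 0" "W p * W p = (a p \<bullet> a p) * (b p \<bullet> b p) - (a p \<bullet> b p) * (a p \<bullet> b p)" if "p \<in> D" for p
    using g[OF that] by (simp_all add: W_def gram_def power2_eq_square)
  have iW: "c1_on D (\<lambda>p. inverse (W p))"
    by (rule c1_on_inverse[OF D c1W]) (use W(1) in force)
  have m: "c1_on D (\<lambda>p. (b p \<bullet> b p) *\<^sub>R a p - (a p \<bullet> b p) *\<^sub>R b p)"
    "c1_on D (\<lambda>p. (a p \<bullet> a p) *\<^sub>R b p - (a p \<bullet> b p) *\<^sub>R a p)"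
    by (intro c1_on_diff c1_on_scaleR c1_on_inner D ab)+
  show n: "c1_on D n1" "c1_on D n2"
    unfolding n1_def n2_def by (intro c1_on_scaleR D iW m)+
  fix p assume p: "p \<in> D" "0 < p $ 2"
  note diff = c1_on_differentiable[OF _ p(1)]
  note pd = partial_deriv_scaleR[OF D p(1)] partial_deriv_diff[OF D p(1)] partial_deriv_inner[OF D p(1)] partial_deriv_mult[OF D p(1)]
  define a1 a2 b1 b2 where ab12: "a1 = partial_deriv D a 1 p" "a2 = partial_deriv D a 2 p"
    "b1 = partial_deriv D b 1 p" "b2 = partial_deriv D b 2 p"
  have sym: "a2 = b1"
    unfolding ab12 a_def b_def
    by (rule mixed_partials_eq[OF D p]) (use f smooth_on_c1 smooth_on_c1_partial in blast)+
  define Z where "Z = partial_deriv D n1 1 p + partial_deriv D n2 2 p"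
  have prod_aux: "inverse (W q) * ((a q \<bullet> a q) * (b q \<bullet> b q) - (a q \<bullet> b q) * (a q \<bullet> b q)) = W q" if "q \<in> D" for q
    using W(1)[OF that] unfolding W(2)[OF that, symmetric] by simp
  \<comment> \<open>\<open>n1, n2\<close> is \<open>W\<close> times the dual frame of
    \<open>a, b\<close> in the tangent plane. Differentiating these four relations determines the
    tangential part of the divergence \<open>Z\<close>.\<close>
  have prod: "n1 q \<bullet> a q = W q" "n1 q \<bullet> b q = 0" "n2 q \<bullet> a q = 0" "n2 q \<bullet> b q = W q" if "q \<in> D" for q
  proof -
    have "n1 q \<bullet> a q = inverse (W q) * ((a q \<bullet> a q) * (b q \<bullet> b q) - (a q \<bullet> b q) * (a q \<bullet> b q))"
      "n2 q \<bullet> b q = inverse (W q) * ((a q \<bullet> a q) * (b q \<bullet> b q) - (a q \<bullet> b q) * (a q \<bullet> b q))"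
      by (simp_all add: n1_def n2_def inner_simps inner_commute algebra_simps)
    then show "n1 q \<bullet> a q = W q" "n2 q \<bullet> b q = W q" using prod_aux[OF that] by simp_all
    show "n1 q \<bullet> b q = 0" "n2 q \<bullet> a q = 0"
      by (simp_all add: n1_def n2_def inner_simps inner_commute algebra_simps)
  qed
  have dprod: "partial_deriv D (\<lambda>q. n1 q \<bullet> a q) 1 p = partial_deriv D W 1 p" "partial_deriv D (\<lambda>q. n2 q \<bullet> a q) 2 p = 0"
     "partial_deriv D (\<lambda>q. n1 q \<bullet> b q) 1 p = 0" "partial_deriv D (\<lambda>q. n2 q \<bullet> b q) 2 p = partial_deriv D W 2 p"
  proof -
    have zero: "partial_deriv D u i p = 0" if "\<And>q. q \<in> D \<Longrightarrow> u q = 0" for u :: "real^2 \<Rightarrow> real" and i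
      by (rule partial_deriv_vanish[OF D D order_refl p(1) that])
    show "partial_deriv D (\<lambda>q. n1 q \<bullet> a q) 1 p = partial_deriv D W 1 p" "partial_deriv D (\<lambda>q. n2 q \<bullet> b q) 2 p = partial_deriv D W 2 p"
      by (rule partial_deriv_cong(2)[OF D p(1) diff[OF c1W]]; simp add: prod)+
    show "partial_deriv D (\<lambda>q. n2 q \<bullet> a q) 2 p = 0" "partial_deriv D (\<lambda>q. n1 q \<bullet> b q) 1 p = 0"
      by (rule zero; simp add: prod)+
  qed
  \<comment> \<open>Differentiating \<open>W * W\<close> as a polynomial in inner products avoids
    the derivative of the square root.\<close>
  have gram_deriv: "W p * partial_deriv D W i p = (a p \<bullet> partial_deriv D a i p) * (b p \<bullet> b p) + (a p \<bullet> a p) * (b p \<bullet> partial_deriv D b i p)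
      - (a p \<bullet> b p) * (a p \<bullet> partial_deriv D b i p + partial_deriv D a i p \<bullet> b p)" for i
  proof -
    have ii: "(\<lambda>q. a q \<bullet> a q) differentiable at p within D" "(\<lambda>q. b q \<bullet> b q) differentiable at p within D"
      "(\<lambda>q. a q \<bullet> b q) differentiable at p within D"
      "(\<lambda>q. (a q \<bullet> a q) * (b q \<bullet> b q)) differentiable at p within D" "(\<lambda>q. (a q \<bullet> b q) * (a q \<bullet> b q)) differentiable at p within D"
      by (intro diff c1_on_inner c1_on_mult D ab)+
    note da = diff[OF ab(1)] and db = diff[OF ab(2)] and dW = diff[OF c1W]
    have "2 * (W p * partial_deriv D W i p) = partial_deriv D (\<lambda>q. W q * W q) i p"
      unfolding partial_deriv_mult[OF D p(1) dW dW] by simp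
    also have "\<dots> = partial_deriv D (\<lambda>q. (a q \<bullet> a q) * (b q \<bullet> b q) - (a q \<bullet> b q) * (a q \<bullet> b q)) i p"
      by (rule partial_deriv_cong(2)[OF D p(1), symmetric]) (rule diff c1_on_mult D c1W | use W(2) in simp)+
    also have "\<dots> = (a p \<bullet> a p) * (b p \<bullet> partial_deriv D b i p + partial_deriv D b i p \<bullet> b p)
        + (a p \<bullet> partial_deriv D a i p + partial_deriv D a i p \<bullet> a p) * (b p \<bullet> b p)
        - ((a p \<bullet> b p) * (a p \<bullet> partial_deriv D b i p + partial_deriv D a i p \<bullet> b p)
          + (a p \<bullet> partial_deriv D b i p + partial_deriv D a i p \<bullet> b p) * (a p \<bullet> b p))"
      unfolding partial_deriv_diff[OF D p(1) ii(4,5)] partial_deriv_mult[OF D p(1) ii(1,2)] partial_deriv_mult[OF D p(1) ii(3,3)]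
        partial_deriv_inner[OF D p(1) da da] partial_deriv_inner[OF D p(1) db db] partial_deriv_inner[OF D p(1) da db] ..
    finally show ?thesis
      by (simp add: inner_commute[of "partial_deriv D b i p"] inner_commute[of "partial_deriv D a i p"] algebra_simps)
  qed
  have nval: "W p * (n1 p \<bullet> z) = (b p \<bullet> b p) * (a p \<bullet> z) - (a p \<bullet> b p) * (b p \<bullet> z)"
    "W p * (n2 p \<bullet> z) = (a p \<bullet> a p) * (b p \<bullet> z) - (a p \<bullet> b p) * (a p \<bullet> z)" for z
    using W(1)[OF p(1)] by (simp_all add: n1_def n2_def inner_simps)
  \<comment> \<open>Product rule for \<open>n1 \<bullet> a = W\<close> and
    \<open>n2 \<bullet> a = 0\<close>. Since \<open>a2 = b1\<close>, the subtracted terms are n1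
    \<bullet> a1 + n2 \<bullet> b1, which is the derivative of \<open>W\<close> by
    \<open>gram_deriv\<close>; hence Z \<bullet> a vanishes.\<close>
  have "Z \<bullet> a p = partial_deriv D W 1 p - n1 p \<bullet> a1 - n2 p \<bullet> a2"
    using dprod(1,2) unfolding partial_deriv_inner[OF D p(1) diff[OF n(1)] diff[OF ab(1)]] partial_deriv_inner[OF D p(1) diff[OF n(2)] diff[OF ab(1)]]
    by (simp add: Z_def inner_simps ab12)
  then have "W p * (Z \<bullet> a p) = W p * partial_deriv D W 1 p - W p * (n1 p \<bullet> a1) - W p * (n2 p \<bullet> a2)"
    by (simp only: right_diff_distrib)
  also have "\<dots> = 0"
    unfolding nval gram_deriv ab12[symmetric] by (simp add: sym inner_commute[of b1] inner_commute[of a1] inner_commute[of b2] inner_commute[of "b p" "a p"] algebra_simps)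
  finally have Za: "Z \<bullet> a p = 0" using W(1)[OF p(1)] by simp
  have "Z \<bullet> b p = partial_deriv D W 2 p - n1 p \<bullet> b1 - n2 p \<bullet> b2"
    using dprod(3,4) unfolding partial_deriv_inner[OF D p(1) diff[OF n(1)] diff[OF ab(2)]] partial_deriv_inner[OF D p(1) diff[OF n(2)] diff[OF ab(2)]]
    by (simp add: Z_def inner_simps ab12)
  then have "W p * (Z \<bullet> b p) = W p * partial_deriv D W 2 p - W p * (n1 p \<bullet> b1) - W p * (n2 p \<bullet> b2)"
    by (simp only: right_diff_distrib)
  also have "\<dots> = 0"
    unfolding nval gram_deriv ab12[symmetric] by (simp add: sym inner_commute[of b1] inner_commute[of a1] inner_commute[of b2] inner_commute[of "b p" "a p"] algebra_simps)
  finally have Zb: "Z \<bullet> b p = 0" using W(1)[OF p(1)] by simp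
  obtain c d where cd: "(b p \<bullet> b p) *\<^sub>R a1 - (a p \<bullet> b p) *\<^sub>R (a2 + b1) + (a p \<bullet> a p) *\<^sub>R b2 = c *\<^sub>R a p + d *\<^sub>R b p"
    using minimal_second_derivs_span[OF _ H[OF p(1)]] g[OF p(1)] unfolding ab12 a_def b_def by blast
  have diffs: "(\<lambda>q. inverse (W q)) differentiable at p within D" "a differentiable at p within D" "b differentiable at p within D"
      "(\<lambda>q. a q \<bullet> a q) differentiable at p within D" "(\<lambda>q. b q \<bullet> b q) differentiable at p within D" "(\<lambda>q. a q \<bullet> b q) differentiable at p within D"
      "(\<lambda>q. (b q \<bullet> b q) *\<^sub>R a q) differentiable at p within D" "(\<lambda>q. (a q \<bullet> b q) *\<^sub>R b q) differentiable at p within D"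
      "(\<lambda>q. (a q \<bullet> a q) *\<^sub>R b q) differentiable at p within D" "(\<lambda>q. (a q \<bullet> b q) *\<^sub>R a q) differentiable at p within D"
    by (intro diff iW c1_on_scaleR c1_on_inner D ab)+
  define ei aai bbi abi where e: "ei = (\<lambda>i. partial_deriv D (\<lambda>q. inverse (W q)) i p)"
    "aai = (\<lambda>i. partial_deriv D (\<lambda>q. a q \<bullet> a q) i p)" "bbi = (\<lambda>i. partial_deriv D (\<lambda>q. b q \<bullet> b q) i p)"
    "abi = (\<lambda>i. partial_deriv D (\<lambda>q. a q \<bullet> b q) i p)"
  have n1': "partial_deriv D n1 1 p = inverse (W p) *\<^sub>R ((b p \<bullet> b p) *\<^sub>R a1 + bbi 1 *\<^sub>R a p - ((a p \<bullet> b p) *\<^sub>R b1 + abi 1 *\<^sub>R b p))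
      + ei 1 *\<^sub>R ((b p \<bullet> b p) *\<^sub>R a p - (a p \<bullet> b p) *\<^sub>R b p)"
    unfolding n1_def partial_deriv_scaleR[OF D p(1) diffs(1) diff[OF m(1)]] partial_deriv_diff[OF D p(1) diffs(7,8)]
      partial_deriv_scaleR[OF D p(1) diffs(5,2)] partial_deriv_scaleR[OF D p(1) diffs(6,3)] e ab12 ..
  have n2': "partial_deriv D n2 2 p = inverse (W p) *\<^sub>R ((a p \<bullet> a p) *\<^sub>R b2 + aai 2 *\<^sub>R b p - ((a p \<bullet> b p) *\<^sub>R a2 + abi 2 *\<^sub>R a p))
      + ei 2 *\<^sub>R ((a p \<bullet> a p) *\<^sub>R b p - (a p \<bullet> b p) *\<^sub>R a p)"
    unfolding n2_def partial_deriv_scaleR[OF D p(1) diffs(1) diff[OF m(2)]] partial_deriv_diff[OF D p(1) diffs(9,10)]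
      partial_deriv_scaleR[OF D p(1) diffs(4,3)] partial_deriv_scaleR[OF D p(1) diffs(6,2)] e ab12 ..
  \<comment> \<open>Every term in which a coefficient, rather than \<open>a\<close> or
    \<open>b\<close>, is differentiated is a multiple of \<open>a\<close> or \<open>b\<close>;
    \<open>x\<close> and \<open>y\<close> collect them. What is left over is the combination of
    second derivatives that minimality makes tangential.\<close>
  define x y where xy: "x = inverse (W p) * (bbi 1 - abi 2) + ei 1 * (b p \<bullet> b p) - ei 2 * (a p \<bullet> b p)"
    "y = inverse (W p) * (aai 2 - abi 1) - ei 1 * (a p \<bullet> b p) + ei 2 * (a p \<bullet> a p)"
  have "Z = inverse (W p) *\<^sub>R ((b p \<bullet> b p) *\<^sub>R a1 - (a p \<bullet> b p) *\<^sub>R (a2 + b1) + (a p \<bullet> a p) *\<^sub>R b2) + (x *\<^sub>R a p + y *\<^sub>R b p)"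
    unfolding Z_def n1' n2' xy by (simp add: algebra_simps)
  then have "Z = (inverse (W p) * c + x) *\<^sub>R a p + (inverse (W p) * d + y) *\<^sub>R b p"
    unfolding cd by (simp add: algebra_simps)
  \<comment> \<open>\<open>Z\<close> is a tangent vector orthogonal to both \<open>a\<close> and
    \<open>b\<close>.\<close>
  from arg_cong[OF this, of "\<lambda>v. Z \<bullet> v"] have "Z \<bullet> Z = 0" by (simp add: inner_simps Za Zb)
  then show "partial_deriv D n1 1 p + partial_deriv D n2 2 p = 0" by (simp add: Z_def)
qed

lemma rel_open_borel: "rel_open D \<Longrightarrow> D \<in> sets borel"
proof -
  have "half_plane \<in> sets borel"
    unfolding half_plane_def by (intro borel_closed closed_Collect_le continuous_intros)
  then show "rel_open D \<Longrightarrow> D \<in> sets borel" by (auto simp: openin_open)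
qed

lemma borel_measurable_indicator_times:
  fixes v :: "real^2 \<Rightarrow> real"
  assumes "rel_open D" "continuous_on D v"
  shows "(\<lambda>p. indicator D p * v p) \<in> borel_measurable borel"
  using borel_measurable_continuous_on_indicator[OF rel_open_borel[OF assms(1)] assms(2)] by simp

text \<open>The divergence theorem is applied to the scalar pair u \<bullet> n1, u \<bullet> n2. Off
  the boundary line the divergence of (n1, n2) vanishes, so only the derivatives of \<open>u\<close>
  survive and form \<open>W\<close> times the trace. On the boundary line \<open>n2\<close> is - |a|
  times the conormal, and the free boundary condition says that the conormal is
  \<open>f\<close>.\<close>

lemma chart_first_variation:
  fixes f u :: "real^2 \<Rightarrow> real^'n"
  assumes D: "rel_open D" and f: "smooth_on D f"
    and g: "\<And>p. p \<in> D \<Longrightarrow> gram (partial_deriv D f 1 p) (partial_deriv D f 2 p) > 0"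
    and H: "\<And>p. p \<in> D \<Longrightarrow> mean_curvature_vector D f p = 0"
    and \<nu>: "\<And>p. p \<in> D \<Longrightarrow> p $ 2 = 0 \<Longrightarrow> is_outward_unit_conormal D f p (f p)"
    and K: "compact K" "K \<inter> half_plane \<subseteq> D"
    and u: "c1_on D u" "\<And>p. p \<in> D - K \<Longrightarrow> u p = 0"
  defines "a \<equiv> partial_deriv D f 1" and "b \<equiv> partial_deriv D f 2"
  shows "(\<integral>p. indicator D p * (sqrt (gram (a p) (b p)) *
            frame_trace (a p) (b p) (partial_deriv D u 1 p) (partial_deriv D u 2 p)) \<partial>lborel)
       = (\<integral>t. indicator D (vector [t, 0]) * (norm (a (vector [t, 0])) * (u (vector [t, 0]) \<bullet> f (vector [t, 0]))) \<partial>lborel)"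
proof -
  define W where "W = (\<lambda>p. sqrt (gram (a p) (b p)))"
  define n1 where "n1 = (\<lambda>p. inverse (W p) *\<^sub>R ((b p \<bullet> b p) *\<^sub>R a p - (a p \<bullet> b p) *\<^sub>R b p))"
  define n2 where "n2 = (\<lambda>p. inverse (W p) *\<^sub>R ((a p \<bullet> a p) *\<^sub>R b p - (a p \<bullet> b p) *\<^sub>R a p))"
  have harm: "c1_on D n1" "c1_on D n2" "\<And>p. p \<in> D \<Longrightarrow> 0 < p $ 2 \<Longrightarrow> partial_deriv D n1 1 p + partial_deriv D n2 2 p = 0"
    unfolding n1_def n2_def W_def a_def b_def by (rule minimal_immersion_harmonic[OF D f g H]; assumption)+
  have ab: "c1_on D a" "c1_on D b"
    unfolding a_def b_def using f smooth_on_c1_partial by blast+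
  have gp: "gram (a p) (b p) > 0" if "p \<in> D" for p using g[OF that] by (simp add: a_def b_def)
  let ?v1 = "\<lambda>p. u p \<bullet> n1 p" and ?v2 = "\<lambda>p. u p \<bullet> n2 p"
  have v: "c1_on D ?v1" "c1_on D ?v2" by (intro c1_on_inner D u harm)+
  let ?tr = "\<lambda>p. frame_trace (a p) (b p) (partial_deriv D u 1 p) (partial_deriv D u 2 p)"
  have eq: "W p * ?tr p = partial_deriv D ?v1 1 p + partial_deriv D ?v2 2 p" if p: "p \<in> D" "p $ 2 \<noteq> 0" for p
  proof -
    note diff = c1_on_differentiable[OF _ p(1)]
    have "0 < p $ 2" using D p openin_imp_subset unfolding half_plane_def by fastforce
    then have z: "partial_deriv D n1 1 p + partial_deriv D n2 2 p = 0" using harm(3) p by blast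
    have "W p > 0" "W p * W p = gram (a p) (b p)" using gp[OF p(1)] by (simp_all add: W_def)
    then have "W p * ?tr p = partial_deriv D u 1 p \<bullet> n1 p + partial_deriv D u 2 p \<bullet> n2 p"
      by (simp add: frame_trace_def n1_def n2_def inner_simps field_simps)
    moreover have "u p \<bullet> partial_deriv D n1 1 p + u p \<bullet> partial_deriv D n2 2 p = 0"
      using z by (simp add: inner_add_right[symmetric])
    ultimately show ?thesis
      unfolding partial_deriv_inner[OF D p(1) diff[OF u(1)] diff[OF harm(1)]] partial_deriv_inner[OF D p(1) diff[OF u(1)] diff[OF harm(2)]]
      by simp
  qed
  have cont: "continuous_on D (\<lambda>p. W p * ?tr p)"
    unfolding W_def frame_trace_def
    using gp by (intro continuous_intros c1_on_continuous_partial[OF u(1)] c1_on_continuous[OF ab(1)] c1_on_continuous[OF ab(2)] continuous_on_divide)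
      (auto simp: gram_def intro!: continuous_intros c1_on_continuous[OF ab(1)] c1_on_continuous[OF ab(2)] less_imp_neq[symmetric])
  have "(\<integral>p. indicator D p * (W p * ?tr p) \<partial>lborel)
     = (\<integral>p. indicator D p * (partial_deriv D ?v1 1 p + partial_deriv D ?v2 2 p) \<partial>lborel)"
  proof (rule Bochner_Integration.integral_cong_AE)
    show "(\<lambda>p. indicator D p * (W p * ?tr p)) \<in> borel_measurable lborel"
      using borel_measurable_indicator_times[OF D cont] by simp
    show "(\<lambda>p. indicator D p * (partial_deriv D ?v1 1 p + partial_deriv D ?v2 2 p)) \<in> borel_measurable lborel"
      using borel_measurable_indicator_times[OF D continuous_on_add[OF c1_on_continuous_partial[OF v(1)] c1_on_continuous_partial[OF v(2)]]] by simp
    show "AE p in lborel. indicator D p * (W p * ?tr p) = indicator D p * (partial_deriv D ?v1 1 p + partial_deriv D ?v2 2 p)"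
      using AE_off_boundary_line by eventually_elim (use eq in \<open>auto simp: indicator_def\<close>)
  qed
  also have "\<dots> = - (\<integral>t. indicator D (vector [t, 0]) * ?v2 (vector [t, 0]) \<partial>lborel)"
    by (rule chart_divergence[OF D K v]) (simp_all add: u(2))
  also have "\<dots> = (\<integral>t. - (indicator D (vector [t, 0]) * ?v2 (vector [t, 0])) \<partial>lborel)" by simp
  also have "(\<lambda>t. - (indicator D (vector [t, 0]) * ?v2 (vector [t, 0])))
      = (\<lambda>t. indicator D (vector [t, 0]) * (norm (a (vector [t, 0])) * (u (vector [t, 0]) \<bullet> f (vector [t, 0]))))"
  proof
    fix t
    let ?p = "vector [t, 0] :: real^2"
    show "- (indicator D ?p * ?v2 ?p) = indicator D ?p * (norm (a ?p) * (u ?p \<bullet> f ?p))"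
    proof (cases "?p \<in> D")
      case True
      have "(a ?p \<bullet> a ?p) *\<^sub>R b ?p - (a ?p \<bullet> b ?p) *\<^sub>R a ?p = (- (W ?p * norm (a ?p))) *\<^sub>R f ?p"
        using outward_conormal_eq[OF \<nu>[OF True] g[OF True]] by (simp add: vector_2 a_def b_def W_def)
      then have "n2 ?p = (inverse (W ?p) * - (W ?p * norm (a ?p))) *\<^sub>R f ?p" unfolding n2_def by simp
      also have "\<dots> = (- norm (a ?p)) *\<^sub>R f ?p" using gp[OF True] by (simp add: W_def)
      finally show ?thesis by simp
    qed simp
  qed
  finally show ?thesis unfolding W_def .
qed

text \<open>The hypothesis \<open>eq\<close> is the shape in which the change of variables theorem
  comes. For nonnegative integrands it is equality of extended integrals: either both functions are
  absolutely integrable with the same value, or both integrals are infinite.\<close>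

lemma nn_integral_eq_if_absolutely_integrable_iff:
  fixes f :: "'a::euclidean_space \<Rightarrow> real" and g :: "'b::euclidean_space \<Rightarrow> real"
  assumes f: "(\<lambda>x. indicator A x * f x) \<in> borel_measurable borel" "\<And>x. x \<in> A \<Longrightarrow> 0 \<le> f x"
    and g: "(\<lambda>x. indicator B x * g x) \<in> borel_measurable borel" "\<And>x. x \<in> B \<Longrightarrow> 0 \<le> g x"
    and eq: "\<And>b. f absolutely_integrable_on A \<and> integral A f = b \<longleftrightarrow> g absolutely_integrable_on B \<and> integral B g = b"
  shows "(\<integral>\<^sup>+x. ennreal (f x) * indicator A x \<partial>lborel) = (\<integral>\<^sup>+x. ennreal (g x) * indicator B x \<partial>lborel)"
proof -
  have top: "(\<integral>\<^sup>+x. ennreal (h x) * indicator C x \<partial>lborel) = \<infinity>"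
    if "\<not> h absolutely_integrable_on C" "(\<lambda>x. indicator C x * h x) \<in> borel_measurable borel" "\<And>x. x \<in> C \<Longrightarrow> 0 \<le> h x"
    for h :: "'c::euclidean_space \<Rightarrow> real" and C
  proof (rule ccontr)
    assume "(\<integral>\<^sup>+x. ennreal (h x) * indicator C x \<partial>lborel) \<noteq> \<infinity>"
    moreover have "(\<integral>\<^sup>+x. ennreal (h x) * indicator C x \<partial>lborel) = (\<integral>\<^sup>+x. ennreal (indicator C x * h x) \<partial>lborel)"
      by (intro nn_integral_cong) (auto simp: indicator_def)
    ultimately have "(\<lambda>x. indicator C x * h x) integrable_on UNIV"
      using that(2,3) by (intro nn_integral_integrable_on) (auto simp: indicator_def less_top)
    then have "(\<lambda>x. if x \<in> C then h x else 0) integrable_on UNIV"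
      by (rule integrable_eq) (auto simp: indicator_def)
    then have "h integrable_on C" by (simp add: integrable_restrict_UNIV)
    then have "h absolutely_integrable_on C" using that(3) absolutely_integrable_on_iff_nonneg by blast
    with that(1) show False by simp
  qed
  have fin: "(\<integral>\<^sup>+x. ennreal (h x) * indicator C x \<partial>lborel) = ennreal (integral C h)"
    if "h absolutely_integrable_on C" "\<And>x. x \<in> C \<Longrightarrow> 0 \<le> h x" for h :: "'c::euclidean_space \<Rightarrow> real" and C
    by (rule nn_integral_has_integral_lebesgue'[OF that(2)])
       (use that(1) in \<open>auto simp: integrable_integral set_lebesgue_integral_eq_integral(1)\<close>)
  show ?thesis
    by (cases "f absolutely_integrable_on A") (use eq fin top f g in \<open>metis+\<close>)
qed

lemma change_of_variables_real_valued:
  fixes f :: "real^2 \<Rightarrow> real" and \<tau> :: "real^2 \<Rightarrow> real^2"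
  assumes "S \<in> sets lebesgue" "\<And>x. x \<in> S \<Longrightarrow> (\<tau> has_derivative \<tau>' x) (at x within S)" "inj_on \<tau> S"
  shows "(\<lambda>x. \<bar>det (matrix (\<tau>' x))\<bar> * f (\<tau> x)) absolutely_integrable_on S \<and>
           integral S (\<lambda>x. \<bar>det (matrix (\<tau>' x))\<bar> * f (\<tau> x)) = b
     \<longleftrightarrow> f absolutely_integrable_on (\<tau> ` S) \<and> integral (\<tau> ` S) f = b"
  using has_absolute_integral_change_of_variables[OF assms, of "\<lambda>x. vec (f x) :: real^1" "vec b"]
  by (simp add: absolutely_integrable_on_1_iff integral_on_1_eq)

section \<open>Charts and transition maps\<close>

locale free_boundary_surface =
  fixes M :: "'m::t2_space set" and P :: "'m patch set" and F :: "'m \<Rightarrow> real^'n"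
  assumes fbms: "free_boundary_minimal_surface M P F"
begin

lemma surface: "smooth_surface M P" and compact_M: "compact M" and boundary_nonempty: "surface_boundary P \<noteq> {}"
  and F_cball: "m \<in> M \<Longrightarrow> norm (F m) \<le> 1"
  using fbms by (auto simp: free_boundary_minimal_surface_def)

lemma M_covered: "m \<in> M \<Longrightarrow> \<exists>D X p. (D, X) \<in> P \<and> p \<in> D \<and> X p = m"
  using surface unfolding smooth_surface_def by fast

lemma M_borel: "M \<in> sets borel"
  using compact_M compact_imp_closed borel_closed by blast

section \<open>Properties of a single chart\<close>

context
  fixes D X assumes c: "(D, X) \<in> P"
begin

lemma chart_open: "rel_open D" and chart_image_open: "openin (top_of_set M) (X ` D)"
  and chart_homeo: "homeomorphism D (X ` D) X (inv_into D X)"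
  using surface c unfolding smooth_surface_def by fast+

lemma chart_in_M: "p \<in> D \<Longrightarrow> X p \<in> M"
  using chart_image_open openin_imp_subset by blast

lemma chart_continuous: "continuous_on D X"
  using chart_homeo homeomorphism_cont1 by blast

lemma chart_inj: "inj_on X D"
  using chart_homeo by (metis homeomorphism_apply1 inj_on_inverseI)

lemma chart_smooth: "smooth_on D (F \<circ> X)"
  using fbms c unfolding free_boundary_minimal_surface_def minimal_immersion_def smooth_immersion_def by fast

lemma chart_c1: "c1_on D (F \<circ> X)"
  using chart_smooth smooth_on_c1 by blast

lemma chart_gram_pos:
  assumes "p \<in> D"
  shows "gram (partial_deriv D (F \<circ> X) 1 p) (partial_deriv D (F \<circ> X) 2 p) > 0"
proof (rule gram_pos)
  show "s = 0 \<and> t = 0" if "s *\<^sub>R partial_deriv D (F \<circ> X) 1 p + t *\<^sub>R partial_deriv D (F \<circ> X) 2 p = 0" for s t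
    using that fbms c assms unfolding free_boundary_minimal_surface_def minimal_immersion_def smooth_immersion_def by fast
qed

lemma chart_minimal: "p \<in> D \<Longrightarrow> mean_curvature_vector D (F \<circ> X) p = 0"
  using fbms c unfolding free_boundary_minimal_surface_def minimal_immersion_def by fast

lemma chart_conormal: "p \<in> D \<Longrightarrow> p $ 2 = 0 \<Longrightarrow> is_outward_unit_conormal D (F \<circ> X) p ((F \<circ> X) p)"
  using fbms c unfolding free_boundary_minimal_surface_def by fastforce

lemma chart_boundary_norm: "p \<in> D \<Longrightarrow> p $ 2 = 0 \<Longrightarrow> norm (F (X p)) = 1"
  using chart_conormal by (auto simp: is_outward_unit_conormal_def)

lemma chart_image_borel: "X ` D \<in> sets borel"
  using chart_image_open M_borel by (auto simp: openin_open)

lemma openin_chart_image: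
  assumes "rel_open D'" "D' \<subseteq> D"
  shows "openin (top_of_set M) (X ` D')"
proof -
  have "openin (top_of_set D) D'" using assms chart_open by (meson openin_imp_subset openin_subset_trans)
  then have "openin (top_of_set (X ` D)) (X ` D')"
    using homeomorphism_imp_open_map[OF chart_homeo] by blast
  then show ?thesis using chart_image_open openin_trans by blast
qed

lemma rel_open_chart_preimage:
  assumes "openin (top_of_set M) V"
  shows "rel_open {p \<in> D. X p \<in> V}"
proof -
  have "openin (top_of_set D) (D \<inter> X -` V)"
    by (rule continuous_openin_preimage[OF chart_continuous _ assms]) (use chart_in_M in auto)
  moreover have "D \<inter> X -` V = {p \<in> D. X p \<in> V}" by auto
  ultimately show ?thesis using chart_open openin_trans by fastforce
qed

end

definition chart_div :: "(real^2) set \<Rightarrow> (real^2 \<Rightarrow> 'm) \<Rightarrow> ('m \<Rightarrow> real^'n) \<Rightarrow> real^2 \<Rightarrow> real" where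
  "chart_div D X u p = frame_trace (partial_deriv D (F \<circ> X) 1 p) (partial_deriv D (F \<circ> X) 2 p)
     (partial_deriv D (u \<circ> X) 1 p) (partial_deriv D (u \<circ> X) 2 p)"

definition area_density :: "(real^2) set \<Rightarrow> (real^2 \<Rightarrow> 'm) \<Rightarrow> real^2 \<Rightarrow> real" where
  "area_density D X p = sqrt (gram (partial_deriv D (F \<circ> X) 1 p) (partial_deriv D (F \<circ> X) 2 p))"

section \<open>Change of charts\<close>

context
  fixes D X E Y assumes c: "(D, X) \<in> P" and d: "(E, Y) \<in> P"
begin

lemma overlap_open: "rel_open {p \<in> D. X p \<in> Y ` E}"
  by (rule rel_open_chart_preimage[OF c chart_image_open[OF d]])

lemma transition_c1: "c1_on {p \<in> D. X p \<in> Y ` E} (inv_into E Y \<circ> X)"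
  using surface c d unfolding smooth_surface_def by (intro smooth_on_c1) fast

lemma transition_in: "p \<in> D \<Longrightarrow> X p \<in> Y ` E \<Longrightarrow> inv_into E Y (X p) \<in> E"
  and transition_apply: "p \<in> D \<Longrightarrow> X p \<in> Y ` E \<Longrightarrow> Y (inv_into E Y (X p)) = X p"
  by (auto intro: inv_into_into f_inv_into_f)

text \<open>On the overlap \<open>u \<circ> X\<close> is \<open>u \<circ> Y\<close> after the
  transition map. The overlap is relatively open in \<open>D\<close>, so the derivative found there
  is the derivative within \<open>D\<close>, also at boundary points.\<close>

lemma chain_rule_transition:
  fixes u :: "'m \<Rightarrow> 'b::real_normed_vector"
  assumes p: "p \<in> D" "X p \<in> Y ` E"
  defines "q \<equiv> inv_into E Y (X p)" and "O' \<equiv> {p \<in> D. X p \<in> Y ` E}"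
  defines "\<tau> \<equiv> \<lambda>i. partial_deriv O' (inv_into E Y \<circ> X) i p"
  assumes u: "(u \<circ> Y) differentiable at q within E"
  shows "(u \<circ> X) differentiable at p within D"
    "partial_deriv D (u \<circ> X) i p = (\<tau> i $ 1) *\<^sub>R partial_deriv E (u \<circ> Y) 1 q + (\<tau> i $ 2) *\<^sub>R partial_deriv E (u \<circ> Y) 2 q"
proof -
  have O: "rel_open O'" "p \<in> O'" "O' \<subseteq> D" using overlap_open p by (auto simp: O'_def)
  have \<tau>: "((inv_into E Y \<circ> X) has_derivative (\<lambda>h. (h $ 1) *\<^sub>R \<tau> 1 + (h $ 2) *\<^sub>R \<tau> 2)) (at p within O')"
    unfolding \<tau>_def by (intro has_derivative_partials c1_on_differentiable[OF transition_c1[folded O'_def] O(2)])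
  have "((\<lambda>x. (u \<circ> Y) ((inv_into E Y \<circ> X) x)) has_derivative
      (\<lambda>h. (((h $ 1) *\<^sub>R \<tau> 1 + (h $ 2) *\<^sub>R \<tau> 2) $ 1) *\<^sub>R partial_deriv E (u \<circ> Y) 1 q
         + (((h $ 1) *\<^sub>R \<tau> 1 + (h $ 2) *\<^sub>R \<tau> 2) $ 2) *\<^sub>R partial_deriv E (u \<circ> Y) 2 q)) (at p within O')"
  proof (rule has_derivative_in_compose[OF \<tau>])
    have q: "(inv_into E Y \<circ> X) p = q" by (simp add: q_def)
    have "(inv_into E Y \<circ> X) ` O' \<subseteq> E" by (auto simp: O'_def intro!: inv_into_into)
    then show "((u \<circ> Y) has_derivative (\<lambda>h. (h $ 1) *\<^sub>R partial_deriv E (u \<circ> Y) 1 q + (h $ 2) *\<^sub>R partial_deriv E (u \<circ> Y) 2 q))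
        (at ((inv_into E Y \<circ> X) p) within (inv_into E Y \<circ> X) ` O')"
      unfolding q by (rule has_derivative_subset[OF has_derivative_partials[OF u]])
  qed
  then have "((u \<circ> X) has_derivative
      (\<lambda>h. (((h $ 1) *\<^sub>R \<tau> 1 + (h $ 2) *\<^sub>R \<tau> 2) $ 1) *\<^sub>R partial_deriv E (u \<circ> Y) 1 q
         + (((h $ 1) *\<^sub>R \<tau> 1 + (h $ 2) *\<^sub>R \<tau> 2) $ 2) *\<^sub>R partial_deriv E (u \<circ> Y) 2 q)) (at p within O')"
    by (rule has_derivative_transform[OF O(2), rotated]) (auto simp: O'_def transition_apply)
  then have *: "((u \<circ> X) has_derivative
      (\<lambda>h. (((h $ 1) *\<^sub>R \<tau> 1 + (h $ 2) *\<^sub>R \<tau> 2) $ 1) *\<^sub>R partial_deriv E (u \<circ> Y) 1 q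
         + (((h $ 1) *\<^sub>R \<tau> 1 + (h $ 2) *\<^sub>R \<tau> 2) $ 2) *\<^sub>R partial_deriv E (u \<circ> Y) 2 q)) (at p within D)"
    using at_within_rel_open[OF chart_open[OF c] O(1,3,2)] by simp
  then show "(u \<circ> X) differentiable at p within D" by (rule differentiableI)
  show "partial_deriv D (u \<circ> X) i p = (\<tau> i $ 1) *\<^sub>R partial_deriv E (u \<circ> Y) 1 q + (\<tau> i $ 2) *\<^sub>R partial_deriv E (u \<circ> Y) 2 q"
    unfolding partial_deriv_eq[OF chart_open[OF c] p(1) *] using exhaust_2[of i] by (auto simp: axis_def)
qed

text \<open>The Gram determinant in the chart \<open>X\<close> is the squared Jacobian times the one
  in \<open>Y\<close>. As the former is positive, the Jacobian cannot vanish: invertibility of the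
  transition derivative follows from \<open>F\<close> being an immersion.\<close>

lemma transition_gram:
  assumes p: "p \<in> D" "X p \<in> Y ` E"
  defines "q \<equiv> inv_into E Y (X p)" and "O' \<equiv> {p \<in> D. X p \<in> Y ` E}"
  defines "\<tau> \<equiv> \<lambda>i. partial_deriv O' (inv_into E Y \<circ> X) i p"
  shows "\<tau> 1 $ 1 * \<tau> 2 $ 2 - \<tau> 1 $ 2 * \<tau> 2 $ 1 \<noteq> 0"
    "area_density D X p = \<bar>\<tau> 1 $ 1 * \<tau> 2 $ 2 - \<tau> 1 $ 2 * \<tau> 2 $ 1\<bar> * area_density E Y q"
proof -
  have q: "q \<in> E" using transition_in p by (simp add: q_def)
  have *: "partial_deriv D (F \<circ> X) i p = (\<tau> i $ 1) *\<^sub>R partial_deriv E (F \<circ> Y) 1 q + (\<tau> i $ 2) *\<^sub>R partial_deriv E (F \<circ> Y) 2 q" for i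
    using chain_rule_transition(2)[OF p, of F i] c1_on_differentiable[OF chart_c1[OF d] q] by (simp add: q_def \<tau>_def O'_def)
  have **: "gram (partial_deriv D (F \<circ> X) 1 p) (partial_deriv D (F \<circ> X) 2 p)
     = (\<tau> 1 $ 1 * \<tau> 2 $ 2 - \<tau> 1 $ 2 * \<tau> 2 $ 1)\<^sup>2 * gram (partial_deriv E (F \<circ> Y) 1 q) (partial_deriv E (F \<circ> Y) 2 q)"
    unfolding *[of 1] *[of 2] gram_transform ..
  then show "\<tau> 1 $ 1 * \<tau> 2 $ 2 - \<tau> 1 $ 2 * \<tau> 2 $ 1 \<noteq> 0"
    using chart_gram_pos[OF c p(1)] by auto
  show "area_density D X p = \<bar>\<tau> 1 $ 1 * \<tau> 2 $ 2 - \<tau> 1 $ 2 * \<tau> 2 $ 1\<bar> * area_density E Y q"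
    unfolding area_density_def ** by (simp add: real_sqrt_mult)
qed

text \<open>Invariance of the trace under a change of frame; it makes the divergence a function on
  the surface itself.\<close>

lemma transition_chart_div:
  assumes p: "p \<in> D" "X p \<in> Y ` E"
  defines "q \<equiv> inv_into E Y (X p)"
  assumes u: "(u \<circ> Y) differentiable at q within E"
  shows "chart_div D X u p = chart_div E Y u q"
proof -
  have q: "q \<in> E" using transition_in p by (simp add: q_def)
  show ?thesis
    unfolding chart_div_def chain_rule_transition(2)[OF p u[unfolded q_def]]
      chain_rule_transition(2)[OF p c1_on_differentiable[OF chart_c1[OF d] q, unfolded q_def]] q_def[symmetric]
    by (rule frame_trace_transform[OF transition_gram(1)[OF p]])
qed

text \<open>
  A boundary point of one chart is a boundary point of every chart: at an interior point with
  \<open>|F| = 1\<close> the function \<open>|F|\<^sup>2\<close> has a maximum, so \<open>F\<close> is normal, but at a boundary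
  point it is tangential.
\<close>

lemma boundary_invariant:
  assumes p: "p \<in> D" "X p \<in> Y ` E" "p $ 2 = 0"
  shows "inv_into E Y (X p) $ 2 = 0"
proof (rule ccontr)
  define q where "q = inv_into E Y (X p)"
  assume "inv_into E Y (X p) $ 2 \<noteq> 0"
  then have q: "q \<in> E" "Y q = X p" "q $ 2 \<noteq> 0" using transition_in transition_apply p by (auto simp: q_def)
  then have q2: "0 < q $ 2" using chart_open[OF d] openin_imp_subset unfolding half_plane_def by fastforce
  let ?f = "F \<circ> Y"
  have diff: "?f differentiable at q within E" by (rule c1_on_differentiable[OF chart_c1[OF d] q(1)])
  have max: "?f x \<bullet> ?f x \<le> ?f q \<bullet> ?f q" if "x \<in> E" for x
  proof -
    have "norm (?f x) \<le> 1" using F_cball chart_in_M[OF d that] by simp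
    moreover have "norm (?f q) = 1" using chart_boundary_norm[OF c p(1,3)] q(2) by simp
    ultimately show ?thesis by (simp add: dot_square_norm power_le_one)
  qed
  obtain r where r: "r > 0" "\<And>x y. \<bar>x - q $ 1\<bar> < r \<Longrightarrow> \<bar>y - q $ 2\<bar> < r \<Longrightarrow> vector [x, y] \<in> E \<and> 0 < y"
    using box_in_rel_open[OF chart_open[OF d] q(1) q2] by blast
  define x0 y0 where "x0 = q $ 1" and "y0 = q $ 2"
  have qv: "vector [x0, y0] = q" by (simp add: x0_def y0_def vec_eq_iff forall_2 vector_2)
  have box: "vector [x, y0] \<in> E" if "\<bar>x0 - x\<bar> < r" for x
    using r that by (auto simp: x0_def y0_def abs_minus_commute)
  have box': "vector [x0, y] \<in> E" if "\<bar>y0 - y\<bar> < r" for y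
    using r that by (auto simp: x0_def y0_def abs_minus_commute)
  have c1: "c1_on E (\<lambda>x. ?f x \<bullet> ?f x)" by (intro c1_on_inner chart_open[OF d] chart_c1[OF d])
  have pd: "partial_deriv E (\<lambda>x. ?f x \<bullet> ?f x) i q = 2 * (?f q \<bullet> partial_deriv E ?f i q)" for i
    using partial_deriv_inner[OF chart_open[OF d] q(1) diff diff] by (simp add: inner_commute)
  have line: "((\<lambda>s. ?f (vector [s, y0]) \<bullet> ?f (vector [s, y0])) has_real_derivative partial_deriv E (\<lambda>x. ?f x \<bullet> ?f x) 1 q) (at x0)"
    "((\<lambda>s. ?f (vector [x0, s]) \<bullet> ?f (vector [x0, s])) has_real_derivative partial_deriv E (\<lambda>x. ?f x \<bullet> ?f x) 2 q) (at y0)"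
    using partial_derivs_along_axes[OF chart_open[OF d] _ _ c1, of x0 y0] q(1) q2 unfolding y0_def[symmetric] qv by blast+
  have "partial_deriv E (\<lambda>x. ?f x \<bullet> ?f x) 1 q = 0"
    by (rule DERIV_local_max[OF line(1) r(1)]) (use box max in \<open>simp add: qv\<close>)
  moreover have "partial_deriv E (\<lambda>x. ?f x \<bullet> ?f x) 2 q = 0"
    by (rule DERIV_local_max[OF line(2) r(1)]) (use box' max in \<open>simp add: qv\<close>)
  ultimately have orth: "?f q \<bullet> partial_deriv E ?f i q = 0" for i using pd exhaust_2[of i] by auto
  obtain a :: "real^2" where a: "F (X p) = (\<Sum>i\<in>UNIV. a $ i *\<^sub>R partial_deriv D (F \<circ> X) i p)"
    using chart_conormal[OF c p(1,3)] by (auto simp: is_outward_unit_conormal_def)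
  have "F (X p) \<bullet> partial_deriv D (F \<circ> X) i p = 0" for i
    unfolding chain_rule_transition(2)[OF p(1,2) diff[unfolded q_def]]
    using orth q(2) by (simp add: inner_simps q_def)
  then have "F (X p) \<bullet> F (X p) = 0" by (subst (2) a) (simp add: inner_simps sum_2)
  then show False using chart_boundary_norm[OF c p(1,3)] by simp
qed

end

end

section \<open>Area and length measures\<close>

text \<open>One construction for both Riemannian measures: \<open>A\<close> is a chart domain
  weighted by the area density, or the boundary line of a domain weighted by the speed.\<close>

definition weighted_image_measure :: "'a::euclidean_space set \<Rightarrow> ('a \<Rightarrow> real) \<Rightarrow> ('a \<Rightarrow> 'b::topological_space) \<Rightarrow> 'b measure" where
  "weighted_image_measure A w T = distr (density (restrict_space lborel A) (\<lambda>p. ennreal (w p))) borel T"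

lemma sets_weighted_image_measure [simp, measurable_cong]: "sets (weighted_image_measure A w T) = sets borel"
  and space_weighted_image_measure [simp]: "space (weighted_image_measure A w T) = UNIV"
  by (simp_all add: weighted_image_measure_def)

context
  fixes A :: "'a::euclidean_space set" and w :: "'a \<Rightarrow> real" and T :: "'a \<Rightarrow> 'b::topological_space"
  assumes A: "A \<in> sets borel" and w: "continuous_on A w" "\<And>p. p \<in> A \<Longrightarrow> 0 \<le> w p" and T: "continuous_on A T"
begin

lemma measurable_weight: "w \<in> borel_measurable (restrict_space lborel A)"
  and measurable_image_map: "T \<in> measurable (restrict_space lborel A) borel"
  using borel_measurable_continuous_on_restrict[OF w(1)] borel_measurable_continuous_on_restrict[OF T]
  by (simp_all add: measurable_cong_sets[OF sets_restrict_space_cong[OF sets_lborel] refl])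

lemma nn_integral_weighted_image_measure:
  assumes [measurable]: "h \<in> borel_measurable borel"
  shows "(\<integral>\<^sup>+m. h m \<partial>weighted_image_measure A w T) = (\<integral>\<^sup>+p. ennreal (w p) * h (T p) * indicator A p \<partial>lborel)"
proof -
  note [measurable] = measurable_weight measurable_image_map
  have "(\<integral>\<^sup>+m. h m \<partial>weighted_image_measure A w T) = (\<integral>\<^sup>+p. ennreal (w p) * h (T p) \<partial>restrict_space lborel A)"
    unfolding weighted_image_measure_def by (subst nn_integral_distr, simp, measurable) (subst nn_integral_density, measurable)
  also have "\<dots> = (\<integral>\<^sup>+p. ennreal (w p) * h (T p) * indicator A p \<partial>lborel)"
    using A by (subst nn_integral_restrict_space) auto
  finally show ?thesis .
qed

lemma integral_weighted_image_measure:
  fixes h :: "'b \<Rightarrow> real"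
  assumes [measurable]: "h \<in> borel_measurable borel"
  shows "(\<integral>m. h m \<partial>weighted_image_measure A w T) = (\<integral>p. indicator A p * (w p * h (T p)) \<partial>lborel)"
proof -
  note [measurable] = measurable_weight measurable_image_map
  have ae: "AE p in restrict_space lborel A. 0 \<le> w p"
    using w(2) A by (subst AE_restrict_space_iff) auto
  have "(\<integral>m. h m \<partial>weighted_image_measure A w T) = (\<integral>p. w p *\<^sub>R h (T p) \<partial>restrict_space lborel A)"
    unfolding weighted_image_measure_def
    by (subst integral_distr, simp, measurable) (subst integral_density[OF _ _ ae], measurable)
  also have "\<dots> = (\<integral>p. indicator A p * (w p * h (T p)) \<partial>lborel)"
    using A by (subst integral_restrict_space) auto
  finally show ?thesis .
qed

lemma emeasure_weighted_image_measure:
  assumes [measurable]: "S \<in> sets borel"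
  shows "emeasure (weighted_image_measure A w T) S = (\<integral>\<^sup>+p\<in>{p \<in> A. T p \<in> S}. ennreal (w p) \<partial>lborel)"
proof -
  have "emeasure (weighted_image_measure A w T) S = (\<integral>\<^sup>+m. indicator S m \<partial>weighted_image_measure A w T)" by simp
  also have "\<dots> = (\<integral>\<^sup>+p\<in>{p \<in> A. T p \<in> S}. ennreal (w p) \<partial>lborel)"
    by (subst nn_integral_weighted_image_measure) (auto intro!: nn_integral_cong simp: indicator_def)
  finally show ?thesis .
qed

end

lemma open_boundary_line:
  assumes "rel_open D"
  shows "open {t. vector [t, 0] \<in> D}"
proof -
  obtain T where T: "open T" "D = half_plane \<inter> T" using assms by (auto simp: openin_open)
  have "{t. vector [t, 0] \<in> D} = (\<lambda>t. vector [t, 0]) -` T"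
    unfolding T(2) by (auto simp: half_plane_def vector_2)
  also have "open \<dots>"
    by (rule open_vimage[OF T(1)]) (intro continuous_intros)
  finally show ?thesis .
qed

lemma has_derivative_boundary_line:
  assumes D: "rel_open D" "vector [t, 0] \<in> D" and f: "f differentiable at (vector [t, 0]) within D"
  shows "((\<lambda>s. f (vector [s, 0])) has_derivative (\<lambda>h. h *\<^sub>R partial_deriv D f 1 (vector [t, 0]))) (at t)"
proof -
  let ?L = "{s. vector [s, 0] \<in> D}"
  have "(\<lambda>s. vector [s, 0] :: real^2) = (\<lambda>s. s *\<^sub>R axis 1 1)"
    using vec2_eq[of "(_, 0)"] by auto
  then have d: "((\<lambda>s. vector [s, 0] :: real^2) has_derivative (\<lambda>s. s *\<^sub>R axis 1 1)) (at t within ?L)"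
    by (auto intro!: derivative_eq_intros)
  have "((\<lambda>s. f (vector [s, 0])) has_derivative (\<lambda>h. ((h *\<^sub>R axis 1 1 :: real^2) $ 1) *\<^sub>R partial_deriv D f 1 (vector [t, 0])
      + ((h *\<^sub>R axis 1 1 :: real^2) $ 2) *\<^sub>R partial_deriv D f 2 (vector [t, 0]))) (at t within ?L)"
    by (rule has_derivative_in_compose[OF d has_derivative_subset[OF has_derivative_partials[OF f]]]) auto
  then show ?thesis
    using at_within_open[OF _ open_boundary_line[OF D(1)], of t] D(2) by (simp add: axis_def)
qed

section \<open>Area and boundary length measures carried by one chart\<close>

context free_boundary_surface
begin

definition area_measure :: "'m patch \<Rightarrow> 'm measure" where
  "area_measure = (\<lambda>(D, X). weighted_image_measure D (area_density D X) X)"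

definition boundary_line :: "(real^2) set \<Rightarrow> real set" where
  "boundary_line D = {t. vector [t, 0] \<in> D}"

definition length_density :: "(real^2) set \<Rightarrow> (real^2 \<Rightarrow> 'm) \<Rightarrow> real \<Rightarrow> real" where
  "length_density D X t = norm (partial_deriv D (F \<circ> X) 1 (vector [t, 0]))"

definition length_measure :: "'m patch \<Rightarrow> 'm measure" where
  "length_measure = (\<lambda>(D, X). weighted_image_measure (boundary_line D) (length_density D X) (\<lambda>t. X (vector [t, 0])))"

lemma sets_area_measure [simp, measurable_cong]: "sets (area_measure c) = sets borel"
  and sets_length_measure [simp, measurable_cong]: "sets (length_measure c) = sets borel"
  by (simp_all add: area_measure_def length_measure_def split: prod.split)

context
  fixes D X assumes c: "(D, X) \<in> P"
begin

lemma area_density_continuous: "continuous_on D (area_density D X)"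
  unfolding area_density_def gram_def
  by (intro continuous_intros c1_on_continuous_partial[OF chart_c1[OF c]])

lemma area_density_pos: "p \<in> D \<Longrightarrow> 0 < area_density D X p"
  using chart_gram_pos[OF c] by (simp add: area_density_def)

lemma boundary_line_borel: "boundary_line D \<in> sets borel"
proof -
  have "(\<lambda>t. vector [t, 0] :: real^2) -` D \<inter> space borel \<in> sets borel"
    by (rule measurable_sets[OF borel_measurable_boundary_line rel_open_borel[OF chart_open[OF c]]])
  then show ?thesis by (simp add: boundary_line_def vimage_def)
qed

lemma length_density_continuous: "continuous_on (boundary_line D) (length_density D X)"
  unfolding length_density_def
  by (intro continuous_intros continuous_on_compose2[OF c1_on_continuous_partial[OF chart_c1[OF c]]])
     (auto simp: boundary_line_def)

lemma length_density_nonneg: "t \<in> boundary_line D \<Longrightarrow> 0 \<le> length_density D X t"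
  by (simp add: length_density_def)

lemma boundary_chart_continuous: "continuous_on (boundary_line D) (\<lambda>t. X (vector [t, 0]))"
  by (intro continuous_on_compose2[OF chart_continuous[OF c]] continuous_intros) (auto simp: boundary_line_def)

lemmas area_measure_facts = rel_open_borel[OF chart_open[OF c]] area_density_continuous less_imp_le[OF area_density_pos] chart_continuous[OF c]
lemmas length_measure_facts = boundary_line_borel length_density_continuous length_density_nonneg boundary_chart_continuous

lemma patch_area_eq: "S \<in> sets borel \<Longrightarrow> patch_area F (D, X) S = emeasure (area_measure (D, X)) S"
  unfolding area_measure_def
  by (simp add: emeasure_weighted_image_measure[OF area_measure_facts] patch_area_def det_induced_metric area_density_def)

lemma patch_boundary_length_eq:
  assumes "S \<in> sets borel"
  shows "patch_boundary_length F (D, X) S = emeasure (length_measure (D, X)) S"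
proof -
  have "emeasure (length_measure (D, X)) S = (\<integral>\<^sup>+t\<in>{t \<in> boundary_line D. X (vector [t, 0]) \<in> S}. ennreal (length_density D X t) \<partial>lborel)"
    unfolding length_measure_def split by (rule emeasure_weighted_image_measure[OF length_measure_facts assms])
  then show ?thesis
    by (simp add: patch_boundary_length_def length_density_def induced_metric_def boundary_line_def norm_eq_sqrt_inner)
qed

end

section \<open>Chart independence of the two measures\<close>

context
  fixes D X E Y S assumes c: "(D, X) \<in> P" and d: "(E, Y) \<in> P"
    and S: "S \<in> sets borel" "S \<subseteq> X ` D \<inter> Y ` E"
begin

lemma chart_preimage_borel: "{p \<in> D. X p \<in> S} \<in> sets borel" "{p \<in> E. Y p \<in> S} \<in> sets borel"
proof -
  have "{p \<in> D. X p \<in> S} \<in> sets borel" if "(D, X) \<in> P" for D X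
  proof -
    have "X -` S \<inter> space (restrict_space borel D) \<in> sets (restrict_space borel D)"
      by (rule measurable_sets[OF borel_measurable_continuous_on_restrict[OF chart_continuous[OF that]] S(1)])
    moreover have "X -` S \<inter> space (restrict_space borel D) = {p \<in> D. X p \<in> S}" by (auto simp: space_restrict_space)
    ultimately show ?thesis using rel_open_borel[OF chart_open[OF that]] by (simp add: sets_restrict_space_iff)
  qed
  from this[OF c] this[OF d] show "{p \<in> D. X p \<in> S} \<in> sets borel" "{p \<in> E. Y p \<in> S} \<in> sets borel" .
qed

text \<open>Change of variables along the transition map, whose Jacobian is the factor between the
  two densities. The change of variables theorem accepts derivatives within the preimage of
  \<open>S\<close>, so boundary points need no separate treatment.\<close>

lemma area_measure_overlap: "emeasure (area_measure (D, X)) S = emeasure (area_measure (E, Y)) S"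
proof -
  let ?A = "{p \<in> D. X p \<in> S}" and ?B = "{p \<in> E. Y p \<in> S}" and ?O = "{p \<in> D. X p \<in> Y ` E}"
  let ?\<tau> = "inv_into E Y \<circ> X"
  let ?d = "\<lambda>i. partial_deriv ?O ?\<tau> i"
  have O: "rel_open ?O" by (rule overlap_open[OF c d])
  have AO: "?A \<subseteq> ?O" using S by auto
  have B: "?\<tau> ` ?A = ?B"
  proof (intro equalityI subsetI)
    fix q assume q: "q \<in> ?B"
    then obtain p where p: "p \<in> D" "X p = Y q" using S(2) by (metis (lifting) IntE imageE mem_Collect_eq subset_iff)
    then have "?\<tau> p = q" using q chart_inj[OF d] by (simp add: inv_into_f_f)
    moreover have "p \<in> ?A" using p q by auto
    ultimately show "q \<in> ?\<tau> ` ?A" by (metis (lifting) image_eqI)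
  next
    fix q assume "q \<in> ?\<tau> ` ?A"
    then obtain p where p: "p \<in> ?A" "q = ?\<tau> p" by blast
    then have "p \<in> D" "X p \<in> Y ` E" using AO by auto
    then show "q \<in> ?B" using p transition_apply[OF c d] transition_in[OF c d] by simp
  qed
  have inj: "inj_on ?\<tau> ?A"
  proof (rule inj_onI)
    fix p p' assume p: "p \<in> ?A" "p' \<in> ?A" "?\<tau> p = ?\<tau> p'"
    then have O: "p \<in> D" "X p \<in> Y ` E" "p' \<in> D" "X p' \<in> Y ` E" using AO by auto
    from p(3) have "Y (inv_into E Y (X p)) = Y (inv_into E Y (X p'))" by simp
    then have "X p = X p'" unfolding transition_apply[OF c d O(1,2)] transition_apply[OF c d O(3,4)] .
    from inj_onD[OF chart_inj[OF c] this O(1,3)] show "p = p'" .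
  qed
  have der: "(?\<tau> has_derivative (\<lambda>h. (h $ 1) *\<^sub>R ?d 1 p + (h $ 2) *\<^sub>R ?d 2 p)) (at p within ?A)" if "p \<in> ?A" for p
  proof -
    have "p \<in> ?O" using that AO by blast
    then show ?thesis
      by (intro has_derivative_subset[OF has_derivative_partials AO] c1_on_differentiable[OF transition_c1[OF c d]])
  qed
  have det: "det (matrix (\<lambda>h. (h $ 1) *\<^sub>R ?d 1 p + (h $ 2) *\<^sub>R ?d 2 p)) = ?d 1 p $ 1 * ?d 2 p $ 2 - ?d 1 p $ 2 * ?d 2 p $ 1" for p
    by (simp add: det_2 matrix_def axis_def)
  have dens: "area_density D X p = \<bar>det (matrix (\<lambda>h. (h $ 1) *\<^sub>R ?d 1 p + (h $ 2) *\<^sub>R ?d 2 p))\<bar> * area_density E Y (?\<tau> p)" if "p \<in> ?A" for p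
  proof -
    have "p \<in> D" "X p \<in> Y ` E" using that AO by auto
    from transition_gram(2)[OF c d this] show ?thesis by (simp only: det o_apply)
  qed
  have meas: "(\<lambda>p. indicator {p \<in> D. X p \<in> S} p * area_density D X p) \<in> borel_measurable borel"
    if "(D, X) \<in> P" "{p \<in> D. X p \<in> S} \<in> sets borel" for D X
    using borel_measurable_continuous_on_indicator[OF that(2) continuous_on_subset[OF area_density_continuous[OF that(1)]]] by auto
  have "(\<integral>\<^sup>+p. ennreal (area_density D X p) * indicator ?A p \<partial>lborel) = (\<integral>\<^sup>+p. ennreal (area_density E Y p) * indicator ?B p \<partial>lborel)"
  proof (rule nn_integral_eq_if_absolutely_integrable_iff)
    fix b
    have "area_density D X absolutely_integrable_on ?A \<longleftrightarrow>
        (\<lambda>p. \<bar>det (matrix (\<lambda>h. (h $ 1) *\<^sub>R ?d 1 p + (h $ 2) *\<^sub>R ?d 2 p))\<bar> * area_density E Y (?\<tau> p)) absolutely_integrable_on ?A"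
      using dens by (intro set_integrable_cong) auto
    moreover have "integral ?A (area_density D X) =
       integral ?A (\<lambda>p. \<bar>det (matrix (\<lambda>h. (h $ 1) *\<^sub>R ?d 1 p + (h $ 2) *\<^sub>R ?d 2 p))\<bar> * area_density E Y (?\<tau> p))"
      using dens by (intro Henstock_Kurzweil_Integration.integral_cong) auto
    ultimately show "area_density D X absolutely_integrable_on ?A \<and> integral ?A (area_density D X) = b
      \<longleftrightarrow> area_density E Y absolutely_integrable_on ?B \<and> integral ?B (area_density E Y) = b"
      using change_of_variables_real_valued[OF _ der inj, of "area_density E Y" b] chart_preimage_borel
      unfolding B by auto
  qed (use meas[OF c] meas[OF d] chart_preimage_borel area_density_pos[OF c] area_density_pos[OF d] in \<open>auto intro: less_imp_le\<close>)
  then show ?thesis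
    unfolding area_measure_def split
    by (simp add: emeasure_weighted_image_measure[OF area_measure_facts[OF c]] emeasure_weighted_image_measure[OF area_measure_facts[OF d]] S(1))
qed

lemma boundary_preimage_borel:
  "{t \<in> boundary_line D. X (vector [t, 0]) \<in> S} \<in> sets borel"
  "{t \<in> boundary_line E. Y (vector [t, 0]) \<in> S} \<in> sets borel"
proof -
  have 1: "{t \<in> boundary_line D. X (vector [t, 0]) \<in> S} = (\<lambda>t. vector [t, 0] :: real^2) -` {p \<in> D. X p \<in> S} \<inter> space borel"
    and 2: "{t \<in> boundary_line E. Y (vector [t, 0]) \<in> S} = (\<lambda>t. vector [t, 0] :: real^2) -` {p \<in> E. Y p \<in> S} \<inter> space borel"
    by (simp_all add: boundary_line_def vimage_def)
  show "{t \<in> boundary_line D. X (vector [t, 0]) \<in> S} \<in> sets borel"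
    unfolding 1 by (rule measurable_sets[OF borel_measurable_boundary_line chart_preimage_borel(1)])
  show "{t \<in> boundary_line E. Y (vector [t, 0]) \<in> S} \<in> sets borel"
    unfolding 2 by (rule measurable_sets[OF borel_measurable_boundary_line chart_preimage_borel(2)])
qed

text \<open>By invariance of the boundary the transition map sends boundary line to boundary line,
  so it restricts to a one-variable map \<open>?s\<close>. The claim is then a substitution on the
  real line with the speed as density.\<close>

lemma length_measure_overlap: "emeasure (length_measure (D, X)) S = emeasure (length_measure (E, Y)) S"
proof -
  let ?A = "{t \<in> boundary_line D. X (vector [t, 0]) \<in> S}" and ?B = "{t \<in> boundary_line E. Y (vector [t, 0]) \<in> S}"
  let ?O = "{p \<in> D. X p \<in> Y ` E}" and ?p = "\<lambda>t. vector [t, 0] :: real^2"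
  let ?\<tau> = "inv_into E Y \<circ> X"
  let ?s = "\<lambda>t. ?\<tau> (?p t) $ 1"
  let ?d = "\<lambda>t. partial_deriv ?O ?\<tau> 1 (?p t)"
  have O: "rel_open ?O" by (rule overlap_open[OF c d])
  have p2: "?p t $ 2 = 0" for t by (simp add: vector_2)
  have AO: "?p t \<in> ?O" if "t \<in> ?A" for t
  proof -
    have "?p t \<in> D" "X (?p t) \<in> S" using that by (simp_all add: boundary_line_def)
    then show ?thesis using S(2) by blast
  qed
  have \<tau>0: "?\<tau> (?p t) $ 2 = 0" if "?p t \<in> ?O" for t
  proof -
    have "?p t \<in> D" "X (?p t) \<in> Y ` E" using that by simp_all
    from boundary_invariant[OF c d this p2] show ?thesis unfolding o_apply .
  qed
  have \<tau>2: "?\<tau> (?p t) = ?p (?s t)" if "?p t \<in> ?O" for t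
    using \<tau>0[OF that] by (simp add: vec_eq_iff forall_2 vector_2)
  have B: "?s ` ?A = ?B"
  proof (intro equalityI subsetI)
    fix r assume r: "r \<in> ?B"
    have rE: "?p r \<in> E" using r by (auto simp: boundary_line_def)
    have XD: "Y (?p r) \<in> X ` D" using r S(2) by auto
    then obtain p where p: "p \<in> D" "X p = Y (?p r)" by (elim imageE) simp
    have pe: "inv_into D X (Y (?p r)) = p" unfolding p(2)[symmetric] by (rule inv_into_f_f[OF chart_inj[OF c] p(1)])
    \<comment> \<open>Invariance of the boundary in the opposite direction, from \<open>Y\<close> to
      \<open>X\<close>; it makes \<open>?s\<close> onto.\<close>
    have p0: "p $ 2 = 0" using boundary_invariant[OF d c rE XD p2] unfolding pe .
    define t where "t = p $ 1"
    have t: "p = ?p t" using p0 by (simp add: t_def vec_eq_iff forall_2 vector_2)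
    have "t \<in> ?A" using p r unfolding t by (simp add: boundary_line_def)
    moreover have "?\<tau> (?p t) = ?p r" using p(2) inv_into_f_f[OF chart_inj[OF d] rE] unfolding t by simp
    then have "?s t = r" by (simp add: vector_2)
    ultimately show "r \<in> ?s ` ?A" by (intro image_eqI[of _ _ t]) auto
  next
    fix r assume "r \<in> ?s ` ?A"
    then obtain t where t: "t \<in> ?A" "r = ?s t" by blast
    have tO: "?p t \<in> D" "X (?p t) \<in> Y ` E" using AO[OF t(1)] by auto
    have "?p r = ?\<tau> (?p t)" unfolding t(2) by (rule \<tau>2[OF AO[OF t(1)], symmetric])
    then show "r \<in> ?B"
      using t(1) transition_apply[OF c d tO] transition_in[OF c d tO] by (simp add: boundary_line_def)
  qed
  have inj: "inj_on ?s ?A"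
  proof (rule inj_onI)
    fix t t' assume t: "t \<in> ?A" "t' \<in> ?A" "?s t = ?s t'"
    from arg_cong[OF t(3), of ?p] have "?\<tau> (?p t) = ?\<tau> (?p t')"
      by (rule trans[OF \<tau>2[OF AO[OF t(1)]] trans[OF _ \<tau>2[OF AO[OF t(2)], symmetric]]])
    then have "Y (inv_into E Y (X (?p t))) = Y (inv_into E Y (X (?p t')))" by simp
    then have "X (?p t) = X (?p t')" using transition_apply[OF c d] AO[OF t(1)] AO[OF t(2)] by simp
    then have "?p t = ?p t'" using chart_inj[OF c] AO[OF t(1)] AO[OF t(2)] by (simp add: inj_on_def)
    from arg_cong[OF this, of "\<lambda>p. p $ 1"] show "t = t'" by (simp add: vector_2)
  qed
  have der: "((\<lambda>t. ?\<tau> (?p t)) has_derivative (\<lambda>h. h *\<^sub>R ?d t)) (at t)" if "?p t \<in> ?O" for t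
    using has_derivative_boundary_line[OF O that c1_on_differentiable[OF transition_c1[OF c d] that]] .
  have der_comp: "((\<lambda>t. ?\<tau> (?p t) $ i) has_real_derivative ?d t $ i) (at t)" if "?p t \<in> ?O" for t i
    using bounded_linear.has_derivative[OF bounded_linear_vec_nth der[OF that], of i]
    by (simp add: has_field_derivative_def mult_commute_abs)
  \<comment> \<open>The second coordinate of the transition map is constantly 0 along the boundary
    line. Without this, a transversal derivative of \<open>F\<close> would enter the speed in
    \<open>dens\<close>.\<close>
  have d2: "?d t $ 2 = 0" if "?p t \<in> ?O" for t
  proof -
    have "((\<lambda>t. 0) has_real_derivative ?d t $ 2) (at t)"
      by (rule has_field_derivative_transform_within_open[OF der_comp[OF that] open_boundary_line[OF O]])
         (use that \<tau>0 in auto)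
    then show ?thesis using DERIV_const DERIV_unique by blast
  qed
  have dens: "length_density D X t = \<bar>?d t $ 1\<bar> * length_density E Y (?s t)" if "t \<in> ?A" for t
  proof -
    have tO: "?p t \<in> D" "X (?p t) \<in> Y ` E" using AO[OF that] by auto
    have eq: "inv_into E Y (X (?p t)) = ?p (?s t)" using \<tau>2[OF AO[OF that]] unfolding o_apply .
    have "partial_deriv D (F \<circ> X) 1 (?p t) = (?d t $ 1) *\<^sub>R partial_deriv E (F \<circ> Y) 1 (?p (?s t)) + (?d t $ 2) *\<^sub>R partial_deriv E (F \<circ> Y) 2 (?p (?s t))"
      using chain_rule_transition(2)[OF c d tO c1_on_differentiable[OF chart_c1[OF d] transition_in[OF c d tO]], of 1] unfolding eq .
    then show ?thesis using d2[OF AO[OF that]] by (simp add: length_density_def)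
  qed
  have meas: "(\<lambda>t. indicator {t \<in> boundary_line D. X (vector [t, 0]) \<in> S} t * length_density D X t) \<in> borel_measurable borel"
    if "(D, X) \<in> P" "{t \<in> boundary_line D. X (vector [t, 0]) \<in> S} \<in> sets borel" for D X
    using borel_measurable_continuous_on_indicator[OF that(2) continuous_on_subset[OF length_density_continuous[OF that(1)]]] by auto
  have "(\<integral>\<^sup>+t. ennreal (length_density D X t) * indicator ?A t \<partial>lborel) = (\<integral>\<^sup>+t. ennreal (length_density E Y t) * indicator ?B t \<partial>lborel)"
  proof (rule nn_integral_eq_if_absolutely_integrable_iff)
    fix b
    have "length_density D X absolutely_integrable_on ?A \<longleftrightarrow> (\<lambda>t. \<bar>?d t $ 1\<bar> * length_density E Y (?s t)) absolutely_integrable_on ?A"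
      using dens by (intro set_integrable_cong) auto
    moreover have "integral ?A (length_density D X) = integral ?A (\<lambda>t. \<bar>?d t $ 1\<bar> * length_density E Y (?s t))"
      using dens by (intro Henstock_Kurzweil_Integration.integral_cong) auto
    moreover have "(?s has_field_derivative ?d t $ 1) (at t within ?A)" if "t \<in> ?A" for t
      using der_comp[OF AO[OF that], of 1] has_field_derivative_at_within by blast
    ultimately show "length_density D X absolutely_integrable_on ?A \<and> integral ?A (length_density D X) = b
      \<longleftrightarrow> length_density E Y absolutely_integrable_on ?B \<and> integral ?B (length_density E Y) = b"
      using has_absolute_integral_change_of_variables_1'[of ?A ?s "\<lambda>t. ?d t $ 1" "length_density E Y" b] boundary_preimage_borel inj
      unfolding B by auto
  qed (use meas[OF c] meas[OF d] boundary_preimage_borel in \<open>auto simp: length_density_def\<close>)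
  then show ?thesis
    unfolding length_measure_def split
    by (simp add: emeasure_weighted_image_measure[OF length_measure_facts[OF c]] emeasure_weighted_image_measure[OF length_measure_facts[OF d]] S(1))
qed

end

end

section \<open>Gluing measures that agree on overlaps\<close>

context
  fixes I :: "'i set" and S :: "'i \<Rightarrow> 'b::topological_space set" and A :: "'b set"
    and m :: "'i \<Rightarrow> 'b measure" and m0 :: "'b measure"
  assumes I: "finite I" and S: "\<And>i. i \<in> I \<Longrightarrow> S i \<in> sets borel" "disjoint_family_on S I" and A: "A \<in> sets borel"
    and m: "\<And>i. i \<in> I \<Longrightarrow> sets (m i) = sets borel" "sets m0 = sets borel"
    and compat: "\<And>i B. i \<in> I \<Longrightarrow> B \<in> sets borel \<Longrightarrow> B \<subseteq> S i \<inter> A \<Longrightarrow> emeasure (m i) B = emeasure m0 B"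
begin

text \<open>The restrictions to a patch are equal as measures, so the same fact serves nonnegative
  and Bochner integrals.\<close>

lemma density_patch_eq:
  assumes i: "i \<in> I"
  shows "density (m i) (indicator (S i \<inter> A)) = density m0 (indicator (S i \<inter> A))"
proof (rule measure_eqI)
  fix B assume "B \<in> sets (density (m i) (indicator (S i \<inter> A)))"
  then have B: "B \<in> sets borel" using m(1)[OF i] by simp
  have *: "emeasure (density \<mu> (indicator (S i \<inter> A))) B = emeasure \<mu> (S i \<inter> A \<inter> B)" if "sets \<mu> = sets borel" for \<mu> :: "'b measure"
  proof -
    have [measurable]: "S i \<inter> A \<in> sets \<mu>" "B \<in> sets \<mu>" using B A S(1)[OF i] that by auto
    have "emeasure (density \<mu> (indicator (S i \<inter> A))) B = (\<integral>\<^sup>+x. indicator (S i \<inter> A) x * indicator B x \<partial>\<mu>)"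
      by (rule emeasure_density) measurable
    also have "\<dots> = (\<integral>\<^sup>+x. indicator (S i \<inter> A \<inter> B) x \<partial>\<mu>)"
      by (intro nn_integral_cong) (auto simp: indicator_def)
    also have "\<dots> = emeasure \<mu> (S i \<inter> A \<inter> B)" by (rule nn_integral_indicator) measurable
    finally show ?thesis .
  qed
  show "emeasure (density (m i) (indicator (S i \<inter> A))) B = emeasure (density m0 (indicator (S i \<inter> A))) B"
    unfolding *[OF m(1)[OF i]] *[OF m(2)] by (rule compat[OF i]) (use S(1)[OF i] A B in auto)
qed (use m(1)[OF i] m(2) in simp)

lemma sum_indicator_patch:
  assumes "x \<in> (\<Union>i\<in>I. S i)"
  shows "(\<Sum>i\<in>I. indicator (S i) x) = (1 :: 'c::semiring_1)"
proof -
  obtain i where i: "i \<in> I" "x \<in> S i" using assms by blast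
  have "(\<Sum>j\<in>I. indicator (S j) x) = (\<Sum>j\<in>I. if j = i then 1 else 0 :: 'c)"
    using S(2) i by (intro sum.cong) (auto simp: indicator_def disjoint_family_on_def)
  then show ?thesis using I i(1) by simp
qed

text \<open>On each patch \<open>m i\<close> may be exchanged for \<open>m0\<close>. The patches are
  disjoint and cover the support of \<open>h\<close>, so their indicators sum to 1 there.\<close>

lemma nn_integral_patch:
  assumes h: "h \<in> borel_measurable borel" and 0: "\<And>x. x \<notin> (\<Union>i\<in>I. S i) \<inter> A \<Longrightarrow> h x = 0"
  shows "(\<Sum>i\<in>I. \<integral>\<^sup>+x. indicator (S i) x * h x \<partial>m i) = (\<integral>\<^sup>+x. h x \<partial>m0)"
proof -
  have meas: "indicator (S i \<inter> A) \<in> borel_measurable \<mu>" "h \<in> borel_measurable \<mu>"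
    if "sets \<mu> = sets borel" "i \<in> I" for \<mu> i
    using S(1)[OF that(2)] A h by (simp_all add: measurable_cong_sets[OF that(1) refl])
  have "(\<Sum>i\<in>I. \<integral>\<^sup>+x. indicator (S i) x * h x \<partial>m i) = (\<Sum>i\<in>I. \<integral>\<^sup>+x. indicator (S i \<inter> A) x * h x \<partial>m i)"
    using 0 by (intro sum.cong refl nn_integral_cong) (auto simp: indicator_def)
  also have "\<dots> = (\<Sum>i\<in>I. \<integral>\<^sup>+x. h x \<partial>density (m i) (indicator (S i \<inter> A)))"
    by (intro sum.cong refl nn_integral_density[symmetric] meas m)
  also have "\<dots> = (\<Sum>i\<in>I. \<integral>\<^sup>+x. h x \<partial>density m0 (indicator (S i \<inter> A)))"
    by (intro sum.cong refl) (simp add: density_patch_eq)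
  also have "\<dots> = (\<Sum>i\<in>I. \<integral>\<^sup>+x. indicator (S i \<inter> A) x * h x \<partial>m0)"
    by (intro sum.cong refl nn_integral_density meas m)
  also have "\<dots> = (\<integral>\<^sup>+x. (\<Sum>i\<in>I. indicator (S i \<inter> A) x * h x) \<partial>m0)"
    proof (rule nn_integral_sum[symmetric])
    fix i assume i: "i \<in> I"
    have [measurable]: "S i \<inter> A \<in> sets m0" "h \<in> borel_measurable m0"
      using S(1)[OF i] A m(2) meas(2)[OF m(2) i] by simp_all
    show "(\<lambda>x. indicator (S i \<inter> A) x * h x) \<in> borel_measurable m0" by measurable
  qed
  finally have 1: "(\<Sum>i\<in>I. \<integral>\<^sup>+x. indicator (S i) x * h x \<partial>m i) = (\<integral>\<^sup>+x. (\<Sum>i\<in>I. indicator (S i \<inter> A) x * h x) \<partial>m0)" .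
  have "(\<integral>\<^sup>+x. (\<Sum>i\<in>I. indicator (S i \<inter> A) x * h x) \<partial>m0) = (\<integral>\<^sup>+x. h x \<partial>m0)"
  proof (rule nn_integral_cong)
    fix x
    show "(\<Sum>i\<in>I. indicator (S i \<inter> A) x * h x) = h x"
    proof (cases "x \<in> (\<Union>i\<in>I. S i) \<inter> A")
      case True
      then have "(\<Sum>i\<in>I. indicator (S i \<inter> A) x) = (1::ennreal)"
        using sum_indicator_patch[of x, where 'c = ennreal] unfolding indicator_inter_arith using True by simp
      then show ?thesis unfolding sum_distrib_right[symmetric] by simp
    qed (use 0 in auto)
  qed
  with 1 show ?thesis by (rule trans)
qed

lemma integral_patch:
  fixes h :: "'b \<Rightarrow> real"
  assumes h: "h \<in> borel_measurable borel" and 0: "\<And>x. x \<notin> (\<Union>i\<in>I. S i) \<inter> A \<Longrightarrow> h x = 0"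
    and int: "\<And>i. i \<in> I \<Longrightarrow> integrable (m i) (\<lambda>x. indicator (S i) x * h x)"
  shows "(\<Sum>i\<in>I. \<integral>x. indicator (S i) x * h x \<partial>m i) = (\<integral>x. h x \<partial>m0)"
proof -
  have ind: "(\<lambda>x. indicator B x :: ennreal) = (\<lambda>x. ennreal (indicator B x))" for B :: "'b set"
    by (auto simp: indicator_def)
  have meas: "(indicator (S i \<inter> A) :: 'b \<Rightarrow> real) \<in> borel_measurable \<mu>" "h \<in> borel_measurable \<mu>"
    if "sets \<mu> = sets borel" "i \<in> I" for \<mu> i
    using S(1)[OF that(2)] A h by (simp_all add: measurable_cong_sets[OF that(1) refl])
  have eq: "indicator (S i) x * h x = indicator (S i \<inter> A) x * h x" if "i \<in> I" for i x
    using 0 that by (auto simp: indicator_def)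
  have dens: "(\<integral>x. h x \<partial>density \<mu> (indicator (S i \<inter> A))) = (\<integral>x. indicator (S i \<inter> A) x * h x \<partial>\<mu>)"
    "integrable (density \<mu> (indicator (S i \<inter> A))) h \<longleftrightarrow> integrable \<mu> (\<lambda>x. indicator (S i \<inter> A) x * h x)"
    if "sets \<mu> = sets borel" "i \<in> I" for \<mu> i
    unfolding ind using meas[OF that] by (simp_all add: integral_density integrable_density)
  have int0: "integrable m0 (\<lambda>x. indicator (S i \<inter> A) x * h x)" if "i \<in> I" for i
    using int[OF that] unfolding eq[OF that] dens(2)[OF m(1)[OF that] that, symmetric] density_patch_eq[OF that] dens(2)[OF m(2) that] .
  have "(\<Sum>i\<in>I. \<integral>x. indicator (S i) x * h x \<partial>m i) = (\<Sum>i\<in>I. \<integral>x. indicator (S i \<inter> A) x * h x \<partial>m0)"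
  proof (intro sum.cong refl)
    fix i assume i: "i \<in> I"
    have "(\<integral>x. indicator (S i) x * h x \<partial>m i) = (\<integral>x. indicator (S i \<inter> A) x * h x \<partial>m i)"
      by (rule Bochner_Integration.integral_cong[OF refl eq[OF i]])
    also have "\<dots> = (\<integral>x. indicator (S i \<inter> A) x * h x \<partial>m0)"
      unfolding dens(1)[OF m(1)[OF i] i, symmetric] dens(1)[OF m(2) i, symmetric] density_patch_eq[OF i] ..
    finally show "(\<integral>x. indicator (S i) x * h x \<partial>m i) = (\<integral>x. indicator (S i \<inter> A) x * h x \<partial>m0)" .
  qed
  also have "\<dots> = (\<integral>x. (\<Sum>i\<in>I. indicator (S i \<inter> A) x * h x) \<partial>m0)"
    using int0 by (simp add: Bochner_Integration.integral_sum)
  finally have 1: "(\<Sum>i\<in>I. \<integral>x. indicator (S i) x * h x \<partial>m i) = (\<integral>x. (\<Sum>i\<in>I. indicator (S i \<inter> A) x * h x) \<partial>m0)" .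
  have "(\<integral>x. (\<Sum>i\<in>I. indicator (S i \<inter> A) x * h x) \<partial>m0) = (\<integral>x. h x \<partial>m0)"
  proof (rule Bochner_Integration.integral_cong[OF refl])
    fix x
    show "(\<Sum>i\<in>I. indicator (S i \<inter> A) x * h x) = h x"
    proof (cases "x \<in> (\<Union>i\<in>I. S i) \<inter> A")
      case True
      then have "(\<Sum>i\<in>I. indicator (S i \<inter> A) x) = (1::real)"
        using sum_indicator_patch[of x, where 'c = real] unfolding indicator_inter_arith using True by simp
      then show ?thesis unfolding sum_distrib_right[symmetric] by simp
    qed (use 0 in auto)
  qed
  with 1 show ?thesis by (rule trans)
qed

end

text \<open>The preimage of \<open>S\<close> lies in a compact subset of the domain, where the
  continuous weight is bounded.\<close>

lemma emeasure_weighted_image_finite: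
  fixes A K :: "'a::euclidean_space set" and T :: "'a \<Rightarrow> 'b::topological_space"
  assumes "A \<in> sets borel" "continuous_on A w" "\<And>p. p \<in> A \<Longrightarrow> 0 \<le> w p" "continuous_on A T"
    and K: "compact K" "K \<subseteq> A" and S: "S \<in> sets borel" "\<And>p. p \<in> A \<Longrightarrow> T p \<in> S \<Longrightarrow> p \<in> K"
  shows "emeasure (weighted_image_measure A w T) S < \<infinity>"
proof -
  obtain C where C: "\<And>p. p \<in> K \<Longrightarrow> w p \<le> C"
    using compact_imp_bounded[OF compact_continuous_image[OF continuous_on_subset[OF assms(2) K(2)] K(1)]]
    unfolding bounded_iff by (metis abs_le_D1 imageI real_norm_def)
  have "emeasure (weighted_image_measure A w T) S = (\<integral>\<^sup>+p\<in>{p \<in> A. T p \<in> S}. ennreal (w p) \<partial>lborel)"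
    by (rule emeasure_weighted_image_measure[OF assms(1-4) S(1)])
  also have "\<dots> \<le> (\<integral>\<^sup>+p. ennreal C * indicator K p \<partial>lborel)"
    using S(2) C by (intro nn_integral_mono) (auto simp: indicator_def intro: ennreal_leI)
  also have "\<dots> = ennreal C * emeasure lborel K"
    by (rule nn_integral_cmult_indicator) (simp add: borel_compact[OF K(1)])
  also have "\<dots> < \<infinity>"
    using emeasure_compact_finite[OF K(1)] by (simp add: ennreal_mult_less_top)
  finally show ?thesis .
qed

section \<open>C^1 fields on the surface and their divergence\<close>

context free_boundary_surface
begin

lemma borel_measurable_on_surface:
  fixes h :: "'m \<Rightarrow> real"
  assumes "continuous_on M h"
  shows "(\<lambda>x. indicator M x * h x) \<in> borel_measurable borel"
  using borel_measurable_continuous_on_indicator[OF M_borel assms] by simp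

definition c1_field :: "('m \<Rightarrow> 'c::real_normed_vector) \<Rightarrow> bool" where
  "c1_field u \<longleftrightarrow> (\<forall>(D, X) \<in> P. c1_on D (u \<circ> X))"

lemma c1_fieldD: "c1_field u \<Longrightarrow> (D, X) \<in> P \<Longrightarrow> c1_on D (u \<circ> X)"
  by (auto simp: c1_field_def)

lemma c1_fieldD': "c1_field u \<Longrightarrow> (D, X) \<in> P \<Longrightarrow> c1_on D (\<lambda>p. u (X p))"
  using c1_fieldD unfolding o_def .

lemma c1_fieldI: "(\<And>D X. (D, X) \<in> P \<Longrightarrow> c1_on D (\<lambda>p. u (X p))) \<Longrightarrow> c1_field u"
  by (auto simp: c1_field_def o_def)

lemma c1_field_F: "c1_field F"
  using chart_c1 by (auto simp: c1_field_def)

lemma c1_field_const: "c1_field (\<lambda>_. c)"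
  by (rule c1_fieldI) (rule c1_on_const[OF chart_open])

lemma c1_field_add: "c1_field u \<Longrightarrow> c1_field v \<Longrightarrow> c1_field (\<lambda>x. u x + v x)"
  by (rule c1_fieldI) (rule c1_on_add[OF chart_open c1_fieldD'[of u] c1_fieldD'[of v]])

lemma c1_field_diff: "c1_field u \<Longrightarrow> c1_field v \<Longrightarrow> c1_field (\<lambda>x. u x - v x)"
  by (rule c1_fieldI) (rule c1_on_diff[OF chart_open c1_fieldD'[of u] c1_fieldD'[of v]])

lemma c1_field_scaleR: "c1_field u \<Longrightarrow> c1_field v \<Longrightarrow> c1_field (\<lambda>x. u x *\<^sub>R v x)"
  by (rule c1_fieldI) (rule c1_on_scaleR[OF chart_open c1_fieldD'[of u] c1_fieldD'[of v]])

lemma c1_field_inner: "c1_field u \<Longrightarrow> c1_field v \<Longrightarrow> c1_field (\<lambda>x. u x \<bullet> v x)"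
  by (rule c1_fieldI) (rule c1_on_inner[OF chart_open c1_fieldD'[of u] c1_fieldD'[of v]])

lemma c1_field_sum: "(\<And>j. j \<in> J \<Longrightarrow> c1_field (u j)) \<Longrightarrow> c1_field (\<lambda>x. \<Sum>j\<in>J. u j x)"
  by (rule c1_fieldI) (rule c1_on_sum[OF chart_open c1_fieldD'])

lemma c1_field_inverse:
  fixes u :: "'m \<Rightarrow> real"
  assumes "c1_field u" "\<And>x. x \<in> M \<Longrightarrow> u x \<noteq> 0"
  shows "c1_field (\<lambda>x. inverse (u x))"
  by (rule c1_fieldI) (rule c1_on_inverse[OF chart_open c1_fieldD'[OF assms(1)] assms(2)[OF chart_in_M]])

text \<open>The chart is picked arbitrarily; \<open>surface_div_chart\<close> shows that for C^1
  fields the choice is immaterial.\<close>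

definition surface_div :: "('m \<Rightarrow> real^'n) \<Rightarrow> 'm \<Rightarrow> real" where
  "surface_div u x = (case SOME (D, X, p). (D, X) \<in> P \<and> p \<in> D \<and> X p = x of (D, X, p) \<Rightarrow>
     chart_div D X u p)"

lemma surface_div_chart:
  assumes u: "c1_field u" and c: "(D, X) \<in> P" and p: "p \<in> D"
  shows "surface_div u (X p) = chart_div D X u p"
proof -
  define z where "z = (SOME (E, Y, q). (E, Y) \<in> P \<and> q \<in> E \<and> Y q = X p)"
  obtain E Y q where z: "z = (E, Y, q)" by (cases z) auto
  have "case z of (E, Y, q) \<Rightarrow> (E, Y) \<in> P \<and> q \<in> E \<and> Y q = X p"
    unfolding z_def by (rule someI[of _ "(D, X, p)"]) (use c p in auto)
  then have d: "(E, Y) \<in> P" and q: "q \<in> E" "Y q = X p" using z by auto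
  have "X p \<in> Y ` E" using q by (metis imageI)
  moreover have "inv_into E Y (X p) = q" using q chart_inj[OF d] by (metis inv_into_f_f)
  ultimately show ?thesis
    using transition_chart_div[OF c d p, of u] c1_on_differentiable[OF c1_fieldD[OF u d] q(1)]
    by (simp add: surface_div_def z_def[symmetric] z)
qed

text \<open>Continuity is tested in charts because each one is a homeomorphism onto a relatively
  open part of \<open>M\<close>.\<close>

lemma continuous_on_surface:
  fixes f :: "'m \<Rightarrow> 'c::topological_space"
  assumes "\<And>D X. (D, X) \<in> P \<Longrightarrow> continuous_on D (\<lambda>p. f (X p))"
  shows "continuous_on M f"
  unfolding continuous_on_eq_continuous_within
proof
  fix x assume x: "x \<in> M"
  then obtain D X p where c: "(D, X) \<in> P" and p: "p \<in> D" "X p = x" using M_covered by blast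
  have "continuous_on (X ` D) (\<lambda>y. f (X (inv_into D X y)))"
    by (rule continuous_on_compose2[OF assms[OF c] homeomorphism_cont2[OF chart_homeo[OF c]]])
       (auto intro: inv_into_into)
  then have "continuous_on (X ` D) f"
    by (rule continuous_on_eq) (simp add: f_inv_into_f)
  then have 1: "continuous (at x within X ` D) f" unfolding continuous_on_eq_continuous_within using p by blast
  obtain T where T: "open T" "X ` D = M \<inter> T" using chart_image_open[OF c] by (auto simp: openin_open)
  have "at x within M = at x within X ` D"
    by (rule at_within_nhd[OF _ T(1)]) (use p T in auto)
  with 1 show "continuous (at x within M) f" by simp
qed

lemma c1_field_continuous: "c1_field u \<Longrightarrow> continuous_on M u"
  by (rule continuous_on_surface, rule c1_on_continuous[OF c1_fieldD'])

lemma surface_div_continuous: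
  assumes u: "c1_field u"
  shows "continuous_on M (surface_div u)"
proof (rule continuous_on_surface)
  fix D X assume c: "(D, X) \<in> P"
  note cont = c1_on_continuous_partial[OF chart_c1[OF c]] c1_on_continuous_partial[OF c1_fieldD[OF u c]]
  have "continuous_on D (\<lambda>p. chart_div D X u p)"
    unfolding chart_div_def frame_trace_def
  proof (rule continuous_on_divide)
    show "continuous_on D (\<lambda>p. gram (partial_deriv D (F \<circ> X) 1 p) (partial_deriv D (F \<circ> X) 2 p))"
      unfolding gram_def by (intro continuous_intros cont)
    show "\<forall>p\<in>D. gram (partial_deriv D (F \<circ> X) 1 p) (partial_deriv D (F \<circ> X) 2 p) \<noteq> 0"
      using chart_gram_pos[OF c] by (metis less_irrefl)
  qed (intro continuous_intros cont)
  then show "continuous_on D (\<lambda>p. surface_div u (X p))"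
    by (rule continuous_on_eq) (simp add: surface_div_chart[OF u c])
qed

lemma surface_div_sum:
  assumes x: "x \<in> M" and u: "\<And>j. j \<in> J \<Longrightarrow> c1_field (u j)"
  shows "surface_div (\<lambda>x. \<Sum>j\<in>J. u j x) x = (\<Sum>j\<in>J. surface_div (u j) x)"
proof -
  obtain D X p where c: "(D, X) \<in> P" and p: "p \<in> D" "X p = x" using x M_covered by blast
  have "partial_deriv D (\<lambda>q. \<Sum>j\<in>K. (u j \<circ> X) q) i p = (\<Sum>j\<in>K. partial_deriv D (u j \<circ> X) i p)"
    if "K \<subseteq> J" for K i
    using that
  proof (induction K rule: infinite_finite_induct)
    case (insert j K)
    have "c1_on D (\<lambda>q. \<Sum>j\<in>K. (u j \<circ> X) q)"
      by (intro c1_on_sum chart_open[OF c] c1_fieldD[OF u c]) (use insert in auto)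
    with insert show ?case
      using partial_deriv_add[OF chart_open[OF c] p(1) c1_on_differentiable[OF c1_fieldD[OF u c] p(1)]
          c1_on_differentiable[OF _ p(1)], of j "\<lambda>q. \<Sum>j\<in>K. (u j \<circ> X) q" i]
      by (simp del: o_apply)
  qed (simp_all add: partial_deriv_const[OF chart_open[OF c] p(1)])
  note pd = this[OF order_refl]
  have "(\<lambda>x. \<Sum>j\<in>J. u j x) \<circ> X = (\<lambda>q. \<Sum>j\<in>J. (u j \<circ> X) q)" by (simp add: o_def)
  then have "surface_div (\<lambda>x. \<Sum>j\<in>J. u j x) (X p) = (\<Sum>j\<in>J. chart_div D X (u j) p)"
    using surface_div_chart[OF c1_field_sum[OF u, of J "\<lambda>j. j"] c p(1)] by (simp only: chart_div_def pd frame_trace_sum)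
  also have "\<dots> = (\<Sum>j\<in>J. surface_div (u j) (X p))"
    by (intro sum.cong refl surface_div_chart[OF u c p(1), symmetric])
  finally show ?thesis unfolding p(2) .
qed

end

section \<open>The first variation formula\<close>

text \<open>The open half-balls cover the surface and are cut into disjoint pieces; the closed ones
  remain inside the chart domains and provide the compact sets that support the cutoffs and bound
  the densities.\<close>

locale covered_surface = free_boundary_surface M P F
  for M :: "'m::t2_space set" and P :: "'m patch set" and F :: "'m \<Rightarrow> real^'n" +
  fixes n :: nat and D :: "nat \<Rightarrow> (real^2) set" and X :: "nat \<Rightarrow> real^2 \<Rightarrow> 'm"
    and c :: "nat \<Rightarrow> real^2" and r :: "nat \<Rightarrow> real"
  assumes charts: "\<And>k. k < n \<Longrightarrow> (D k, X k) \<in> P" "\<And>k. k < n \<Longrightarrow> 0 < r k"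
      "\<And>k. k < n \<Longrightarrow> cball (c k) (r k) \<inter> half_plane \<subseteq> D k"
    and cover: "M \<subseteq> (\<Union>k<n. X k ` (ball (c k) (r k) \<inter> half_plane))"

lemma (in free_boundary_surface) exists_cover:
  "\<exists>n D X c r. covered_surface M P F n D X c r"
proof -
  define Q where "Q = {(D, X, c, r). (D, X) \<in> P \<and> 0 < r \<and> cball c r \<inter> half_plane \<subseteq> D}"
  define U where "U = (\<lambda>(D :: (real^2) set, X, c, r). X ` (ball c r \<inter> half_plane) :: 'm set)"
  have op: "openin (top_of_set M) (U q)" if "q \<in> Q" for q
  proof -
    obtain D X c r where q: "q = (D, X, c, r)" by (cases q) auto
    have "ball c r \<inter> half_plane \<subseteq> D" "(D, X) \<in> P" using that q by (auto simp: Q_def)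
    moreover have "rel_open (ball c r \<inter> half_plane)" by (simp add: openin_open_Int inf_commute)
    ultimately show ?thesis using openin_chart_image by (simp add: U_def q)
  qed
  have "M \<subseteq> \<Union>(U ` Q)"
  proof
    fix x assume "x \<in> M"
    then obtain D X p where d: "(D, X) \<in> P" "p \<in> D" "X p = x" using M_covered by blast
    obtain e where e: "e > 0" "cball p e \<inter> half_plane \<subseteq> D"
      using chart_open[OF d(1)] d(2) unfolding openin_contains_cball by blast
    then have "(D, X, p, e) \<in> Q" using d by (auto simp: Q_def)
    moreover have "x \<in> U (D, X, p, e)"
      using d e openin_imp_subset[OF chart_open[OF d(1)]] by (auto simp: U_def)
    ultimately show "x \<in> \<Union>(U ` Q)" by blast
  qed
  moreover have "\<forall>V\<in>U ` Q. openin (top_of_set M) V" using op by blast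
  ultimately obtain \<U> where "\<U> \<subseteq> U ` Q" "finite \<U>" "M \<subseteq> \<Union>\<U>"
    using compact_M unfolding compact_eq_openin_cover by metis
  then obtain Q' where Q': "Q' \<subseteq> Q" "finite Q'" "M \<subseteq> \<Union>(U ` Q')"
    by (metis finite_subset_image)
  \<comment> \<open>Enumerating the finite cover by natural numbers gives sense to the first set of
    the cover that contains a point.\<close>
  obtain h where h: "bij_betw h {0..<card Q'} Q'" using ex_bij_betw_nat_finite[OF Q'(2)] by blast
  have hQ: "h k \<in> Q" if "k < card Q'" for k
    using h Q'(1) that by (auto simp: bij_betw_def)
  have hU: "M \<subseteq> (\<Union>k<card Q'. U (h k))"
  proof
    fix x assume "x \<in> M"
    then obtain q where q: "q \<in> Q'" "x \<in> U q" using Q'(3) by blast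
    then have "q \<in> h ` {0..<card Q'}" using bij_betw_imp_surj_on[OF h] by simp
    then obtain k where "k \<in> {0..<card Q'}" "q = h k" by (rule imageE)
    then have "k < card Q'" "x \<in> U (h k)" using q(2) by simp_all
    then show "x \<in> (\<Union>k<card Q'. U (h k))" by blast
  qed
  have "covered_surface M P F (card Q') (\<lambda>k. fst (h k)) (\<lambda>k. fst (snd (h k))) (\<lambda>k. fst (snd (snd (h k)))) (\<lambda>k. snd (snd (snd (h k))))"
  proof
    fix k assume "k < card Q'"
    from hQ[OF this] show "(fst (h k), fst (snd (h k))) \<in> P" "0 < snd (snd (snd (h k)))"
      "cball (fst (snd (snd (h k)))) (snd (snd (snd (h k)))) \<inter> half_plane \<subseteq> fst (h k)"
      by (auto simp: Q_def)
  next
    show "M \<subseteq> (\<Union>k<card Q'. fst (snd (h k)) ` (ball (fst (snd (snd (h k)))) (snd (snd (snd (h k)))) \<inter> half_plane))"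
      using hU by (simp add: U_def case_prod_beta)
  qed
  then show ?thesis by blast
qed

section \<open>A dissection adapted to the finite cover\<close>

context covered_surface
begin

definition K :: "nat \<Rightarrow> (real^2) set" where
  "K k = cball (c k) (r k) \<inter> half_plane"

definition U :: "nat \<Rightarrow> 'm set" where
  "U k = X k ` (ball (c k) (r k) \<inter> half_plane)"

text \<open>Each point goes to the first half-ball that contains it. This dissects the surface into
  Borel pieces, each inside the compact part of one chart.\<close>

definition S :: "nat \<Rightarrow> 'm set" where
  "S k = U k - (\<Union>j<k. U j)"

lemma K_compact: "compact (K k)"
proof -
  have "closed half_plane" unfolding half_plane_def by (intro closed_Collect_le continuous_intros)
  then show ?thesis unfolding K_def by (intro compact_Int_closed compact_cball)
qed

lemma K_subset: "k < n \<Longrightarrow> K k \<subseteq> D k"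
  using charts(3) by (simp add: K_def)

lemma K_image_closed: "k < n \<Longrightarrow> closed (X k ` K k)"
  using compact_continuous_image[OF continuous_on_subset[OF chart_continuous[OF charts(1)] K_subset] K_compact]
    compact_imp_closed by blast

lemma U_openin: assumes "k < n" shows "openin (top_of_set M) (U k)"
  unfolding U_def
proof (rule openin_chart_image[OF charts(1)[OF assms]])
  show "rel_open (ball (c k) (r k) \<inter> half_plane)" by (simp add: openin_open_Int inf_commute)
  show "ball (c k) (r k) \<inter> half_plane \<subseteq> D k" using charts(3)[OF assms] by auto
qed

lemma U_borel: "k < n \<Longrightarrow> U k \<in> sets borel"
  using U_openin[of k] M_borel by (auto simp: openin_open)

lemma S_borel: "k < n \<Longrightarrow> S k \<in> sets borel"
  unfolding S_def using U_borel by (intro sets.Diff sets.finite_UN) auto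

lemma S_subset: "S k \<subseteq> U k" "U k \<subseteq> X k ` K k"
  by (auto simp: S_def U_def K_def)

lemma S_chart: "k < n \<Longrightarrow> S k \<subseteq> X k ` D k"
  using S_subset K_subset by blast

lemma S_disjoint: "disjoint_family_on S {..<n}"
proof -
  have "S j \<inter> S k = {}" if "j < k" for j k using that by (auto simp: S_def)
  then show ?thesis unfolding disjoint_family_on_def by (metis inf_commute linorder_neqE_nat)
qed

lemma S_union: "(\<Union>k<n. S k) = M"
proof
  show "(\<Union>k<n. S k) \<subseteq> M" using S_subset U_openin openin_imp_subset by fast
  show "M \<subseteq> (\<Union>k<n. S k)"
  proof
    fix x assume "x \<in> M"
    then have ex: "\<exists>k. k < n \<and> x \<in> U k" using cover unfolding U_def by blast
    define k where "k = (LEAST k. k < n \<and> x \<in> U k)"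
    have "k < n \<and> x \<in> U k" unfolding k_def by (rule LeastI_ex[OF ex])
    moreover have "x \<notin> U j" if "j < k" for j
      using not_less_Least[of j "\<lambda>k. k < n \<and> x \<in> U k"] that calculation unfolding k_def[symmetric] by auto
    ultimately show "x \<in> (\<Union>k<n. S k)" by (auto simp: S_def)
  qed
qed

lemma S_in_M: "k < n \<Longrightarrow> x \<in> S k \<Longrightarrow> x \<in> M"
  using S_union by blast

lemma chart_point_in_K:
  assumes "k < n" "p \<in> D k" "X k p \<in> X k ` K k"
  shows "p \<in> K k"
proof -
  obtain q where q: "q \<in> K k" "X k p = X k q" using assms(3) by (rule imageE)
  then have "p = q"
    using inj_onD[OF chart_inj[OF charts(1)[OF assms(1)]] q(2) assms(2)] K_subset[OF assms(1)] by blast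
  with q(1) show ?thesis by simp
qed

lemma area_measure_finite: assumes "k < n" shows "emeasure (area_measure (D k, X k)) (S k) < \<infinity>"
  unfolding area_measure_def split
proof (rule emeasure_weighted_image_finite[OF area_measure_facts[OF charts(1)[OF assms]] K_compact K_subset[OF assms] S_borel[OF assms]])
  show "p \<in> K k" if "p \<in> D k" "X k p \<in> S k" for p
    using chart_point_in_K[OF assms that(1)] that(2) S_subset by blast
qed

lemma length_measure_finite: assumes "k < n" shows "emeasure (length_measure (D k, X k)) (S k) < \<infinity>"
  unfolding length_measure_def split
proof (rule emeasure_weighted_image_finite[OF length_measure_facts[OF charts(1)[OF assms]] _ _ S_borel[OF assms]])
  \<comment> \<open>The flat side of the half-ball, seen as a subset of the real line.\<close>
  let ?K = "(\<lambda>p. p $ 1) ` (K k \<inter> {p. p $ 2 = 0})"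
  show "compact ?K"
    by (intro compact_continuous_image compact_Int_closed K_compact continuous_intros closed_Collect_eq)
  show "?K \<subseteq> boundary_line (D k)"
  proof clarify
    fix p assume p: "p \<in> K k" "p $ 2 = 0"
    then have "vector [p $ 1, 0] = p" by (simp add: vec_eq_iff forall_2 vector_2)
    then show "p $ 1 \<in> boundary_line (D k)" using p K_subset[OF assms] by (auto simp: boundary_line_def)
  qed
  show "t \<in> ?K" if "t \<in> boundary_line (D k)" "X k (vector [t, 0]) \<in> S k" for t
  proof
    show "t = (vector [t, 0] :: real^2) $ 1" by (simp add: vector_2)
    show "vector [t, 0] \<in> K k \<inter> {p. p $ 2 = 0}"
      using chart_point_in_K[OF assms, of "vector [t, 0]"] that S_subset[of k] by (auto simp: boundary_line_def vector_2)
  qed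
qed

text \<open>Integration against the global Riemannian measure without building that measure: each
  piece is measured in its own chart.\<close>

definition surface_integral :: "('m patch \<Rightarrow> 'm measure) \<Rightarrow> ('m \<Rightarrow> real) \<Rightarrow> real" where
  "surface_integral \<mu> h = (\<Sum>k<n. \<integral>x. indicator (S k) x * h x \<partial>\<mu> (D k, X k))"

abbreviation "area_integral \<equiv> surface_integral area_measure"
abbreviation "length_integral \<equiv> surface_integral length_measure"

text \<open>What area and boundary length share, so that integration on the surface is developed
  once for both: Borel sets, finite mass of the pieces, and agreement on chart overlaps.\<close>

definition admissible :: "('m patch \<Rightarrow> 'm measure) \<Rightarrow> bool" where
  "admissible \<mu> \<longleftrightarrow> (\<forall>a. sets (\<mu> a) = sets borel) \<and> (\<forall>k<n. emeasure (\<mu> (D k, X k)) (S k) < \<infinity>) \<and>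
     (\<forall>E Y E' Y' B. (E, Y) \<in> P \<longrightarrow> (E', Y') \<in> P \<longrightarrow> B \<in> sets borel \<longrightarrow> B \<subseteq> Y ` E \<inter> Y' ` E' \<longrightarrow>
        emeasure (\<mu> (E, Y)) B = emeasure (\<mu> (E', Y')) B)"

lemma admissible_area_measure: "admissible area_measure"
  unfolding admissible_def
proof (intro conjI allI impI sets_area_measure area_measure_finite)
  fix E Y E' Y' B
  assume "(E, Y) \<in> P" "(E', Y') \<in> P" "B \<in> sets borel" "B \<subseteq> Y ` E \<inter> Y' ` E'"
  then show "emeasure (area_measure (E, Y)) B = emeasure (area_measure (E', Y')) B" by (rule area_measure_overlap)
qed

lemma admissible_length_measure: "admissible length_measure"
  unfolding admissible_def
proof (intro conjI allI impI sets_length_measure length_measure_finite)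
  fix E Y E' Y' B
  assume "(E, Y) \<in> P" "(E', Y') \<in> P" "B \<in> sets borel" "B \<subseteq> Y ` E \<inter> Y' ` E'"
  then show "emeasure (length_measure (E, Y)) B = emeasure (length_measure (E', Y')) B" by (rule length_measure_overlap)
qed

section \<open>Integration over the surface against either measure\<close>

context
  fixes \<mu> assumes \<mu>: "admissible \<mu>"
begin

lemma admissible_sets [simp]: "sets (\<mu> a) = sets borel"
  using \<mu> unfolding admissible_def by blast

lemma surface_integrable:
  assumes h: "continuous_on M h" and k: "k < n"
  shows "integrable (\<mu> (D k, X k)) (\<lambda>x. indicator (S k) x * (h x :: real))"
proof -
  have "bounded (h ` M)" by (rule compact_imp_bounded[OF compact_continuous_image[OF h compact_M]])
  then obtain C where "\<forall>y\<in>h ` M. norm y \<le> C" unfolding bounded_iff by blast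
  then have C: "norm (h x) \<le> C" if "x \<in> M" for x using that by blast
  have SM: "S k \<subseteq> M" using S_union k by blast
  have fin: "emeasure (\<mu> (D k, X k)) (S k) < \<infinity>" using \<mu> k unfolding admissible_def by blast
  have meas: "(\<lambda>x. indicator M x *\<^sub>R h x) \<in> borel_measurable (\<mu> (D k, X k))"
    using borel_measurable_continuous_on_indicator[OF M_borel h] by (simp add: measurable_cong_sets[OF admissible_sets refl])
  have "integrable (\<mu> (D k, X k)) (\<lambda>x. indicator (S k) x *\<^sub>R (indicator M x *\<^sub>R h x))"
    by (rule integrableI_bounded_set_indicator[OF _ meas, where B = C])
       (use S_borel[OF k] fin C SM in \<open>auto simp: indicator_def\<close>)
  then show ?thesis
    by (rule Bochner_Integration.integrable_cong[THEN iffD1, rotated -1]) (use SM in \<open>auto simp: indicator_def\<close>)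
qed

lemma surface_integral_cong:
  assumes "\<And>x. x \<in> M \<Longrightarrow> h x = g x"
  shows "surface_integral \<mu> h = surface_integral \<mu> g"
  unfolding surface_integral_def
proof (intro sum.cong refl Bochner_Integration.integral_cong)
  fix k x assume "k \<in> {..<n}"
  then show "indicator (S k) x * h x = indicator (S k) x * g x"
    by (cases "x \<in> S k") (simp_all add: assms S_in_M)
qed

lemma surface_integral_sum:
  assumes "\<And>j. j \<in> J \<Longrightarrow> continuous_on M (h j)"
  shows "surface_integral \<mu> (\<lambda>x. \<Sum>j\<in>J. h j x) = (\<Sum>j\<in>J. surface_integral \<mu> (h j))"
proof -
  have "surface_integral \<mu> (\<lambda>x. \<Sum>j\<in>J. h j x) = (\<Sum>k<n. \<Sum>j\<in>J. \<integral>x. indicator (S k) x * h j x \<partial>\<mu> (D k, X k))"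
    unfolding surface_integral_def sum_distrib_left
    by (intro sum.cong refl Bochner_Integration.integral_sum surface_integrable assms) auto
  also have "\<dots> = (\<Sum>j\<in>J. surface_integral \<mu> (h j))"
    unfolding surface_integral_def by (rule sum.swap)
  finally show ?thesis .
qed

lemma surface_integral_mono:
  assumes "continuous_on M h" "continuous_on M g" and "\<And>x. x \<in> M \<Longrightarrow> h x \<le> g x"
  shows "surface_integral \<mu> h \<le> surface_integral \<mu> g"
  unfolding surface_integral_def
proof (rule sum_mono)
  fix k assume k: "k \<in> {..<n}"
  show "(\<integral>x. indicator (S k) x * h x \<partial>\<mu> (D k, X k)) \<le> (\<integral>x. indicator (S k) x * g x \<partial>\<mu> (D k, X k))"
  proof (rule integral_mono)
    show "indicator (S k) x * h x \<le> indicator (S k) x * g x" for x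
      using k by (cases "x \<in> S k") (simp_all add: assms(3) S_in_M)
  qed (use k in \<open>simp_all add: surface_integrable assms\<close>)
qed

lemma patch_compat:
  assumes "(E, Y) \<in> P" "k < n" "B \<in> sets borel" "B \<subseteq> S k \<inter> Y ` E"
  shows "emeasure (\<mu> (D k, X k)) B = emeasure (\<mu> (E, Y)) B"
proof -
  have "B \<subseteq> X k ` D k \<inter> Y ` E" using assms S_chart by blast
  then show ?thesis using \<mu> charts(1)[OF assms(2)] assms(1,3) unfolding admissible_def by blast
qed

text \<open>An integrand that lives in one chart can be measured entirely in that chart: by
  agreement on overlaps, each piece \<open>S k\<close> is remeasured there and the pieces add
  up.\<close>

lemma surface_integral_chart:
  assumes d: "(E, Y) \<in> P" and h: "continuous_on M h" "\<And>x. x \<in> M - Y ` E \<Longrightarrow> h x = 0"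
  shows "surface_integral \<mu> h = (\<integral>x. indicator M x * h x \<partial>\<mu> (E, Y))"
proof -
  have SM: "S k \<subseteq> M" if "k < n" for k using S_union that by blast
  have eq: "indicator (S k) x * h x = indicator (S k) x * (indicator M x * h x)" if "k < n" for k x
    using SM[OF that] by (auto simp: indicator_def)
  have "surface_integral \<mu> h = (\<Sum>k<n. \<integral>x. indicator (S k) x * (indicator M x * h x) \<partial>\<mu> (D k, X k))"
    unfolding surface_integral_def by (intro sum.cong refl Bochner_Integration.integral_cong eq) auto
  also have "\<dots> = (\<integral>x. indicator M x * h x \<partial>\<mu> (E, Y))"
  proof (rule integral_patch[where A = "Y ` E"])
    show "(\<lambda>x. indicator M x * h x) \<in> borel_measurable borel"
      by (rule borel_measurable_on_surface[OF h(1)])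
    show "integrable (\<mu> (D k, X k)) (\<lambda>x. indicator (S k) x * (indicator M x * h x))" if "k \<in> {..<n}" for k
      using surface_integrable[OF h(1), of k] eq[of k] that by simp
    show "indicator M x * h x = 0" if "x \<notin> (\<Union>k<n. S k) \<inter> Y ` E" for x
      using that h(2) unfolding S_union by (auto simp: indicator_def)
  qed (use S_borel S_disjoint chart_image_borel[OF d] patch_compat[OF d] in auto)
  finally show ?thesis .
qed

end

end

context free_boundary_surface
begin

lemma surface_div_vanish:
  assumes u: "c1_field u" and V: "openin (top_of_set M) V" "x \<in> V" "\<And>y. y \<in> V \<Longrightarrow> u y = 0"
  shows "surface_div u x = 0"
proof -
  have "x \<in> M" using V openin_imp_subset by blast
  then obtain E Y q where d: "(E, Y) \<in> P" and q: "q \<in> E" "Y q = x" using M_covered by blast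
  have "partial_deriv E (u \<circ> Y) i q = 0" for i
    by (rule partial_deriv_vanish[OF chart_open[OF d] rel_open_chart_preimage[OF d V(1)]]) (use q V in auto)
  then show ?thesis using surface_div_chart[OF u d q(1)] q(2) by (simp add: chart_div_def)
qed

end

section \<open>From the first variation in a chart to the whole surface\<close>

context covered_surface
begin

text \<open>For a field supported in one compact half-ball, both surface integrals pull back to the
  same chart domain, where the identity is \<open>chart_first_variation\<close>.\<close>

lemma first_variation_local:
  assumes k: "k < n" and u: "c1_field u" "\<And>x. x \<in> M - X k ` K k \<Longrightarrow> u x = 0"
  shows "area_integral (surface_div u) = length_integral (\<lambda>x. u x \<bullet> F x)"
proof -
  note c = charts(1)[OF k]
  have V: "openin (top_of_set M) (M - X k ` K k)"
    using K_image_closed[OF k] by (simp add: Diff_eq openin_open_Int open_Compl)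
  have KD: "X k ` K k \<subseteq> X k ` D k" using K_subset[OF k] by blast
  have XM: "X k p \<in> M" if "p \<in> D k" for p using chart_in_M[OF c that] .
  have cont: "continuous_on M (surface_div u)" "continuous_on M (\<lambda>x. u x \<bullet> F x)"
    using surface_div_continuous[OF u(1)] c1_field_continuous[OF u(1)] c1_field_continuous[OF c1_field_F]
    by (auto intro!: continuous_intros)
  have meas: "(\<lambda>x. indicator M x * surface_div u x) \<in> borel_measurable borel"
    "(\<lambda>x. indicator M x * (u x \<bullet> F x)) \<in> borel_measurable borel"
    by (rule borel_measurable_on_surface[OF cont(1)], rule borel_measurable_on_surface[OF cont(2)])
  have "area_integral (surface_div u) = (\<integral>x. indicator M x * surface_div u x \<partial>area_measure (D k, X k))"
  proof (rule surface_integral_chart[OF admissible_area_measure c cont(1)])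
    fix x assume "x \<in> M - X k ` D k"
    then have "x \<in> M - X k ` K k" using KD by blast
    then show "surface_div u x = 0" by (rule surface_div_vanish[OF u(1) V]) (rule u(2))
  qed
  also have "\<dots> = (\<integral>p. indicator (D k) p * (area_density (D k) (X k) p * (indicator M (X k p) * surface_div u (X k p))) \<partial>lborel)"
    unfolding area_measure_def split by (rule integral_weighted_image_measure[OF area_measure_facts[OF c] meas(1)])
  also have "\<dots> = (\<integral>p. indicator (D k) p * (area_density (D k) (X k) p * chart_div (D k) (X k) u p) \<partial>lborel)"
  proof (rule Bochner_Integration.integral_cong[OF refl])
    fix p
    show "indicator (D k) p * (area_density (D k) (X k) p * (indicator M (X k p) * surface_div u (X k p)))
      = indicator (D k) p * (area_density (D k) (X k) p * chart_div (D k) (X k) u p)"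
      by (cases "p \<in> D k") (simp_all add: XM surface_div_chart[OF u(1) c])
  qed
  also have "\<dots> = (\<integral>t. indicator (D k) (vector [t, 0]) * (length_density (D k) (X k) t
      * ((u \<circ> X k) (vector [t, 0]) \<bullet> (F \<circ> X k) (vector [t, 0]))) \<partial>lborel)"
    unfolding area_density_def chart_div_def length_density_def
  proof (rule chart_first_variation[OF chart_open[OF c] chart_smooth[OF c] chart_gram_pos[OF c] chart_minimal[OF c] chart_conormal[OF c],
        where K = "cball (c k) (r k)"])
    show "(u \<circ> X k) p = 0" if "p \<in> D k - cball (c k) (r k)" for p
    proof -
      have "X k p \<notin> X k ` K k" using chart_point_in_K[OF k, of p] that by (auto simp: K_def)
      then show ?thesis using u(2) XM that by simp
    qed
  qed (use charts(3)[OF k] c1_fieldD[OF u(1) c] in auto)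
  also have "\<dots> = (\<integral>t. indicator (boundary_line (D k)) t * (length_density (D k) (X k) t *
       (indicator M (X k (vector [t, 0])) * (u (X k (vector [t, 0])) \<bullet> F (X k (vector [t, 0]))))) \<partial>lborel)"
  proof (rule Bochner_Integration.integral_cong[OF refl])
    fix t
    show "indicator (D k) (vector [t, 0]) * (length_density (D k) (X k) t
      * ((u \<circ> X k) (vector [t, 0]) \<bullet> (F \<circ> X k) (vector [t, 0])))
      = indicator (boundary_line (D k)) t * (length_density (D k) (X k) t *
       (indicator M (X k (vector [t, 0])) * (u (X k (vector [t, 0])) \<bullet> F (X k (vector [t, 0])))))"
      by (cases "vector [t, 0] \<in> D k") (simp_all add: XM boundary_line_def)
  qed
  also have "\<dots> = (\<integral>x. indicator M x * (u x \<bullet> F x) \<partial>length_measure (D k, X k))"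
    unfolding length_measure_def split by (rule integral_weighted_image_measure[OF length_measure_facts[OF c] meas(2), symmetric])
  also have "\<dots> = length_integral (\<lambda>x. u x \<bullet> F x)"
  proof (rule surface_integral_chart[OF admissible_length_measure c cont(2), symmetric])
    fix x assume "x \<in> M - X k ` D k"
    then show "u x \<bullet> F x = 0" using u(2) KD by (metis DiffD1 DiffD2 DiffI in_mono inner_zero_left)
  qed
  finally show ?thesis .
qed

text \<open>In the coordinates of chart \<open>k\<close> this is the squared positive part of r^2 -
  |q - c|^2. It is positive on \<open>U k\<close>, vanishes off the compact image of the closed
  half-ball, and is C^1 across its edge.\<close>

definition bump :: "nat \<Rightarrow> 'm \<Rightarrow> real" where
  "bump k x = (if x \<in> X k ` D k
     then (max 0 ((r k)\<^sup>2 - (inv_into (D k) (X k) x - c k) \<bullet> (inv_into (D k) (X k) x - c k)))\<^sup>2 else 0)"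

lemma bump_nonneg: "0 \<le> bump k x"
  by (simp add: bump_def)

lemma bump_pos:
  assumes "k < n" "x \<in> U k"
  shows "0 < bump k x"
proof -
  obtain p where p: "p \<in> ball (c k) (r k) \<inter> half_plane" "x = X k p" using assms(2) unfolding U_def by (rule imageE)
  have pD: "p \<in> D k" using p charts(3)[OF assms(1)] by auto
  have inv: "inv_into (D k) (X k) (X k p) = p" by (rule inv_into_f_f[OF chart_inj[OF charts(1)[OF assms(1)]] pD])
  have "norm (p - c k) < r k" using p by (simp add: dist_norm norm_minus_commute)
  then have "(norm (p - c k))\<^sup>2 < (r k)\<^sup>2" by (intro power_strict_mono) auto
  then show ?thesis using pD p(2) by (simp add: bump_def inv power2_norm_eq_inner)
qed

lemma bump_support:
  assumes "k < n" "x \<notin> X k ` K k"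
  shows "bump k x = 0"
proof (cases "x \<in> X k ` D k")
  case True
  then have q: "inv_into (D k) (X k) x \<in> D k" "X k (inv_into (D k) (X k) x) = x"
    by (auto intro: inv_into_into f_inv_into_f)
  let ?q = "inv_into (D k) (X k) x"
  have "?q \<notin> K k" using q(2) assms(2) by (metis imageI)
  moreover have "?q \<in> half_plane" using q(1) chart_open[OF charts(1)[OF assms(1)]] openin_imp_subset by blast
  ultimately have "r k < norm (?q - c k)" by (simp add: K_def dist_norm norm_minus_commute)
  then have "(r k)\<^sup>2 \<le> (norm (?q - c k))\<^sup>2" using charts(2)[OF assms(1)] by (intro power_mono) auto
  then show ?thesis by (simp add: bump_def power2_norm_eq_inner)
qed (simp add: bump_def)

lemma c1_field_bump:
  assumes k: "k < n"
  shows "c1_field (bump k)"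
proof (rule c1_fieldI)
  fix E Y assume d: "(E, Y) \<in> P"
  note c = charts(1)[OF k]
  let ?A = "{q \<in> E. Y q \<in> X k ` D k}" and ?B = "{q \<in> E. Y q \<in> M - X k ` K k}"
  have B: "rel_open ?B"
    by (rule rel_open_chart_preimage[OF d]) (use K_image_closed[OF k] in \<open>simp add: Diff_eq openin_open_Int open_Compl\<close>)
  have A: "rel_open ?A" by (rule overlap_open[OF d c])
  have "c1_on ?A (\<lambda>q. (max 0 ((r k)\<^sup>2 - ((inv_into (D k) (X k) \<circ> Y) q - c k) \<bullet> ((inv_into (D k) (X k) \<circ> Y) q - c k)))\<^sup>2)"
    by (intro c1_on_max_0_square c1_on_diff c1_on_inner c1_on_const A transition_c1[OF d c])
  then have 1: "c1_on ?A (\<lambda>q. bump k (Y q))"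
    by (rule c1_on_cong[OF A]) (simp add: bump_def)
  have 2: "c1_on ?B (\<lambda>q. bump k (Y q))"
    by (rule c1_on_cong[OF B c1_on_const[OF B, of 0]]) (simp add: bump_support[OF k])
  have "?A \<union> ?B = E" using K_subset[OF k] chart_in_M[OF d] by auto
  with c1_on_Un[OF A 1 B 2] show "c1_on E (\<lambda>q. bump k (Y q))" by simp
qed

lemma bump_sum_pos: assumes "x \<in> M" shows "0 < (\<Sum>k<n. bump k x)"
proof -
  obtain k where k: "k < n" "x \<in> U k" using cover assms unfolding U_def by blast
  have "0 < bump k x" by (rule bump_pos[OF k])
  also have "\<dots> \<le> (\<Sum>k<n. bump k x)" by (rule member_le_sum) (use k(1) bump_nonneg in auto)
  finally show ?thesis .
qed

text \<open>The bumps divided by their positive sum \<beta> form a partition of unity. It splits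
  \<open>u\<close> into fields \<open>v k\<close> supported in single charts, and both sides of the
  identity are additive.\<close>

lemma first_variation:
  assumes u: "c1_field u"
  shows "area_integral (surface_div u) = length_integral (\<lambda>x. u x \<bullet> F x)"
proof -
  define \<beta> where "\<beta> = (\<lambda>x. \<Sum>k<n. bump k x)"
  have \<beta>: "c1_field \<beta>" "\<And>x. x \<in> M \<Longrightarrow> 0 < \<beta> x"
    unfolding \<beta>_def using bump_sum_pos by (auto intro!: c1_field_sum c1_field_bump)
  define v where "v = (\<lambda>k x. bump k x *\<^sub>R (inverse (\<beta> x) *\<^sub>R u x))"
  have i\<beta>: "c1_field (\<lambda>x. inverse (\<beta> x))" by (rule c1_field_inverse[OF \<beta>(1)]) (use \<beta>(2) in force)
  have v: "c1_field (v k)" if "k < n" for k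
    unfolding v_def by (rule c1_field_scaleR[OF c1_field_bump[OF that] c1_field_scaleR[OF i\<beta> u]])
  have vsum: "(\<Sum>k<n. v k x) = u x" if "x \<in> M" for x
  proof -
    have "(\<Sum>k<n. v k x) = \<beta> x *\<^sub>R (inverse (\<beta> x) *\<^sub>R u x)"
      unfolding v_def \<beta>_def by (rule scaleR_sum_left[symmetric])
    then show ?thesis using \<beta>(2)[OF that] by simp
  qed
  have "surface_div u x = (\<Sum>k<n. surface_div (v k) x)" if x: "x \<in> M" for x
  proof -
    obtain E Y q where d: "(E, Y) \<in> P" and q: "q \<in> E" "Y q = x" using x M_covered by blast
    have vs: "c1_field (\<lambda>x. \<Sum>k<n. v k x)" by (rule c1_field_sum) (simp add: v)
    \<comment> \<open>\<open>u\<close> and the sum of the \<open>v k\<close> agree on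
      \<open>M\<close> and possibly not elsewhere in the ambient type, so they are compared through
      their derivatives in a chart.\<close>
    have "partial_deriv E (u \<circ> Y) i q = partial_deriv E ((\<lambda>x. \<Sum>k<n. v k x) \<circ> Y) i q" for i
      by (rule partial_deriv_cong(2)[OF chart_open[OF d] q(1) c1_on_differentiable[OF c1_fieldD[OF vs d] q(1)]])
         (simp add: vsum chart_in_M[OF d])
    then have "surface_div u (Y q) = surface_div (\<lambda>x. \<Sum>k<n. v k x) (Y q)"
      using surface_div_chart[OF u d q(1)] surface_div_chart[OF vs d q(1)] by (simp add: chart_div_def)
    also have "\<dots> = (\<Sum>k<n. surface_div (v k) (Y q))"
      by (rule surface_div_sum) (use chart_in_M[OF d q(1)] v in auto)
    finally show ?thesis unfolding q(2) .
  qed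
  then have "area_integral (surface_div u) = area_integral (\<lambda>x. \<Sum>k<n. surface_div (v k) x)"
    by (rule surface_integral_cong[OF admissible_area_measure])
  also have "\<dots> = (\<Sum>k<n. area_integral (surface_div (v k)))"
    by (rule surface_integral_sum[OF admissible_area_measure]) (simp add: surface_div_continuous v)
  also have "\<dots> = (\<Sum>k<n. length_integral (\<lambda>x. v k x \<bullet> F x))"
  proof (intro sum.cong refl)
    fix k assume "k \<in> {..<n}"
    then show "area_integral (surface_div (v k)) = length_integral (\<lambda>x. v k x \<bullet> F x)"
      by (intro first_variation_local[of k] v) (auto simp: v_def bump_support)
  qed
  also have "\<dots> = length_integral (\<lambda>x. \<Sum>k<n. v k x \<bullet> F x)"
    by (rule surface_integral_sum[OF admissible_length_measure, symmetric])
       (auto intro!: c1_field_continuous c1_field_inner v c1_field_F)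
  also have "\<dots> = length_integral (\<lambda>x. u x \<bullet> F x)"
    by (rule surface_integral_cong[OF admissible_length_measure]) (simp add: inner_sum_left[symmetric] vsum)
  finally show ?thesis .
qed

text \<open>The length measure is an image of the boundary line, so the set where the inequality
  fails carries no length. Thus pointwise information on the boundary alone decides length
  integrals.\<close>

lemma length_integral_mono:
  assumes h: "continuous_on M h" "continuous_on M g" and le: "\<And>x. x \<in> surface_boundary P \<Longrightarrow> h x \<le> g x"
  shows "length_integral h \<le> length_integral g"
  unfolding surface_integral_def
proof (rule sum_mono)
  fix k assume "k \<in> {..<n}"
  then have k: "k < n" by simp
  note c = charts(1)[OF k]
  let ?N = "{x. indicator M x * g x < indicator M x * h x}"
  have [measurable]: "(\<lambda>x. indicator M x * h x) \<in> borel_measurable borel" "(\<lambda>x. indicator M x * g x) \<in> borel_measurable borel"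
    by (rule borel_measurable_on_surface[OF h(1)], rule borel_measurable_on_surface[OF h(2)])
  have N: "?N \<in> sets borel" by measurable
  have empty: "{t \<in> boundary_line (D k). X k (vector [t, 0]) \<in> ?N} = {}"
  proof -
    have "X k (vector [t, 0]) \<in> surface_boundary P" if "t \<in> boundary_line (D k)" for t
      unfolding surface_boundary_def using c that by (auto simp: boundary_line_def vector_2 intro!: exI[of _ "X k"] exI[of _ "D k"] exI[of _ "vector [t, 0]"])
    then have "indicator M (X k (vector [t, 0])) * h (X k (vector [t, 0])) \<le> indicator M (X k (vector [t, 0])) * g (X k (vector [t, 0]))"
      if "t \<in> boundary_line (D k)" for t using le that by (intro mult_left_mono) auto
    then show ?thesis by (auto simp: not_less)
  qed
  have "emeasure (length_measure (D k, X k)) ?N = 0"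
    unfolding length_measure_def split
    by (rule trans[OF emeasure_weighted_image_measure[OF length_measure_facts[OF c] N]], assumption, subst empty, simp)
  then have "?N \<in> null_sets (length_measure (D k, X k))" using N by (simp add: null_sets_def)
  then have ae: "AE x in length_measure (D k, X k). x \<notin> ?N" by (rule AE_not_in)
  show "(\<integral>x. indicator (S k) x * h x \<partial>length_measure (D k, X k)) \<le> (\<integral>x. indicator (S k) x * g x \<partial>length_measure (D k, X k))"
  proof (rule integral_mono_AE)
    show "AE x in length_measure (D k, X k). indicator (S k) x * h x \<le> indicator (S k) x * g x"
      using ae
    proof eventually_elim
      case (elim x)
      then show ?case using S_in_M[OF k] by (cases "x \<in> S k") auto
    qed
  qed (use surface_integrable[OF admissible_length_measure _ k] h in auto)
qed

lemma total_mass: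
  assumes "admissible \<mu>"
  shows "(\<Sum>k<n. emeasure (\<mu> (D k, X k)) (S k)) = ennreal (surface_integral \<mu> (\<lambda>_. 1))"
proof -
  have "emeasure (\<mu> (D k, X k)) (S k) = ennreal (\<integral>x. indicator (S k) x * 1 \<partial>\<mu> (D k, X k))" if "k < n" for k
  proof -
    have sets: "S k \<in> sets (\<mu> (D k, X k))" using S_borel[OF that] admissible_sets[OF assms] by simp
    have "emeasure (\<mu> (D k, X k)) (S k) < \<infinity>" using assms that unfolding admissible_def by blast
    then show ?thesis using sets sets.sets_into_space[OF sets] by (simp add: emeasure_eq_ennreal_measure Int_absorb2)
  qed
  then have "(\<Sum>k<n. emeasure (\<mu> (D k, X k)) (S k)) = (\<Sum>k<n. ennreal (\<integral>x. indicator (S k) x * 1 \<partial>\<mu> (D k, X k)))"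
    by (intro sum.cong refl) simp
  also have "\<dots> = ennreal (surface_integral \<mu> (\<lambda>_. 1))"
    unfolding surface_integral_def by (rule sum_ennreal) (auto intro!: integral_nonneg)
  finally show ?thesis .
qed

end

section \<open>Comparison of the integrals with the suprema over dissections\<close>

context covered_surface
begin

text \<open>Any competing dissection is refined by the pieces \<open>S k\<close> and remeasured in
  the charts of the cover. Its sets are disjoint, so within \<open>S k\<close> they have total mass
  at most that of \<open>S k\<close>.\<close>

lemma area_le: "area P F \<le> ennreal (area_integral (\<lambda>_. 1))"
proof -
  let ?\<mu> = "\<lambda>k. area_measure (D k, X k)"
  have "(\<Sum>(a, B)\<in>Q. patch_area F a B) \<le> (\<Sum>k<n. emeasure (?\<mu> k) (S k))" if Q: "dissection P Q" for Q
  proof -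
    have B: "fst q \<in> P" "snd q \<in> sets borel" "snd q \<subseteq> snd (fst q) ` fst (fst q)" if "q \<in> Q" for q
      using Q that unfolding dissection_def by fastforce+
    have fin: "finite Q" and disj: "\<And>q q'. q \<in> Q \<Longrightarrow> q' \<in> Q \<Longrightarrow> q \<noteq> q' \<Longrightarrow> snd q \<inter> snd q' = {}"
      using Q by (auto simp: dissection_def pairwise_def disjnt_def)
    have pieces: "patch_area F (fst q) (snd q) = (\<Sum>k<n. emeasure (?\<mu> k) (snd q \<inter> S k))" if q: "q \<in> Q" for q
    proof -
      obtain E Y T where qe: "q = ((E, Y), T)" by (metis prod.collapse)
      have d: "(E, Y) \<in> P" and T: "T \<in> sets borel" "T \<subseteq> Y ` E" using B[OF q] by (auto simp: qe)
      have TM: "T = (\<Union>k<n. T \<inter> S k)" using T(2) chart_in_M[OF d] S_union by blast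
      have "patch_area F (E, Y) T = emeasure (area_measure (E, Y)) (\<Union>k<n. T \<inter> S k)"
        using patch_area_eq[OF d T(1)] TM by simp
      also have "\<dots> = (\<Sum>k<n. emeasure (area_measure (E, Y)) (T \<inter> S k))"
        by (rule sum_emeasure[symmetric]) (use T(1) S_borel S_disjoint in \<open>auto simp: disjoint_family_on_def\<close>)
      also have "\<dots> = (\<Sum>k<n. emeasure (?\<mu> k) (T \<inter> S k))"
      proof (intro sum.cong refl)
        fix k assume "k \<in> {..<n}"
        then have k: "k < n" by simp
        show "emeasure (area_measure (E, Y)) (T \<inter> S k) = emeasure (?\<mu> k) (T \<inter> S k)"
          by (rule area_measure_overlap[OF d charts(1)[OF k]]) (use T S_borel[OF k] S_chart[OF k] in auto)
      qed
      finally show ?thesis by (simp add: qe)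
    qed
    have "(\<Sum>(a, B)\<in>Q. patch_area F a B) = (\<Sum>q\<in>Q. \<Sum>k<n. emeasure (?\<mu> k) (snd q \<inter> S k))"
      using pieces by (intro sum.cong refl) (auto simp: case_prod_beta)
    also have "\<dots> = (\<Sum>k<n. \<Sum>q\<in>Q. emeasure (?\<mu> k) (snd q \<inter> S k))" by (rule sum.swap)
    also have "\<dots> \<le> (\<Sum>k<n. emeasure (?\<mu> k) (S k))"
    proof (rule sum_mono)
      fix k assume "k \<in> {..<n}"
      then have k: "k < n" by simp
      have "(\<Sum>q\<in>Q. emeasure (?\<mu> k) (snd q \<inter> S k)) = emeasure (?\<mu> k) (\<Union>q\<in>Q. snd q \<inter> S k)"
      proof (rule sum_emeasure)
        show "disjoint_family_on (\<lambda>q. snd q \<inter> S k) Q" unfolding disjoint_family_on_def using disj by blast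
      qed (use B(2) S_borel[OF k] fin in auto)
      also have "\<dots> \<le> emeasure (?\<mu> k) (S k)"
        by (rule emeasure_mono) (use S_borel[OF k] in auto)
      finally show "(\<Sum>q\<in>Q. emeasure (?\<mu> k) (snd q \<inter> S k)) \<le> emeasure (?\<mu> k) (S k)" .
    qed
    finally show ?thesis .
  qed
  then show ?thesis
    unfolding area_def total_mass[OF admissible_area_measure, symmetric] by (intro SUP_least) auto
qed

text \<open>The pieces \<open>S k\<close> with their charts form a dissection, hence a competitor in
  the supremum.\<close>

lemma length_ge: "ennreal (length_integral (\<lambda>_. 1)) \<le> boundary_length P F"
proof -
  let ?q = "\<lambda>k. ((D k, X k), S k)"
  have disj: "S j \<inter> S k = {}" if "j < n" "k < n" "j \<noteq> k" for j k
    using S_disjoint that by (auto simp: disjoint_family_on_def)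
  have "dissection P (?q ` {..<n})"
    unfolding dissection_def
  proof (intro conjI)
    show "\<forall>((D, X), T)\<in>?q ` {..<n}. (D, X) \<in> P \<and> T \<in> sets borel \<and> T \<subseteq> X ` D"
      using charts(1) S_borel S_chart by auto
    show "pairwise (\<lambda>q r. disjnt (snd q) (snd r)) (?q ` {..<n})"
      unfolding pairwise_def disjnt_def using disj by fastforce
  qed simp
  then have "(\<Sum>(a, B)\<in>?q ` {..<n}. patch_boundary_length F a B) \<le> boundary_length P F"
    unfolding boundary_length_def by (intro SUP_upper) simp
  also have "(\<Sum>(a, B)\<in>?q ` {..<n}. patch_boundary_length F a B) = (\<Sum>k<n. patch_boundary_length F (D k, X k) (S k))"
  \<comment> \<open>Different indices may yield the same member of the dissection, but then the
    piece is disjoint from itself, hence empty and of length 0.\<close>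
  proof (subst sum.reindex_nontrivial)
    fix j k assume "j \<in> {..<n}" "k \<in> {..<n}" "j \<noteq> k" "?q j = ?q k"
    then have "S j = {}" using disj[of j k] by auto
    then show "(case ?q j of (a, B) \<Rightarrow> patch_boundary_length F a B) = 0"
      by (simp add: patch_boundary_length_def)
  qed simp_all
  also have "\<dots> = (\<Sum>k<n. emeasure (length_measure (D k, X k)) (S k))"
    by (intro sum.cong refl patch_boundary_length_eq charts S_borel) auto
  also have "\<dots> = ennreal (length_integral (\<lambda>_. 1))"
    by (rule total_mass[OF admissible_length_measure])
  finally show ?thesis .
qed

section \<open>The two test fields\<close>

lemma F_boundary_norm: "x \<in> surface_boundary P \<Longrightarrow> norm (F x) = 1"
  using chart_boundary_norm by (auto simp: surface_boundary_def)

lemma surface_integral_scale: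
  "surface_integral \<mu> (\<lambda>x. a * h x) = a * surface_integral \<mu> h"
  unfolding surface_integral_def sum_distrib_left by (intro sum.cong refl) (simp add: mult.left_commute)

text \<open>The divergence of the position field is the trace of the identity on a tangent plane,
  which is 2, and its normal component on the boundary is |F|^2 = 1.\<close>

lemma twice_area_eq_length:
  "2 * area_integral (\<lambda>_. 1) = length_integral (\<lambda>_. 1)"
proof -
  have "2 * area_integral (\<lambda>_. 1) = area_integral (\<lambda>x. 2 * 1)"
    by (rule surface_integral_scale[symmetric])
  also have "\<dots> = area_integral (surface_div F)"
  proof (rule surface_integral_cong[OF admissible_area_measure])
    fix x assume "x \<in> M"
    then obtain E Y q where d: "(E, Y) \<in> P" and q: "q \<in> E" "Y q = x" using M_covered by blast
    show "2 * 1 = surface_div F x"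
      using surface_div_chart[OF c1_field_F d q(1)] frame_trace_self chart_gram_pos[OF d q(1)] q(2)
      by (force simp: chart_div_def)
  qed
  also have "\<dots> = length_integral (\<lambda>x. F x \<bullet> F x)" by (rule first_variation[OF c1_field_F])
  also have "\<dots> = length_integral (\<lambda>_. 1)"
    \<comment> \<open>The integrands agree on the boundary alone, so equality is obtained by
      monotonicity in both directions.\<close>
    by (intro antisym length_integral_mono c1_field_continuous c1_field_inner c1_field_F c1_field_const)
       (simp_all add: dot_square_norm F_boundary_norm)
  finally show ?thesis .
qed

text \<open>
  The test field \<open>(F - y) / (|F - y|\<^sup>2 + \<epsilon>\<^sup>2)\<close> regularizes the logarithmic gradient with pole
  at a boundary point \<open>y\<close>. On the unit sphere its normal component is at most \<open>1/2\<close>.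
\<close>

lemma concentrated_area_le:
  assumes y: "norm y = 1" and \<epsilon>: "\<epsilon> > 0"
  shows "area_integral (\<lambda>x. 2 * \<epsilon>\<^sup>2 / ((norm (F x - y))\<^sup>2 + \<epsilon>\<^sup>2)\<^sup>2)
      \<le> length_integral (\<lambda>_. 1) / 2"
proof -
  define s where "s = (\<lambda>x. (F x - y) \<bullet> (F x - y) + \<epsilon>\<^sup>2)"
  have s_pos: "s x > 0" for x using \<epsilon> by (simp add: s_def add_nonneg_pos)
  define V where "V = (\<lambda>x. inverse (s x) *\<^sub>R (F x - y))"
  have z: "c1_field (\<lambda>x. F x - y)" by (intro c1_field_diff c1_field_F c1_field_const)
  have s: "c1_field s" unfolding s_def by (intro c1_field_add c1_field_inner z c1_field_const)
  have inv_s: "c1_field (\<lambda>x. inverse (s x))" by (rule c1_field_inverse[OF s]) (use s_pos in \<open>metis less_irrefl\<close>)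
  have V: "c1_field V" unfolding V_def by (rule c1_field_scaleR[OF inv_s z])
  have eq: "2 * \<epsilon>\<^sup>2 / ((norm (F x - y))\<^sup>2 + \<epsilon>\<^sup>2)\<^sup>2 = 2 * \<epsilon>\<^sup>2 * (inverse (s x))\<^sup>2" for x
    by (simp add: s_def power2_norm_eq_inner field_simps)
  have "area_integral (\<lambda>x. 2 * \<epsilon>\<^sup>2 / ((norm (F x - y))\<^sup>2 + \<epsilon>\<^sup>2)\<^sup>2) \<le> area_integral (surface_div V)"
    unfolding eq
  proof (rule surface_integral_mono[OF admissible_area_measure])
    show "continuous_on M (\<lambda>x. 2 * \<epsilon>\<^sup>2 * (inverse (s x))\<^sup>2)"
      by (intro continuous_intros c1_field_continuous inv_s)
    show "continuous_on M (surface_div V)" by (rule surface_div_continuous[OF V])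
    fix x assume "x \<in> M"
    then obtain E Y q where d: "(E, Y) \<in> P" and q: "q \<in> E" "Y q = x" using M_covered by blast
    note E = chart_open[OF d] q(1)
    define a b where "a = partial_deriv E (F \<circ> Y) 1 q" and "b = partial_deriv E (F \<circ> Y) 2 q"
    define w \<phi> where "w = F x - y" and "\<phi> = inverse (s x)"
    have diff: "(u \<circ> Y) differentiable at q within E" if "c1_field u" for u :: "'m \<Rightarrow> 'z::real_normed_vector"
      by (rule c1_on_differentiable[OF c1_fieldD[OF that d] q(1)])
    note diff' = diff[unfolded o_def]
    have dz: "partial_deriv E (\<lambda>p. F (Y p) - y) i q = partial_deriv E (F \<circ> Y) i q" for i
      using partial_deriv_diff[OF E diff'[OF c1_field_F] diff'[OF c1_field_const], of y i] partial_deriv_const[OF E, of y i]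
      by (simp add: o_def)
    have ds: "partial_deriv E (\<lambda>p. s (Y p)) i q = 2 * (w \<bullet> partial_deriv E (F \<circ> Y) i q)" for i
      using partial_deriv_add[OF E diff'[OF c1_field_inner[OF z z]] diff'[OF c1_field_const], of "\<epsilon>\<^sup>2" i]
        partial_deriv_inner[OF E diff'[OF z] diff'[OF z], of i] partial_deriv_const[OF E, of "\<epsilon>\<^sup>2" i]
      by (simp add: s_def dz w_def q(2) inner_commute)
    have dis: "partial_deriv E (\<lambda>p. inverse (s (Y p))) i q = - (2 * \<phi>\<^sup>2) * (w \<bullet> partial_deriv E (F \<circ> Y) i q)" for i
    proof -
      have "(inverse has_real_derivative - inverse ((s x)\<^sup>2)) (at (s (Y q)))"
        using s_pos[of x] by (auto intro!: derivative_eq_intros simp: power2_eq_square q(2))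
      from partial_deriv_chain_real(2)[OF E diff'[OF s] this, of i] show ?thesis
        by (simp add: ds \<phi>_def power_inverse)
    qed
    \<comment> \<open>With \<phi> = 1/s, the derivative of the test field in direction e is \<phi> e
      - 2 \<phi>^2 (w \<bullet> e) w: a multiple of the identity, with trace 2 \<phi>, and a rank
      one term whose trace is controlled by \<open>frame_trace_rank_one_le\<close>.\<close>
    have dV: "partial_deriv E (V \<circ> Y) i q = \<phi> *\<^sub>R partial_deriv E (F \<circ> Y) i q + (- (2 * \<phi>\<^sup>2)) *\<^sub>R ((w \<bullet> partial_deriv E (F \<circ> Y) i q) *\<^sub>R w)" for i
      using partial_deriv_scaleR[OF E diff'[OF inv_s] diff'[OF z], of i]
      by (simp add: V_def o_def dz[unfolded o_def] dis[unfolded o_def] q(2) w_def[symmetric] \<phi>_def[symmetric])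
    have g: "gram a b > 0" unfolding a_def b_def by (rule chart_gram_pos[OF d q(1)])
    have "surface_div V x = \<phi> * frame_trace a b a b + (- (2 * \<phi>\<^sup>2)) * frame_trace a b ((w \<bullet> a) *\<^sub>R w) ((w \<bullet> b) *\<^sub>R w)"
      using surface_div_chart[OF V d q(1)] unfolding chart_div_def dV q(2) a_def[symmetric] b_def[symmetric]
      by (simp only: frame_trace_add frame_trace_scaleR)
    also have "\<dots> \<ge> 2 * \<phi> - 2 * \<phi>\<^sup>2 * (w \<bullet> w)"
      using mult_left_mono[OF frame_trace_rank_one_le[OF g, of w], of "2 * \<phi>\<^sup>2"] g by (simp add: frame_trace_self)
    finally have "2 * \<phi> - 2 * \<phi>\<^sup>2 * (w \<bullet> w) \<le> surface_div V x" .
    \<comment> \<open>This is \<phi> = \<phi>^2 s. After substitution the two |w|^2 terms cancel,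
      leaving the \<epsilon>^2 term alone.\<close>
    moreover have "\<phi> = \<phi>\<^sup>2 * (w \<bullet> w + \<epsilon>\<^sup>2)"
      using s_pos[of x] by (simp add: \<phi>_def s_def w_def power2_eq_square)
    then have "2 * \<phi> - 2 * \<phi>\<^sup>2 * (w \<bullet> w) = 2 * \<epsilon>\<^sup>2 * \<phi>\<^sup>2" by (simp add: algebra_simps)
    ultimately show "2 * \<epsilon>\<^sup>2 * (inverse (s x))\<^sup>2 \<le> surface_div V x" by (simp add: \<phi>_def)
  qed
  also have "\<dots> = length_integral (\<lambda>x. V x \<bullet> F x)" by (rule first_variation[OF V])
  also have "\<dots> \<le> length_integral (\<lambda>x. 1 / 2 * 1)"
  proof (rule length_integral_mono)
    show "continuous_on M (\<lambda>x. V x \<bullet> F x)" by (intro c1_field_continuous c1_field_inner V c1_field_F)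
    fix x assume "x \<in> surface_boundary P"
    then have "F x \<bullet> F x = 1" using F_boundary_norm by (simp add: dot_square_norm)
    moreover have "y \<bullet> y = 1" using y by (simp add: dot_square_norm)
    \<comment> \<open>For unit vectors |F - y|^2 = 2 - 2 F \<bullet> y, which is twice (F - y)
      \<bullet> F.\<close>
    ultimately have "(F x - y) \<bullet> F x = (F x - y) \<bullet> (F x - y) / 2"
      by (simp add: inner_diff_left inner_diff_right inner_commute)
    also have "\<dots> \<le> s x / 2" by (simp add: s_def)
    finally have "inverse (s x) * ((F x - y) \<bullet> F x) \<le> inverse (s x) * (s x / 2)"
      using s_pos[of x] by (intro mult_left_mono) auto
    then show "V x \<bullet> F x \<le> 1 / 2 * 1" using s_pos[of x] by (simp add: V_def)
  qed simp
  also have "\<dots> = length_integral (\<lambda>_. 1) / 2" unfolding surface_integral_scale by simp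
  finally show ?thesis .
qed

text \<open>A single chart bounds the area integral of a nonnegative function from below, which is
  what the blow-up needs: it is carried out in one chart at the pole.\<close>

lemma chart_area_le:
  assumes d: "(E, Y) \<in> P" and h: "continuous_on M h" "\<And>x. x \<in> M \<Longrightarrow> 0 \<le> h x"
  shows "(\<integral>\<^sup>+p\<in>E. ennreal (area_density E Y p * h (Y p)) \<partial>lborel) \<le> ennreal (area_integral h)"
proof -
  let ?h = "\<lambda>x. ennreal (indicator M x * h x) * indicator (Y ` E) x"
  have YM: "Y ` E \<subseteq> M" using chart_in_M[OF d] by blast
  have [measurable]: "(\<lambda>x. indicator M x * h x) \<in> borel_measurable borel"
    by (rule borel_measurable_on_surface[OF h(1)])
  have [measurable]: "Y ` E \<in> sets borel" by (rule chart_image_borel[OF d])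
  have meas: "?h \<in> borel_measurable borel" by measurable
  have "(\<integral>\<^sup>+p\<in>E. ennreal (area_density E Y p * h (Y p)) \<partial>lborel) = (\<integral>\<^sup>+p. ennreal (area_density E Y p) * ?h (Y p) * indicator E p \<partial>lborel)"
  proof (intro nn_integral_cong)
    fix p
    show "ennreal (area_density E Y p * h (Y p)) * indicator E p = ennreal (area_density E Y p) * ?h (Y p) * indicator E p"
      by (cases "p \<in> E") (use YM h(2) less_imp_le[OF area_density_pos[OF d]] in \<open>auto simp: ennreal_mult\<close>)
  qed
  also have "\<dots> = (\<integral>\<^sup>+x. ?h x \<partial>area_measure (E, Y))"
    unfolding area_measure_def split by (rule nn_integral_weighted_image_measure[OF area_measure_facts[OF d] meas, symmetric])
  also have "\<dots> = (\<Sum>k<n. \<integral>\<^sup>+x. indicator (S k) x * ?h x \<partial>area_measure (D k, X k))"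
  proof (rule nn_integral_patch[symmetric, where A = "Y ` E"])
    show "?h x = 0" if "x \<notin> (\<Union>k<n. S k) \<inter> Y ` E" for x
      using that unfolding S_union by (auto simp: indicator_def)
  qed (use S_borel S_disjoint meas patch_compat[OF admissible_area_measure d] in auto)
  also have "\<dots> \<le> (\<Sum>k<n. ennreal (\<integral>x. indicator (S k) x * h x \<partial>area_measure (D k, X k)))"
  proof (rule sum_mono)
    fix k assume "k \<in> {..<n}"
    then have k: "k < n" by simp
    have "(\<integral>\<^sup>+x. indicator (S k) x * ?h x \<partial>area_measure (D k, X k)) \<le> (\<integral>\<^sup>+x. ennreal (indicator (S k) x * h x) \<partial>area_measure (D k, X k))"
      using S_in_M[OF k] by (intro nn_integral_mono) (auto simp: indicator_def)
    also have "\<dots> = ennreal (\<integral>x. indicator (S k) x * h x \<partial>area_measure (D k, X k))"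
      by (rule nn_integral_eq_integral[OF surface_integrable[OF admissible_area_measure h(1) k]])
         (use S_in_M[OF k] h(2) in \<open>auto simp: indicator_def\<close>)
    finally show "(\<integral>\<^sup>+x. indicator (S k) x * ?h x \<partial>area_measure (D k, X k)) \<le> ennreal (\<integral>x. indicator (S k) x * h x \<partial>area_measure (D k, X k))" .
  qed
  also have "\<dots> = ennreal (area_integral h)"
    unfolding surface_integral_def
  proof (rule sum_ennreal)
    fix k assume "k \<in> {..<n}"
    then show "0 \<le> (\<integral>x. indicator (S k) x * h x \<partial>area_measure (D k, X k))"
      using S_in_M[of k] h(2) by (intro Bochner_Integration.integral_nonneg) (auto simp: indicator_def)
  qed
  finally show ?thesis .
qed

end

section \<open>Blow-up at a boundary point\<close>

text \<open>Completing the square, A times the quadratic is (A t + B)^2 + W^2, so arctan ((A t + B)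
  / W) is a primitive. It tends to \<pi>/2 at infinity and equals arctan (B / W) at 0.\<close>

lemma nn_integral_shifted_lorentzian:
  fixes A B C W :: real
  assumes A: "A > 0" and W: "W > 0" "W * W = A * C - B * B"
  shows "(\<integral>\<^sup>+t. ennreal (W / (A * t\<^sup>2 + 2 * B * t + C)) * indicator {0..} t \<partial>lborel) = ennreal (pi / 2 - arctan (B / W))"
proof -
  have pos: "0 < A * t\<^sup>2 + 2 * B * t + C" for t
  proof -
    have "0 < (A * t + B)\<^sup>2 + W * W" using W(1) by (simp add: add_nonneg_pos)
    also have "\<dots> = A * (A * t\<^sup>2 + 2 * B * t + C)" unfolding W(2) by (simp add: power2_eq_square algebra_simps)
    finally show ?thesis using A by (simp add: zero_less_mult_iff)
  qed
  have "(\<integral>\<^sup>+t. ennreal (W / (A * t\<^sup>2 + 2 * B * t + C)) * indicator {0..} t \<partial>lborel) = ennreal (pi / 2 - arctan ((A * 0 + B) / W))"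
  proof (rule nn_integral_FTC_atLeast)
    show "(\<lambda>t. W / (A * t\<^sup>2 + 2 * B * t + C)) \<in> borel_measurable borel" by measurable
    show "0 \<le> W / (A * t\<^sup>2 + 2 * B * t + C)" for t using pos[of t] W(1) by simp
    show "((\<lambda>t. arctan ((A * t + B) / W)) has_real_derivative W / (A * t\<^sup>2 + 2 * B * t + C)) (at t)" for t
    proof -
      have eq: "inverse (1 + ((A * t + B) / W)\<^sup>2) * (A / W) = W / (A * t\<^sup>2 + 2 * B * t + C)"
      proof -
        have "1 + ((A * t + B) / W)\<^sup>2 = (W * W + (A * t + B)\<^sup>2) / (W * W)"
          using W(1) by (simp add: field_simps power2_eq_square)
        also have "W * W + (A * t + B)\<^sup>2 = A * (A * t\<^sup>2 + 2 * B * t + C)"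
          unfolding W(2) by (simp add: power2_eq_square algebra_simps)
        finally have sq: "1 + ((A * t + B) / W)\<^sup>2 = A * (A * t\<^sup>2 + 2 * B * t + C) / (W * W)" .
        show ?thesis unfolding sq using A W(1) pos[of t] by simp
      qed
      show ?thesis unfolding eq[symmetric] using W(1) by (auto intro!: derivative_eq_intros)
    qed
    have "filterlim (\<lambda>t. (A * t + B) / W) at_top at_top"
      using A W(1) by real_asymp
    then show "((\<lambda>t. arctan ((A * t + B) / W)) \<longlongrightarrow> pi / 2) at_top"
      by (rule filterlim_compose[OF tendsto_arctan_at_top])
  qed
  then show ?thesis by simp
qed

text \<open>Reflecting the negative half-line replaces \<open>B\<close> by \<open>- B\<close>; the
  two arctan terms cancel because arctan is odd.\<close>

lemma nn_integral_lorentzian: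
  fixes A B C W :: real
  assumes A: "A > 0" and W: "W > 0" "W * W = A * C - B * B"
  shows "(\<integral>\<^sup>+t. ennreal (W / (A * t\<^sup>2 + 2 * B * t + C)) \<partial>lborel) = ennreal pi"
proof -
  let ?H = "\<lambda>B t. ennreal (W / (A * t\<^sup>2 + 2 * B * t + C))"
  have "(\<integral>\<^sup>+t. ?H B t \<partial>lborel) = (\<integral>\<^sup>+t. ?H B t * indicator {0..} t + ?H B t * indicator {..<0} t \<partial>lborel)"
    by (intro nn_integral_cong) (auto simp: indicator_def)
  also have "\<dots> = (\<integral>\<^sup>+t. ?H B t * indicator {0..} t \<partial>lborel) + (\<integral>\<^sup>+t. ?H B t * indicator {..<0} t \<partial>lborel)"
    by (rule nn_integral_add) measurable
  also have "(\<integral>\<^sup>+t. ?H B t * indicator {..<0} t \<partial>lborel) = (\<integral>\<^sup>+t. ?H (- B) t * indicator {0<..} t \<partial>lborel)"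
    by (subst nn_integral_real_affine[where c = "-1" and t = 0])
       (auto intro!: nn_integral_cong simp: indicator_def)
  also have "\<dots> = (\<integral>\<^sup>+t. ?H (- B) t * indicator {0..} t \<partial>lborel)"
    by (intro nn_integral_cong_AE) (use AE_lborel_singleton[of 0] in eventually_elim, auto simp: indicator_def)
  also have "(\<integral>\<^sup>+t. ?H B t * indicator {0..} t \<partial>lborel) + (\<integral>\<^sup>+t. ?H (- B) t * indicator {0..} t \<partial>lborel)
     = ennreal (pi / 2 - arctan (B / W)) + ennreal (pi / 2 - arctan (- B / W))"
    using nn_integral_shifted_lorentzian[OF assms] nn_integral_shifted_lorentzian[of A W C "- B"] assms by simp
  also have "\<dots> = ennreal ((pi / 2 - arctan (B / W)) + (pi / 2 - arctan (- B / W)))"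
    using arctan_ubound[of "B / W"] arctan_ubound[of "- B / W"] by (intro ennreal_plus[symmetric]) auto
  also have "\<dots> = ennreal pi" by (simp add: arctan_minus)
  finally show ?thesis .
qed

text \<open>Substituting \<open>(x, y) = (s t, s)\<close> makes the inner integral elementary.\<close>

lemma half_plane_bubble_integral:
  fixes a b :: "'a::real_inner"
  assumes g: "gram a b > 0"
  shows "(\<integral>\<^sup>+q. ennreal (2 * sqrt (gram a b) / ((norm (q $ 1 *\<^sub>R a + q $ 2 *\<^sub>R b))\<^sup>2 + 1)\<^sup>2) * indicator {q. 0 < q $ 2} (q :: real^2) \<partial>lborel)
     = ennreal pi"
proof -
  define A B C W where defs: "A = a \<bullet> a" "B = a \<bullet> b" "C = b \<bullet> b" "W = sqrt (gram a b)"
  define Q where "Q = (\<lambda>t. A * t\<^sup>2 + 2 * B * t + C)"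
  have W: "W > 0" "W * W = A * C - B * B"
    using g by (simp_all add: defs) (simp add: gram_def power2_eq_square)
  have "a \<noteq> 0" using g by (auto simp: gram_def)
  then have A: "A > 0" by (simp add: defs)
  have Q: "Q t > 0" for t
  proof -
    have "0 < (A * t + B)\<^sup>2 + W * W" using W(1) by (simp add: add_nonneg_pos)
    also have "\<dots> = A * Q t" unfolding W(2) Q_def by (simp add: power2_eq_square algebra_simps)
    finally show ?thesis using A by (simp add: zero_less_mult_iff)
  qed
  have nrm: "(norm ((s * t) *\<^sub>R a + s *\<^sub>R b))\<^sup>2 = s\<^sup>2 * Q t" for s t
    unfolding power2_norm_eq_inner Q_def defs
    by (simp add: inner_simps inner_commute[of b a] power2_eq_square algebra_simps)
  define h where "h = (\<lambda>q :: real^2. ennreal (2 * W / ((norm (q $ 1 *\<^sub>R a + q $ 2 *\<^sub>R b))\<^sup>2 + 1)\<^sup>2) * indicator {q. 0 < q $ 2} q)"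
  have "(\<lambda>q :: real^2. (norm (q $ 1 *\<^sub>R a + q $ 2 *\<^sub>R b))\<^sup>2) \<in> borel_measurable borel"
    unfolding power2_norm_eq_inner by (simp add: inner_simps)
  then have [measurable]: "h \<in> borel_measurable borel" unfolding h_def by measurable
  have "(\<integral>\<^sup>+q. h q \<partial>lborel) = (\<integral>\<^sup>+y. \<integral>\<^sup>+x. h (vector [x, y]) \<partial>lborel \<partial>lborel)"
    by (rule nn_integral_vec2) measurable
  also have "\<dots> = (\<integral>\<^sup>+s. \<integral>\<^sup>+t. ennreal (2 * W * s / (s\<^sup>2 * Q t + 1)\<^sup>2) * indicator {0<..} s \<partial>lborel \<partial>lborel)"
  proof (rule nn_integral_cong)
    fix s :: real
    show "(\<integral>\<^sup>+x. h (vector [x, s]) \<partial>lborel) = (\<integral>\<^sup>+t. ennreal (2 * W * s / (s\<^sup>2 * Q t + 1)\<^sup>2) * indicator {0<..} s \<partial>lborel)"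
    proof (cases "0 < s")
      case True
      have "(\<integral>\<^sup>+x. h (vector [x, s]) \<partial>lborel) = ennreal \<bar>s\<bar> * (\<integral>\<^sup>+t. h (vector [0 + s * t, s]) \<partial>lborel)"
      proof (rule nn_integral_real_affine)
        have "(\<lambda>x. vector [x, s] :: real^2) \<in> borel_measurable borel"
          by (intro borel_measurable_continuous_onI continuous_intros)
        then show "(\<lambda>x. h (vector [x, s])) \<in> borel_measurable borel" by measurable
      qed (use True in simp)
      also have "\<dots> = (\<integral>\<^sup>+t. ennreal \<bar>s\<bar> * h (vector [0 + s * t, s]) \<partial>lborel)"
      proof (rule nn_integral_cmult[symmetric])
        have "(\<lambda>t. vector [0 + s * t, s] :: real^2) \<in> borel_measurable borel"
          by (intro borel_measurable_continuous_onI continuous_intros)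
        then show "(\<lambda>t. h (vector [0 + s * t, s])) \<in> borel_measurable lborel" by measurable
      qed
      also have "\<dots> = (\<integral>\<^sup>+t. ennreal (2 * W * s / (s\<^sup>2 * Q t + 1)\<^sup>2) * indicator {0<..} s \<partial>lborel)"
      proof (rule nn_integral_cong)
        fix t
        have h: "h (vector [0 + s * t, s]) = ennreal (2 * W / (s\<^sup>2 * Q t + 1)\<^sup>2)"
          using True by (simp add: h_def vector_2 nrm)
        have "ennreal \<bar>s\<bar> * h (vector [0 + s * t, s]) = ennreal (\<bar>s\<bar> * (2 * W / (s\<^sup>2 * Q t + 1)\<^sup>2))"
          unfolding h using W(1) by (intro ennreal_mult[symmetric]) auto
        also have "\<bar>s\<bar> * (2 * W / (s\<^sup>2 * Q t + 1)\<^sup>2) = 2 * W * s / (s\<^sup>2 * Q t + 1)\<^sup>2" using True by simp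
        finally show "ennreal \<bar>s\<bar> * h (vector [0 + s * t, s]) = ennreal (2 * W * s / (s\<^sup>2 * Q t + 1)\<^sup>2) * indicator {0<..} s"
          using True by simp
      qed
      finally show ?thesis .
    next
      case False then show ?thesis by (simp add: h_def vector_2)
    qed
  qed
  \<comment> \<open>After the exchange, the Jacobian \<open>s\<close> makes the integrand an exact
    derivative in \<open>s\<close>, with primitive - (W / Q t) / (s^2 Q t + 1). The radial integral
    is \<open>W / Q t\<close>, and the slopes \<open>t\<close> of all rays into the upper half-plane
    contribute a total of \<pi>.\<close>
  also have "\<dots> = (\<integral>\<^sup>+t. \<integral>\<^sup>+s. ennreal (2 * W * s / (s\<^sup>2 * Q t + 1)\<^sup>2) * indicator {0<..} s \<partial>lborel \<partial>lborel)"
    by (rule lborel_pair.Fubini') (simp add: Q_def case_prod_beta', measurable)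
  also have "\<dots> = (\<integral>\<^sup>+t. ennreal (W / Q t) \<partial>lborel)"
  proof (rule nn_integral_cong)
    fix t
    have "(\<integral>\<^sup>+s. ennreal (2 * W * s / (s\<^sup>2 * Q t + 1)\<^sup>2) * indicator {0<..} s \<partial>lborel)
       = (\<integral>\<^sup>+s. ennreal (2 * W * s / (s\<^sup>2 * Q t + 1)\<^sup>2) * indicator {0..} s \<partial>lborel)"
      by (intro nn_integral_cong) (auto simp: indicator_def)
    also have "\<dots> = ennreal (0 - (- (W / Q t) / (0\<^sup>2 * Q t + 1)))"
    proof (rule nn_integral_FTC_atLeast)
      show "(\<lambda>s. 2 * W * s / (s\<^sup>2 * Q t + 1)\<^sup>2) \<in> borel_measurable borel" by measurable
      show "0 \<le> 2 * W * s / (s\<^sup>2 * Q t + 1)\<^sup>2" if "0 \<le> s" for s using that W(1) by simp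
      show "((\<lambda>s. - (W / Q t) / (s\<^sup>2 * Q t + 1)) has_real_derivative 2 * W * s / (s\<^sup>2 * Q t + 1)\<^sup>2) (at s)" for s
      proof -
        have "s\<^sup>2 * Q t + 1 > 0" using Q[of t] by (simp add: add_nonneg_pos)
        then show ?thesis using Q[of t]
          by (auto intro!: derivative_eq_intros simp: power2_eq_square)
      qed
      show "((\<lambda>s. - (W / Q t) / (s\<^sup>2 * Q t + 1)) \<longlongrightarrow> 0) at_top"
        using Q[of t] by real_asymp
    qed
    finally show "(\<integral>\<^sup>+s. ennreal (2 * W * s / (s\<^sup>2 * Q t + 1)\<^sup>2) * indicator {0<..} s \<partial>lborel) = ennreal (W / Q t)" by simp
  qed
  also have "\<dots> = ennreal pi" unfolding Q_def by (rule nn_integral_lorentzian[OF A W])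
  finally show ?thesis unfolding h_def defs(4) .
qed

text \<open>Since \<open>p\<close> lies on the boundary line and \<open>q\<close> points upwards, p
  + e q is in the half-plane, and in \<open>E\<close> once \<open>e\<close> is small.
  Differentiability within \<open>E\<close> therefore applies along this sequence.\<close>

lemma blow_up_tendsto:
  fixes f :: "real^2 \<Rightarrow> 'b::real_normed_vector"
  assumes E: "rel_open E" "p \<in> E" "p $ 2 = 0" and f: "f differentiable at p within E" and q: "0 < q $ 2"
    and e: "\<And>m. 0 < e m" "e \<longlonglongrightarrow> 0"
  shows "filterlim (\<lambda>m. p + e m *\<^sub>R q) (at p within E) sequentially"
    "(\<lambda>m. (1 / e m) *\<^sub>R (f (p + e m *\<^sub>R q) - f p))
       \<longlonglongrightarrow> q $ 1 *\<^sub>R partial_deriv E f 1 p + q $ 2 *\<^sub>R partial_deriv E f 2 p"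
proof -
  let ?T = "\<lambda>m. p + e m *\<^sub>R q" and ?f' = "\<lambda>v. v $ 1 *\<^sub>R partial_deriv E f 1 p + v $ 2 *\<^sub>R partial_deriv E f 2 p"
  have q0: "q \<noteq> 0" using q by auto
  have "?T \<longlonglongrightarrow> p + 0 *\<^sub>R q" by (intro tendsto_intros e)
  then have T: "?T \<longlonglongrightarrow> p" by simp
  obtain \<delta> where \<delta>: "\<delta> > 0" "ball p \<delta> \<inter> half_plane \<subseteq> E"
    using E(1,2) unfolding openin_contains_ball by blast
  have "\<forall>\<^sub>F m in sequentially. dist (?T m) p < \<delta>" using T \<delta>(1) tendstoD by blast
  then have ev: "\<forall>\<^sub>F m in sequentially. ?T m \<in> E"
  proof eventually_elim
    case (elim m)
    have "?T m \<in> half_plane" using E(3) q e(1)[of m] by (simp add: half_plane_def)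
    then show ?case using elim \<delta>(2) by (auto simp: dist_commute)
  qed
  show lim: "filterlim ?T (at p within E) sequentially"
    unfolding filterlim_at
  proof
    have "?T m \<noteq> p" for m using q0 e(1)[of m] by simp
    with ev show "\<forall>\<^sub>F m in sequentially. ?T m \<in> E \<and> ?T m \<noteq> p" by (simp add: eventually_mono)
  qed (rule T)
  have "((\<lambda>x. (1 / norm (x - p)) *\<^sub>R (f x - (f p + ?f' (x - p)))) \<longlongrightarrow> 0) (at p within E)"
    using has_derivative_partials[OF f] unfolding has_derivative_within by blast
  from filterlim_compose[OF this lim]
  have "(\<lambda>m. (1 / norm (e m *\<^sub>R q)) *\<^sub>R (f (?T m) - (f p + ?f' (e m *\<^sub>R q)))) \<longlonglongrightarrow> 0" by simp
  from tendsto_scaleR[OF tendsto_const[of "norm q"] this]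
  have "(\<lambda>m. norm q *\<^sub>R ((1 / norm (e m *\<^sub>R q)) *\<^sub>R (f (?T m) - (f p + ?f' (e m *\<^sub>R q))))) \<longlonglongrightarrow> 0" by simp
  \<comment> \<open>The factor |q| converts the remainder divided by |e q| into the difference
    quotient in \<open>e\<close> minus its limit.\<close>
  moreover have "norm q *\<^sub>R ((1 / norm (e m *\<^sub>R q)) *\<^sub>R (f (?T m) - (f p + ?f' (e m *\<^sub>R q))))
      = (1 / e m) *\<^sub>R (f (?T m) - f p) - ?f' q" for m
  proof -
    have 1: "norm q *\<^sub>R ((1 / norm (e m *\<^sub>R q)) *\<^sub>R v) = (1 / e m) *\<^sub>R v" for v :: 'b
      using q0 e(1)[of m] by simp
    have "?f' (e m *\<^sub>R q) = e m *\<^sub>R ?f' q" by (simp add: scaleR_add_right)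
    then show ?thesis unfolding 1 using e(1)[of m] less_imp_neq[OF e(1)[of m]] by (simp add: scaleR_diff_right scaleR_add_right)
  qed
  ultimately have "(\<lambda>m. (1 / e m) *\<^sub>R (f (?T m) - f p) - ?f' q) \<longlonglongrightarrow> 0" by simp
  then show "(\<lambda>m. (1 / e m) *\<^sub>R (f (?T m) - f p)) \<longlonglongrightarrow> ?f' q" by (rule LIM_zero_cancel)
qed

lemma nn_integral_blow_up:
  fixes p :: "real^2"
  assumes [measurable]: "h \<in> borel_measurable borel" and e: "0 < e"
  shows "(\<integral>\<^sup>+x. h x \<partial>lborel) = (\<integral>\<^sup>+q. ennreal (e\<^sup>2) * h (p + e *\<^sub>R q) \<partial>lborel)"
proof -
  have "(\<integral>\<^sup>+x. h x \<partial>lborel) = (\<integral>\<^sup>+x. h x \<partial>density (distr lborel borel (\<lambda>q. p + e *\<^sub>R q)) (\<lambda>_. ennreal (\<bar>e\<bar> ^ DIM(real^2))))"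
    using lborel_affine[of e p] e by simp
  also have "\<dots> = (\<integral>\<^sup>+q. ennreal (\<bar>e\<bar> ^ DIM(real^2)) * h (p + e *\<^sub>R q) \<partial>lborel)"
    by (subst nn_integral_density, simp, simp, subst nn_integral_distr) simp_all
  also have "\<bar>e\<bar> ^ DIM(real^2) = e\<^sup>2" by simp
  finally show ?thesis .
qed

section \<open>The lower bound for the boundary length\<close>

context covered_surface
begin

text \<open>For fixed \<open>q\<close> in the open upper half-plane the rescaled chart domains
  eventually contain \<open>q\<close>, and the rescaled integrands \<open>k m\<close> converge there
  to the bubble of the tangent map. Fatou's lemma then requires only pointwise limits and
  nonnegativity, and each integral is at most L/2.\<close>

lemma length_ge_2pi: "2 * pi \<le> length_integral (\<lambda>_. 1)"
proof -
  define L where "L = length_integral (\<lambda>_. 1)"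
  obtain E Y p where d: "(E, Y) \<in> P" and p: "p \<in> E" "p $ 2 = 0"
    using boundary_nonempty unfolding surface_boundary_def by blast
  define f where "f = F \<circ> Y"
  define y where "y = f p"
  have y: "norm y = 1" using chart_boundary_norm[OF d p] by (simp add: y_def f_def)
  define a b where "a = partial_deriv E f 1 p" and "b = partial_deriv E f 2 p"
  have g: "gram a b > 0" using chart_gram_pos[OF d p(1)] by (simp add: a_def b_def f_def)
  define W where "W = area_density E Y"
  have Wp: "W p = sqrt (gram a b)" by (simp add: W_def area_density_def a_def b_def f_def)
  have cont: "continuous_on E f" "continuous_on E W"
    unfolding f_def W_def by (rule c1_on_continuous[OF chart_c1[OF d]], rule area_density_continuous[OF d])
  have W0: "0 \<le> W x" if "x \<in> E" for x using area_density_pos[OF d that] by (simp add: W_def)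
  define e where "e = (\<lambda>m. 1 / (real m + 1))"
  have e: "0 < e m" for m by (simp add: e_def)
  have e0: "e \<longlonglongrightarrow> 0" unfolding e_def by real_asymp
  let ?T = "\<lambda>m q. p + e m *\<^sub>R q"
  \<comment> \<open>\<open>k\<close> is \<open>h\<close> in the variable q with x = p + e q,
    multiplied by the Jacobian e^2. The scaling is exact: e^2 * 2 e^2 / (n^2 + e^2)^2 = 2 / ((n/e)^2
    + 1)^2, so \<epsilon> survives only inside the difference quotient, the weight and the
    domain.\<close>
  define k where "k = (\<lambda>m q. ennreal (W (?T m q) * (2 / ((norm ((1 / e m) *\<^sub>R (f (?T m q) - y)))\<^sup>2 + 1)\<^sup>2)) * indicator E (?T m q))"
  define h where "h = (\<lambda>m x. ennreal (W x * (2 * (e m)\<^sup>2 / ((norm (f x - y))\<^sup>2 + (e m)\<^sup>2)\<^sup>2)) * indicator E x)"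
  have den: "(norm (f x - y))\<^sup>2 + (e m)\<^sup>2 > 0" for x m using e[of m] by (simp add: add_nonneg_pos)
  have h_meas: "h m \<in> borel_measurable borel" for m
  proof -
    have "continuous_on E (\<lambda>x. W x * (2 * (e m)\<^sup>2 / ((norm (f x - y))\<^sup>2 + (e m)\<^sup>2)\<^sup>2))"
      using den[of _ m] by (intro continuous_intros cont) (metis less_irrefl power_eq_0_iff)
    from borel_measurable_indicator_times[OF chart_open[OF d] this]
    have "(\<lambda>x. ennreal (indicator E x * (W x * (2 * (e m)\<^sup>2 / ((norm (f x - y))\<^sup>2 + (e m)\<^sup>2)\<^sup>2)))) \<in> borel_measurable borel"
      by measurable
    also have "(\<lambda>x. ennreal (indicator E x * (W x * (2 * (e m)\<^sup>2 / ((norm (f x - y))\<^sup>2 + (e m)\<^sup>2)\<^sup>2)))) = h m"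
      by (auto simp: h_def fun_eq_iff indicator_def)
    finally show ?thesis .
  qed
  have hk: "ennreal ((e m)\<^sup>2) * h m (?T m q) = k m q" for m q
  proof (cases "?T m q \<in> E")
    case True
    let ?n = "norm (f (?T m q) - y)"
    have N: "(norm ((1 / e m) *\<^sub>R (f (?T m q) - y)))\<^sup>2 = ?n\<^sup>2 / (e m)\<^sup>2"
      using e[of m] by (simp add: power_divide)
    have "?n\<^sup>2 / (e m)\<^sup>2 + 1 = (?n\<^sup>2 + (e m)\<^sup>2) / (e m)\<^sup>2"
      using e[of m] by (simp add: add_divide_distrib)
    then have "((norm ((1 / e m) *\<^sub>R (f (?T m q) - y)))\<^sup>2 + 1)\<^sup>2 = (?n\<^sup>2 + (e m)\<^sup>2)\<^sup>2 / ((e m)\<^sup>2)\<^sup>2"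
      unfolding N by (simp only: power_divide)
    then have "(e m)\<^sup>2 * (W (?T m q) * (2 * (e m)\<^sup>2 / (?n\<^sup>2 + (e m)\<^sup>2)\<^sup>2))
        = W (?T m q) * (2 / ((norm ((1 / e m) *\<^sub>R (f (?T m q) - y)))\<^sup>2 + 1)\<^sup>2)"
      by (simp add: power2_eq_square)
    moreover have "0 \<le> W (?T m q) * (2 * (e m)\<^sup>2 / (?n\<^sup>2 + (e m)\<^sup>2)\<^sup>2)" using W0[OF True] by simp
    ultimately show ?thesis using True by (simp add: h_def k_def ennreal_mult[symmetric])
  qed (simp add: h_def k_def)
  have bound: "(\<integral>\<^sup>+q. k m q \<partial>lborel) \<le> ennreal (L / 2)" for m
  proof -
    have "(\<integral>\<^sup>+q. k m q \<partial>lborel) = (\<integral>\<^sup>+x. h m x \<partial>lborel)"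
      unfolding nn_integral_blow_up[OF h_meas e, of m m p] hk ..
    also have "\<dots> \<le> ennreal (area_integral (\<lambda>x. 2 * (e m)\<^sup>2 / ((norm (F x - y))\<^sup>2 + (e m)\<^sup>2)\<^sup>2))"
      unfolding h_def W_def f_def o_apply
    proof (rule chart_area_le[OF d])
      have "(norm (F x - y))\<^sup>2 + (e m)\<^sup>2 > 0" for x using e[of m] by (simp add: add_nonneg_pos)
      then show "continuous_on M (\<lambda>x. 2 * (e m)\<^sup>2 / ((norm (F x - y))\<^sup>2 + (e m)\<^sup>2)\<^sup>2)"
        by (intro continuous_intros c1_field_continuous[OF c1_field_F]) (metis less_irrefl power_eq_0_iff)
    qed simp
    also have "\<dots> \<le> ennreal (L / 2)" unfolding L_def by (intro ennreal_leI concentrated_area_le y e)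
    finally show ?thesis .
  qed
  have k_lim: "(\<lambda>m. k m q) \<longlonglongrightarrow> ennreal (2 * sqrt (gram a b) / ((norm (q $ 1 *\<^sub>R a + q $ 2 *\<^sub>R b))\<^sup>2 + 1)\<^sup>2)" if q: "0 < q $ 2" for q
  proof -
    note bl = blow_up_tendsto[OF chart_open[OF d] p c1_on_differentiable[OF chart_c1[OF d] p(1)] q e e0, folded f_def]
    have T: "(\<lambda>m. ?T m q) \<longlonglongrightarrow> p" and TE: "\<forall>\<^sub>F m in sequentially. ?T m q \<in> E"
      using bl(1) unfolding filterlim_at by (auto elim: eventually_mono)
    have "(\<lambda>m. W (?T m q)) \<longlonglongrightarrow> W p"
      by (rule continuous_on_tendsto_compose[OF cont(2) T p(1) TE])
    moreover have "(\<lambda>m. (1 / e m) *\<^sub>R (f (?T m q) - y)) \<longlonglongrightarrow> q $ 1 *\<^sub>R a + q $ 2 *\<^sub>R b"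
      using bl(2) unfolding a_def b_def y_def .
    ultimately have "(\<lambda>m. W (?T m q) * (2 / ((norm ((1 / e m) *\<^sub>R (f (?T m q) - y)))\<^sup>2 + 1)\<^sup>2))
        \<longlonglongrightarrow> W p * (2 / ((norm (q $ 1 *\<^sub>R a + q $ 2 *\<^sub>R b))\<^sup>2 + 1)\<^sup>2)"
      by (intro tendsto_intros) (auto simp: add_nonneg_eq_0_iff)
    then have "(\<lambda>m. ennreal (W (?T m q) * (2 / ((norm ((1 / e m) *\<^sub>R (f (?T m q) - y)))\<^sup>2 + 1)\<^sup>2)))
        \<longlonglongrightarrow> ennreal (W p * (2 / ((norm (q $ 1 *\<^sub>R a + q $ 2 *\<^sub>R b))\<^sup>2 + 1)\<^sup>2))"
      by (rule tendsto_ennrealI)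
    moreover have "\<forall>\<^sub>F m in sequentially. ennreal (W (?T m q) * (2 / ((norm ((1 / e m) *\<^sub>R (f (?T m q) - y)))\<^sup>2 + 1)\<^sup>2)) = k m q"
      using TE by eventually_elim (simp add: k_def)
    ultimately show ?thesis using Lim_transform_eventually by (fastforce simp: Wp mult.commute)
  qed
  have k_meas: "k m \<in> borel_measurable lborel" for m
  proof -
    have [measurable]: "h m \<in> borel_measurable borel" by (rule h_meas)
    have "(\<lambda>q. ennreal ((e m)\<^sup>2) * h m (?T m q)) \<in> borel_measurable lborel" by measurable
    then show ?thesis unfolding hk .
  qed
  have "ennreal pi = (\<integral>\<^sup>+q. ennreal (2 * sqrt (gram a b) / ((norm (q $ 1 *\<^sub>R a + q $ 2 *\<^sub>R b))\<^sup>2 + 1)\<^sup>2) * indicator {q. 0 < q $ 2} (q :: real^2) \<partial>lborel)"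
    by (rule half_plane_bubble_integral[OF g, symmetric])
  also have "\<dots> \<le> (\<integral>\<^sup>+q. liminf (\<lambda>m. k m q) \<partial>lborel)"
  proof (rule nn_integral_mono)
    fix q :: "real^2"
    show "ennreal (2 * sqrt (gram a b) / ((norm (q $ 1 *\<^sub>R a + q $ 2 *\<^sub>R b))\<^sup>2 + 1)\<^sup>2) * indicator {q. 0 < q $ 2} q \<le> liminf (\<lambda>m. k m q)"
      using lim_imp_Liminf[OF _ k_lim, of q] by (cases "0 < q $ 2") simp_all
  qed
  also have "\<dots> \<le> liminf (\<lambda>m. \<integral>\<^sup>+q. k m q \<partial>lborel)"
    by (rule nn_integral_liminf[OF k_meas])
  also have "\<dots> \<le> liminf (\<lambda>m. ennreal (L / 2))"
    by (intro Liminf_mono always_eventually allI bound)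
  also have "\<dots> = ennreal (L / 2)" by (simp add: Liminf_const)
  finally have "ennreal pi \<le> ennreal (L / 2)" .
  \<comment> \<open>\<open>ennreal\<close> sends negative reals to 0, so the sign of
    \<open>L / 2\<close> must be known before the inequality is read in the reals; \<pi> > 0
    excludes a negative value.\<close>
  moreover have "\<not> L / 2 < 0"
    using calculation pi_gt_zero by (metis ennreal_le_iff2 less_eq_real_def not_less)
  ultimately have "pi \<le> L / 2" by (simp add: ennreal_le_iff)
  then show ?thesis by (simp add: L_def)
qed

end

theorem corollary5p5:
  fixes M :: "'m::t2_space set" and P :: "'m patch set" and F :: "'m \<Rightarrow> real^'n"
  assumes "free_boundary_minimal_surface M P F"
  shows "area P F \<le> (boundary_length P F)\<^sup>2 / ennreal (4 * pi)"
proof -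
  interpret free_boundary_surface M P F by unfold_locales (rule assms)
  obtain n D X c r where "covered_surface M P F n D X c r" using exists_cover by blast
  then interpret covered_surface M P F n D X c r .
  define A L where "A = area_integral (\<lambda>_. 1)" and "L = length_integral (\<lambda>_. 1)"
  have AL: "2 * A = L" unfolding A_def L_def by (rule twice_area_eq_length)
  have L: "2 * pi \<le> L" unfolding L_def by (rule length_ge_2pi)
  have L0: "0 \<le> L" using L pi_gt_zero by linarith
  \<comment> \<open>With L = 2 A, the bound 2 \<pi> \<le> L multiplied by L is exactly 4 \<pi> A
    \<le> L^2.\<close>
  have "2 * pi * L \<le> L * L" using L L0 by (rule mult_right_mono)
  moreover have "2 * pi * L = A * (4 * pi)" unfolding AL[symmetric] by simp
  ultimately have "A \<le> L\<^sup>2 / (4 * pi)" by (simp add: pos_le_divide_eq power2_eq_square)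
  then have "area P F \<le> ennreal (L\<^sup>2 / (4 * pi))"
    using area_le unfolding A_def[symmetric] by (meson ennreal_leI order_trans)
  also have "\<dots> = (ennreal L)\<^sup>2 / ennreal (4 * pi)"
    using L0 by (simp add: divide_ennreal ennreal_power)
  also have "\<dots> \<le> (boundary_length P F)\<^sup>2 / ennreal (4 * pi)"
    using length_ge unfolding L_def[symmetric] by (intro divide_right_mono_ennreal power_mono) auto
  finally show ?thesis .
qed

end
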